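(* Let $d\in\mathbb{N}$, let $G=\mathbb{Z}^d$ or $G=\mathbb{Z}_+^d$, let $\Sigma$ be a nonempty finite set, let $S\subset\Sigma^G$ be a subshift and let $\varsigma$ be the shift action of $G$ on $S$. If $\mu\in EM(S,\varsigma)$, i.e. $\mu$ is an ergodic $\varsigma$-invariant Borel probability measure on $S$, then $$\mathcal{K}(\omega)=h_{\varsigma}(\mu)\qquad\text{for }\mu\text{-a.e. }\omega\in S,$$ that is, for $\mu$-a.e. $\omega\in S$ the limit $\mathcal{K}(\omega)=\lim_{n\to\infty}\mathsf{K}(\omega\upharpoonright\Lambda_n)/|\Lambda_n|$ exists and equals the Kolmogorov-Sinai entropy $h_{\varsigma}(\mu)$ (computed with $\log_2$).
   Context: **Basic notation.** $\mathbb{N}=\{1,2,\dots\}$, $\mathbb{Z}_+=\{0,1,2,\dots\}$. For $n\in\mathbb{N}$, $\Lambda_n:=\{g=(g_i)_{i=1}^d\in G:|g_i|<n\text{ for all }i\}$, so $|\Lambda_n|=(2n-1)^d$ if $G=\mathbb{Z}^d$ and $|\Lambda_n|=n^d$ if $G=\mathbb{Z}_+^d$. **Shift.** $\Omega:=\Sigma^G$ carries the product topology of the discrete topology on $\Sigma$. For $g\in G$, $\sigma^g:\Omega\to\Omega$ is $(\sigma^g\omega)_i:=\omega_{i+g}$. A subshift is a nonempty closed $S\subset\Omega$ with $\sigma^g(S)=S$ for all $g\in G$; $\varsigma=(\varsigma^g)_{g\in G}$ denotes the restriction of $(\sigma^g)_{g\in G}$ to $S$. $\mathfrak{B}(S)$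 is the Borel $\sigma$-algebra. $M(S,\varsigma)$ is the set of Borel probability measures $\mu$ on $S$ with $\mu((\varsigma^{g})^{-1}A)=\mu(A)$ for all $g\in G$, $A\in\mathfrak{B}(S)$. Such $\mu$ is ergodic if for all $f\in L^1(S,\mu)$, $\lim_{n\to\infty}\frac1{|\Lambda_n|}\sum_{g\in\Lambda_n}f(\varsigma^g x)=\int_S f\,d\mu$ for $\mu$-a.e. $x$. $EM(S,\varsigma)$ is the set of ergodic members of $M(S,\varsigma)$. **Entropy.** A $\mu$-partition is a family $\alpha=\{A_i:i\in I\}$ of measurable sets with $\mu(A_i\cap A_j)=0$ for $i\ne j$, $\mu(S\setminus\bigcup_iA_i)=0$, and $\mu(A_i)>0$ for all $i$. $H(\alpha):=\sum_{A\in\alpha}\varphi(\mu(A))$, with $\varphi(t)=-t\log_2t$ for $t>0$ and $\varphi(0)=0$. $\alpha\vee\beta:=\{A\cap B:A\in\alpha,B\in\beta,\mu(A\cap B)>0\}$, and $\alpha^{\Lambda}:=\bigvee_{g\in\Lambda}\{(\varsigma^g)^{-1}A:A\in\alpha\}$ for finite $\Lambda\subset G$. $h(\mu,\alpha,\varsigma):=\inf_{n>0}\frac{1}{|\Lambda_n|}H(\alpha^{\Lambda_n})$, and $h_{\varsigma}(\mu):=\sup\{h(\mu,\alpha,\varsigma):\alpha\text{ a }\mu\text{-partition with }H(\alpha)<\infty\}$ (Kolmogorov-Sinai entropy). **Prefix Kolmogorov complexity.** Identify $\Sigma$ with $\{0,1,\dots,N\}$. For a nonempty finite alphabet $\mathcal{A}$,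 $\mathcal{A}^*$ is the set of finite strings over $\mathcal{A}$ (including the empty string $\lambda$), $l(x)$ is the length of $x$. A set of strings is prefix-free if no element is a prefix of another element. A partial recursive prefix function $\{0,1\}^*\rightsquigarrow\Sigma^*$ is a partial recursive (Turing computable) function whose domain is prefix-free. For such $\phi$ and $x\in\Sigma^*$, $K_\phi(x):=\min\{l(p):\phi(p)=x\}$ ($\infty$ if $\phi^{-1}(x)=\emptyset$). $\phi$ is additively optimal if for every partial recursive prefix function $\psi:\{0,1\}^*\rightsquigarrow\Sigma^*$ there is a constant $c_{\phi,\psi}\in\mathbb{R}$ with $K_\phi(x)\le K_\psi(x)+c_{\phi,\psi}$ for all $x\in\Sigma^*$. Such functions exist; one is fixed and $K(x):=K_\phi(x)$. **Complexity of patterns.** Fix an arbitrary bijective computable function $f:G\to\mathbb{Z}_+$ (elements of $G$ being encoded as strings in the usual effective way) such that $f(\Lambda_n)=\{0,1,\dots,|\Lambda_n|-1\}$ for all $n\in\mathbb{N}$. For $s=(s_g)_{g\in\Lambda_n}\in\Sigma^{\Lambda_n}$ put $\mathcal{G}(s):=s_{f^{-1}(0)}\cdots s_{f^{-1}(|\Lambda_n|-1)}\in\Sigma^*$ and $\mathsf{K}(s):=K(\mathcal{G}(s))$. **Complexity density.** For $\omega\in\Omega$, $\overline{\mathcal{K}}(\omega):=\limsup_{n\to\infty}\mathsf{K}(\omega\upharpoonright\Lambda_n)/|\Lambda_n|$ and $\underline{\mathcal{K}}(\omega):=\liminf_{n\to\infty}\mathsf{K}(\omega\upharpoonright\Lambda_n)/|\Lambda_n|$,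 where $\omega\upharpoonright\Lambda_n$ is the restriction of $\omega$ to $\Lambda_n$; if they coincide, the common value is $\mathcal{K}(\omega)$. *)

theory Defs
  imports "HOL-Probability.Probability" "HOL-Library.Sublist" "HOL-Library.Nat_Bijection"
begin

section \<open>Partial recursive functions\<close>

text \<open>Kleene's partial recursive functions. A term denotes a partial function on argument
  lists; for every arity k, its restriction to lists of length k is a k-ary partial recursive
  function, and every such function arises in this way. The recursion variable of
  \<open>PrimRec\<close> and the search variable of \<open>Minimize\<close> come first in the argument list.\<close>

datatype recf =
    Zero
  | Succ
  | Proj nat
  | Comp recf "recf list"
  | PrimRec recf recf
  | Minimize recf

fun rec_eval :: "recf \<Rightarrow> nat list \<Rightarrow> nat option" where
  "rec_eval Zero xs = Some 0"
| "rec_eval Succ xs = (case xs of [] \<Rightarrow> None | x # _ \<Rightarrow> Some (Suc x))"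
| "rec_eval (Proj i) xs = (if i < length xs then Some (xs ! i) else None)"
| "rec_eval (Comp f gs) xs =
     Option.bind (those (map (\<lambda>g. rec_eval g xs) gs)) (\<lambda>ys. rec_eval f ys)"
| "rec_eval (PrimRec f g) xs =
     (case xs of
        [] \<Rightarrow> None
      | n # ys \<Rightarrow>
          rec_nat (rec_eval f ys) (\<lambda>m r. Option.bind r (\<lambda>y. rec_eval g (m # y # ys))) n)"
| "rec_eval (Minimize f) xs =
     (if \<exists>n. rec_eval f (n # xs) = Some 0 \<and> (\<forall>m<n. \<exists>y. rec_eval f (m # xs) = Some (Suc y))
      then Some (LEAST n. rec_eval f (n # xs) = Some 0)
      else None)"

section \<open>Prefix Kolmogorov complexity\<close>

text \<open>Binary strings are of type \<^typ>\<open>bool list\<close>. The alphabet is a finite type, identified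
  with {0,...,N} by a bijection \<open>num\<close>. Computability on strings is computability
  on the numbers coding them by \<^const>\<open>list_encode\<close>.\<close>

definition partial_recursive :: "('a \<Rightarrow> nat) \<Rightarrow> (bool list \<Rightarrow> 'a list option) \<Rightarrow> bool" where
  "partial_recursive num \<phi> \<longleftrightarrow>
     (\<exists>r. \<forall>p. rec_eval r [list_encode (map of_bool p)]
              = map_option (\<lambda>x. list_encode (map num x)) (\<phi> p))"

definition prefix_free :: "'b list set \<Rightarrow> bool" where
  "prefix_free A \<longleftrightarrow> (\<forall>x\<in>A. \<forall>y\<in>A. prefix x y \<longrightarrow> x = y)"

definition partial_recursive_prefix ::
    "('a \<Rightarrow> nat) \<Rightarrow> (bool list \<Rightarrow> 'a list option) \<Rightarrow> bool" where
  "partial_recursive_prefix num \<phi> \<longleftrightarrow> partial_recursive num \<phi> \<and> prefix_free (dom \<phi>)"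

text \<open>The infimum in \<^typ>\<open>enat\<close> is a minimum, or \<open>\<infinity>\<close> if there is no program for \<open>x\<close>.\<close>

definition kolm :: "(bool list \<Rightarrow> 'a list option) \<Rightarrow> 'a list \<Rightarrow> enat" where
  "kolm \<phi> x = (INF p\<in>{p. \<phi> p = Some x}. enat (length p))"

definition additively_optimal ::
    "('a \<Rightarrow> nat) \<Rightarrow> (bool list \<Rightarrow> 'a list option) \<Rightarrow> bool" where
  "additively_optimal num \<phi> \<longleftrightarrow>
     partial_recursive_prefix num \<phi> \<and>
     (\<forall>\<psi>. partial_recursive_prefix num \<psi> \<longrightarrow>
        (\<exists>c::real. \<forall>x. ereal_of_enat (kolm \<phi> x) \<le> ereal_of_enat (kolm \<psi> x) + ereal c))"

section \<open>The index set and complexity densities\<close>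

text \<open>The index set \<open>G\<close> is a subset of \<^typ>\<open>int ^ 'd\<close>: everything or the nonnegative vectors.\<close>

definition Lam :: "(int ^ 'd) set \<Rightarrow> nat \<Rightarrow> (int ^ 'd) set" where
  "Lam G n = {g \<in> G. \<forall>i. \<bar>g $ i\<bar> < int n}"

text \<open>The coordinates are listed in the order given by the enumeration \<^const>\<open>from_nat_into\<close>
  of the finite type \<open>'d\<close>; the choice of order does not affect which functions are
  computable.\<close>

definition vec_code :: "int ^ 'd \<Rightarrow> nat" where
  "vec_code g = list_encode (map (\<lambda>k. int_encode (g $ from_nat_into UNIV k)) [0..<CARD('d)])"

definition computable_index :: "(int ^ 'd) set \<Rightarrow> (int ^ 'd \<Rightarrow> nat) \<Rightarrow> bool" where
  "computable_index G f \<longleftrightarrow> (\<exists>r. \<forall>g\<in>G. rec_eval r [vec_code g] = Some (f g))"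

definition admissible_enum :: "(int ^ 'd) set \<Rightarrow> (int ^ 'd \<Rightarrow> nat) \<Rightarrow> bool" where
  "admissible_enum G f \<longleftrightarrow>
     bij_betw f G UNIV \<and> computable_index G f \<and>
     (\<forall>n\<ge>1. f ` Lam G n = {..<card (Lam G n)})"

definition pattern_string ::
    "(int ^ 'd) set \<Rightarrow> (int ^ 'd \<Rightarrow> nat) \<Rightarrow> nat \<Rightarrow> (int ^ 'd \<Rightarrow> 'a) \<Rightarrow> 'a list" where
  "pattern_string G f n s = map (\<lambda>k. s (inv_into G f k)) [0..<card (Lam G n)]"

definition pattern_complexity ::
    "(bool list \<Rightarrow> 'a list option) \<Rightarrow> (int ^ 'd) set \<Rightarrow> (int ^ 'd \<Rightarrow> nat) \<Rightarrow> nat \<Rightarrow>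
     (int ^ 'd \<Rightarrow> 'a) \<Rightarrow> enat" where
  "pattern_complexity \<phi> G f n s = kolm \<phi> (pattern_string G f n s)"

definition upper_complexity_density ::
    "(bool list \<Rightarrow> 'a list option) \<Rightarrow> (int ^ 'd) set \<Rightarrow> (int ^ 'd \<Rightarrow> nat) \<Rightarrow>
     (int ^ 'd \<Rightarrow> 'a) \<Rightarrow> ennreal" where
  "upper_complexity_density \<phi> G f \<omega> =
     limsup (\<lambda>n. ennreal_of_enat (pattern_complexity \<phi> G f n (restrict \<omega> (Lam G n)))
                 / of_nat (card (Lam G n)))"

definition lower_complexity_density ::
    "(bool list \<Rightarrow> 'a list option) \<Rightarrow> (int ^ 'd) set \<Rightarrow> (int ^ 'd \<Rightarrow> nat) \<Rightarrow>
     (int ^ 'd \<Rightarrow> 'a) \<Rightarrow> ennreal" where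
  "lower_complexity_density \<phi> G f \<omega> =
     liminf (\<lambda>n. ennreal_of_enat (pattern_complexity \<phi> G f n (restrict \<omega> (Lam G n)))
                 / of_nat (card (Lam G n)))"

section \<open>Subshifts and their ergodic measures\<close>

text \<open>Configurations are the extensional functions on \<open>G\<close>, the points of \<open>full_shift G\<close>.\<close>

definition full_shift :: "(int ^ 'd) set \<Rightarrow> (int ^ 'd \<Rightarrow> 'a) topology" where
  "full_shift G = product_topology (\<lambda>_. discrete_topology UNIV) G"

definition shift :: "(int ^ 'd) set \<Rightarrow> int ^ 'd \<Rightarrow> (int ^ 'd \<Rightarrow> 'a) \<Rightarrow> (int ^ 'd \<Rightarrow> 'a)" where
  "shift G g \<omega> = (\<lambda>i\<in>G. \<omega> (i + g))"

definition subshift :: "(int ^ 'd) set \<Rightarrow> (int ^ 'd \<Rightarrow> 'a) set \<Rightarrow> bool" where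
  "subshift G S \<longleftrightarrow>
     S \<noteq> {} \<and> closedin (full_shift G) S \<and> (\<forall>g\<in>G. shift G g ` S = S)"

definition borel_subshift ::
    "(int ^ 'd) set \<Rightarrow> (int ^ 'd \<Rightarrow> 'a) set \<Rightarrow> (int ^ 'd \<Rightarrow> 'a) measure" where
  "borel_subshift G S = sigma S {U. openin (subtopology (full_shift G) S) U}"

definition invariant_measures ::
    "(int ^ 'd) set \<Rightarrow> (int ^ 'd \<Rightarrow> 'a) set \<Rightarrow> (int ^ 'd \<Rightarrow> 'a) measure set" where
  "invariant_measures G S =
     {\<mu>. prob_space \<mu> \<and> space \<mu> = S \<and> sets \<mu> = sets (borel_subshift G S) \<and>
         (\<forall>g\<in>G. \<forall>A\<in>sets \<mu>. emeasure \<mu> (shift G g -` A \<inter> space \<mu>) = emeasure \<mu> A)}"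

definition ergodic_measures ::
    "(int ^ 'd) set \<Rightarrow> (int ^ 'd \<Rightarrow> 'a) set \<Rightarrow> (int ^ 'd \<Rightarrow> 'a) measure set" where
  "ergodic_measures G S =
     {\<mu> \<in> invariant_measures G S.
        \<forall>f :: (int ^ 'd \<Rightarrow> 'a) \<Rightarrow> real. integrable \<mu> f \<longrightarrow>
          (AE x in \<mu>. (\<lambda>n. (\<Sum>g\<in>Lam G n. f (shift G g x)) / real (card (Lam G n)))
                       \<longlonglongrightarrow> integral\<^sup>L \<mu> f)}"

section \<open>Kolmogorov-Sinai entropy\<close>

text \<open>A partition is automatically countable, since its members are disjoint up to null sets
  and have positive measure. For the same reason a family satisfying these conditions has no
  repeated members, so it can be treated as a set.\<close>

definition mu_partition :: "'b measure \<Rightarrow> 'b set set \<Rightarrow> bool" where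
  "mu_partition \<mu> \<alpha> \<longleftrightarrow>
     \<alpha> \<subseteq> sets \<mu> \<and>
     (\<forall>A\<in>\<alpha>. \<forall>B\<in>\<alpha>. A \<noteq> B \<longrightarrow> measure \<mu> (A \<inter> B) = 0) \<and>
     measure \<mu> (space \<mu> - \<Union>\<alpha>) = 0 \<and>
     (\<forall>A\<in>\<alpha>. measure \<mu> A > 0)"

definition ent_fun :: "real \<Rightarrow> real" where
  "ent_fun t = (if t > 0 then - t * log 2 t else 0)"

definition part_entropy :: "'b measure \<Rightarrow> 'b set set \<Rightarrow> ennreal" where
  "part_entropy \<mu> \<alpha> = (\<Sum>\<^sub>\<infinity>A\<in>\<alpha>. ennreal (ent_fun (measure \<mu> A)))"

text \<open>The finite join over \<open>g \<in> \<Lambda>\<close> of the partitions \<open>{(\<sigma>\<^sup>g)\<inverse> A | A \<in> \<alpha>}\<close>, i.e. the iterated binary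
  join: all non-null intersections with one member chosen from each partition.\<close>

definition part_refine ::
    "(int ^ 'd) set \<Rightarrow> (int ^ 'd \<Rightarrow> 'a) measure \<Rightarrow> (int ^ 'd) set \<Rightarrow>
     (int ^ 'd \<Rightarrow> 'a) set set \<Rightarrow> (int ^ 'd \<Rightarrow> 'a) set set" where
  "part_refine G \<mu> \<Lambda> \<alpha> =
     {C. \<exists>A. (\<forall>g\<in>\<Lambda>. A g \<in> \<alpha>) \<and> C = space \<mu> \<inter> (\<Inter>g\<in>\<Lambda>. shift G g -` A g) \<and> measure \<mu> C > 0}"

definition entropy_wrt ::
    "(int ^ 'd) set \<Rightarrow> (int ^ 'd \<Rightarrow> 'a) measure \<Rightarrow> (int ^ 'd \<Rightarrow> 'a) set set \<Rightarrow> ennreal" where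
  "entropy_wrt G \<mu> \<alpha> =
     (INF n\<in>{0<..}. part_entropy \<mu> (part_refine G \<mu> (Lam G n) \<alpha>) / of_nat (card (Lam G n)))"

definition ks_entropy :: "(int ^ 'd) set \<Rightarrow> (int ^ 'd \<Rightarrow> 'a) measure \<Rightarrow> ennreal" where
  "ks_entropy G \<mu> = (SUP \<alpha>\<in>{\<alpha>. mu_partition \<mu> \<alpha> \<and> part_entropy \<mu> \<alpha> < \<infinity>}. entropy_wrt G \<mu> \<alpha>)"

end

theory Submission
  imports Defs
begin

text \<open>For a finite set \<open>A\<close> of sites that precede a site \<open>u\<close> in the lexicographic order, let \<open>h u A\<close> be the
  conditional entropy of the symbol at \<open>u\<close> given the symbols on \<open>A\<close>, and let the entropy rate be the infimum
  of these numbers. It equals the Kolmogorov-Sinai entropy: the chain rule bounds the entropy of a box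
  from both sides, and a countable partition of finite entropy is coded with small expected cost by
  guessing the cell from the symbols in a large window.

  Upper bound: rational approximations of the conditional probabilities of \<open>u\<close> given \<open>A\<close> form a finite
  table, and the product of the table entries over all translates inside a box is a computable weight
  on strings that satisfies Kraft's inequality. A Shannon-Fano-Elias code, decoded by unbounded
  search, shows that the complexity is at most minus the logarithm of the weight; the ergodic theorem
  evaluates that logarithm.

  Lower bound: in a huge finite box let \<open>p\<^sub>g\<close> be the conditional probability of the symbol at \<open>g\<close> given all
  smaller sites of the box. There are at most \<open>2\<^sup>j\<close> programs of length less than \<open>j\<close>, so a pattern of
  small complexity forces the product of the \<open>p\<^sub>g\<close> over the pattern to be exponentially small outside a
  small set. If \<open>h u A\<close> is close to the entropy rate, then \<open>p\<^sub>g\<close> is close in relative entropy to the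
  conditional probability \<open>r\<^sub>g\<close> given the translate of \<open>A\<close> only. A Vitali covering argument, averaged over
  the base point of the pattern, makes this comparison uniform in the size of the pattern, and the
  ergodic theorem applies to the \<open>r\<^sub>g\<close>. Working in finite boxes avoids the natural
  extension when the index set is the orthant.\<close>

section \<open>Computable functions\<close>

text \<open>The obstacle in the lower bound is that \<open>p\<^sub>g\<close> depends on the position
  of \<open>g\<close> in the box, so the ergodic theorem says nothing about these factors; and their
  mean distance from \<open>r\<^sub>g\<close> is small but has no rate that could be summed over all
  pattern sizes. The way out is the gap \<open>r - 1 - ln r\<close> of the ratio
  \<open>r = r\<^sub>g / p\<^sub>g\<close>. It is nonnegative, and its mean is at most
  \<open>ln 2\<close> times \<open>h u A - entropy_rate\<close> in every box. Nonnegativity and a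
  uniform bound on the mean are what a maximal inequality asks for. It controls all sizes up to a
  given bound at once, and the finite box may be chosen after that bound, because an almost sure
  statement needs only estimates that are uniform over finite ranges of sizes. Infima over finite
  pasts take the place of conditioning on an infinite past. The only ergodic input is therefore the
  convergence of averages, applied to one function of finitely many coordinates at a time.\<close>

definition recfn :: "nat \<Rightarrow> (nat list \<Rightarrow> nat) \<Rightarrow> bool" where
  "recfn n F \<longleftrightarrow> (\<exists>r. \<forall>xs. length xs = n \<longrightarrow> rec_eval r xs = Some (F xs))"

lemma recfn_cong:
  assumes "recfn n F" "\<And>xs. length xs = n \<Longrightarrow> F xs = G xs"
  shows "recfn n G"
  using assms unfolding recfn_def by metis

lemma recfn_const: "recfn n (\<lambda>_. c)"
proof (induction c)
  case 0
  show ?case unfolding recfn_def by (rule exI[of _ Zero]) simp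
next
  case (Suc c)
  then obtain r where "\<forall>xs. length xs = n \<longrightarrow> rec_eval r xs = Some c"
    unfolding recfn_def by blast
  then show ?case unfolding recfn_def by (intro exI[of _ "Comp Succ [r]"]) simp
qed

lemma recfn_nth: "i < n \<Longrightarrow> recfn n (\<lambda>xs. xs ! i)"
  unfolding recfn_def by (intro exI[of _ "Proj i"]) simp

lemma recfn_comp:
  assumes F: "recfn (length Gs) F" and Gs: "\<And>G. G \<in> set Gs \<Longrightarrow> recfn n G"
  shows "recfn n (\<lambda>xs. F (map (\<lambda>G. G xs) Gs))"
proof -
  obtain r where r: "\<And>xs. length xs = length Gs \<Longrightarrow> rec_eval r xs = Some (F xs)"
    using F unfolding recfn_def by blast
  have "\<exists>rs. \<forall>xs. length xs = n \<longrightarrow> those (map (\<lambda>g. rec_eval g xs) rs) = Some (map (\<lambda>G. G xs) Gs)"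
    using Gs
  proof (induction Gs)
    case Nil
    show ?case by (intro exI[of _ "[]"]) simp
  next
    case (Cons G Gs)
    then obtain rs where rs: "\<And>xs. length xs = n \<Longrightarrow>
        those (map (\<lambda>g. rec_eval g xs) rs) = Some (map (\<lambda>G. G xs) Gs)"
      by (metis list.set_intros(2))
    obtain q where q: "\<And>xs. length xs = n \<Longrightarrow> rec_eval q xs = Some (G xs)"
      using Cons.prems[of G] unfolding recfn_def by auto
    show ?case using rs q by (intro exI[of _ "q # rs"]) simp
  qed
  then obtain rs where rs: "\<And>xs. length xs = n \<Longrightarrow>
        those (map (\<lambda>g. rec_eval g xs) rs) = Some (map (\<lambda>G. G xs) Gs)"
    by blast
  show ?thesis unfolding recfn_def
    by (intro exI[of _ "Comp r rs"]) (simp add: rs r)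
qed

definition computable1 :: "(nat \<Rightarrow> nat) \<Rightarrow> bool" where
  "computable1 g \<longleftrightarrow> recfn 1 (\<lambda>xs. g (xs ! 0))"

definition computable2 :: "(nat \<Rightarrow> nat \<Rightarrow> nat) \<Rightarrow> bool" where
  "computable2 g \<longleftrightarrow> recfn 2 (\<lambda>xs. g (xs ! 0) (xs ! 1))"

definition computable3 :: "(nat \<Rightarrow> nat \<Rightarrow> nat \<Rightarrow> nat) \<Rightarrow> bool" where
  "computable3 g \<longleftrightarrow> recfn 3 (\<lambda>xs. g (xs ! 0) (xs ! 1) (xs ! 2))"

lemma recfn_app1: "computable1 g \<Longrightarrow> recfn n F \<Longrightarrow> recfn n (\<lambda>xs. g (F xs))"
  using recfn_comp[of "[F]" "\<lambda>xs. g (xs ! 0)" n] by (simp add: computable1_def)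

lemma recfn_app2:
  "computable2 g \<Longrightarrow> recfn n F \<Longrightarrow> recfn n G \<Longrightarrow> recfn n (\<lambda>xs. g (F xs) (G xs))"
  using recfn_comp[of "[F, G]" "\<lambda>xs. g (xs ! 0) (xs ! 1)" n]
  by (auto simp: computable2_def numeral_2_eq_2)

lemma recfn_app3:
  "computable3 g \<Longrightarrow> recfn n F \<Longrightarrow> recfn n G \<Longrightarrow> recfn n H
    \<Longrightarrow> recfn n (\<lambda>xs. g (F xs) (G xs) (H xs))"
  using recfn_comp[of "[F, G, H]" "\<lambda>xs. g (xs ! 0) (xs ! 1) (xs ! 2)" n]
  by (auto simp: computable3_def numeral_3_eq_3 numeral_2_eq_2)

lemma recfn_prim:
  assumes B: "recfn n B" and T: "recfn (Suc (Suc n)) T"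
    and f0: "\<And>xs. f (0 # xs) = B xs"
    and fS: "\<And>m xs. f (Suc m # xs) = T (m # f (m # xs) # xs)"
  shows "recfn (Suc n) f"
proof -
  obtain b where b: "\<And>xs. length xs = n \<Longrightarrow> rec_eval b xs = Some (B xs)"
    using B unfolding recfn_def by blast
  obtain t where t: "\<And>xs. length xs = Suc (Suc n) \<Longrightarrow> rec_eval t xs = Some (T xs)"
    using T unfolding recfn_def by blast
  have "rec_nat (rec_eval b ys) (\<lambda>m r. Option.bind r (\<lambda>y. rec_eval t (m # y # ys))) m
        = Some (f (m # ys))" if "length ys = n" for m ys
    by (induction m) (simp_all add: b t that f0 fS)
  then have "rec_eval (PrimRec b t) xs = Some (f xs)" if "length xs = Suc n" for xs
    using that by (cases xs) simp_all
  then show ?thesis unfolding recfn_def by blast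
qed

lemma computable1_prim:
  assumes "computable2 t" and "\<And>m. f (Suc m) = t m (f m)"
  shows "computable1 f"
  unfolding computable1_def One_nat_def
  by (rule recfn_prim[of 0 "\<lambda>_. f 0" "\<lambda>xs. t (xs ! 0) (xs ! 1)"])
     (use assms in \<open>simp_all add: recfn_const computable2_def numeral_2_eq_2\<close>)

lemma computable2_prim:
  assumes "computable1 b" "computable3 t" and "\<And>a. f 0 a = b a"
    and "\<And>m a. f (Suc m) a = t m (f m a) a"
  shows "computable2 f"
  unfolding computable2_def numeral_2_eq_2
  by (rule recfn_prim[of 1 "\<lambda>xs. b (xs ! 0)" "\<lambda>xs. t (xs ! 0) (xs ! 1) (xs ! 2)", simplified])
     (use assms in \<open>simp_all add: computable1_def computable3_def numeral_3_eq_3 numeral_2_eq_2\<close>)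

lemma computable3_prim:
  assumes "recfn 2 (\<lambda>xs. b (xs ! 0) (xs ! 1))"
    and "recfn 4 (\<lambda>xs. t (xs ! 0) (xs ! 1) (xs ! 2) (xs ! 3))"
    and "\<And>u v. f 0 u v = b u v"
    and "\<And>m u v. f (Suc m) u v = t m (f m u v) u v"
  shows "computable3 f"
  unfolding computable3_def
  using recfn_prim[of 2 "\<lambda>xs. b (xs ! 0) (xs ! 1)" "\<lambda>xs. t (xs ! 0) (xs ! 1) (xs ! 2) (xs ! 3)"
    "\<lambda>xs. f (xs ! 0) (xs ! 1) (xs ! 2)"] assms
  by (simp add: eval_nat_numeral)

text \<open>\<open>Minimize\<close> demands that the values before the zero be defined and positive.
  This is automatic here: \<open>F\<close> is total, and no value below the least zero is 0.\<close>

lemma recfn_least: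
  assumes F: "recfn (Suc n) F" and ex: "\<And>xs. length xs = n \<Longrightarrow> \<exists>m. F (m # xs) = 0"
  shows "recfn n (\<lambda>xs. LEAST m. F (m # xs) = 0)"
proof -
  obtain r where r: "\<And>xs. length xs = Suc n \<Longrightarrow> rec_eval r xs = Some (F xs)"
    using F unfolding recfn_def by blast
  have "rec_eval (Minimize r) xs = Some (LEAST m. F (m # xs) = 0)" if xs: "length xs = n" for xs
  proof -
    have "F ((LEAST m. F (m # xs) = 0) # xs) = 0" using ex[OF xs] by (rule LeastI_ex)
    moreover have "\<forall>k<(LEAST m. F (m # xs) = 0). \<exists>y. F (k # xs) = Suc y"
      using not_less_Least not0_implies_Suc by blast
    ultimately show ?thesis using xs r by auto
  qed
  then show ?thesis unfolding recfn_def by blast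
qed

section \<open>Arithmetic, truth values and bounded search\<close>

lemma computable_Suc: "computable1 Suc"
  unfolding computable1_def recfn_def by (intro exI[of _ Succ]) (auto simp: length_Suc_conv)

lemmas rec_base = recfn_const recfn_nth recfn_app1[OF computable_Suc]

lemma computable_add: "computable2 (+)"
  by (rule computable2_prim[of "\<lambda>a. a" "\<lambda>m y a. Suc y"])
     (simp_all add: computable1_def computable3_def rec_base)

lemma computable_mult: "computable2 (*)"
  by (rule computable2_prim[of "\<lambda>a. 0" "\<lambda>m y a. a + y"])
     (simp_all add: computable1_def computable3_def rec_base recfn_app2[OF computable_add])

text \<open>The recursion variable comes first, so the exponent here and the subtrahend in
  \<open>computable_monus\<close> precede the other argument.\<close>

lemma computable_pow: "computable2 (\<lambda>n a. a ^ n)"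
  by (rule computable2_prim[of "\<lambda>a. 1" "\<lambda>m y a. a * y"])
     (simp_all add: computable1_def computable3_def rec_base recfn_app2[OF computable_mult])

lemma computable_pred: "computable1 (\<lambda>n. n - 1)"
  by (rule computable1_prim[of "\<lambda>m y. m"]) (simp_all add: computable2_def rec_base)

lemma computable_monus: "computable2 (\<lambda>n a. a - n)"
  by (rule computable2_prim[of "\<lambda>a. a" "\<lambda>m y a. y - 1"])
     (simp_all add: computable1_def computable3_def rec_base recfn_app1[OF computable_pred, unfolded One_nat_def])

lemma recfn_diff: "recfn n F \<Longrightarrow> recfn n G \<Longrightarrow> recfn n (\<lambda>xs. F xs - G xs)"
  by (rule recfn_app2[OF computable_monus])

lemma recfn_power: "recfn n F \<Longrightarrow> recfn n G \<Longrightarrow> recfn n (\<lambda>xs. F xs ^ G xs)"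
  by (rule recfn_app2[OF computable_pow])

lemmas rec_arith = rec_base recfn_app2[OF computable_add] recfn_app2[OF computable_mult]
  recfn_diff recfn_power

lemma recfn_not: "recfn n (\<lambda>xs. of_bool (P xs)) \<Longrightarrow> recfn n (\<lambda>xs. of_bool (\<not> P xs))"
  by (rule recfn_cong[of n "\<lambda>xs. 1 - of_bool (P xs)"]) (intro rec_arith, simp_all)

lemma recfn_conj:
  "recfn n (\<lambda>xs. of_bool (P xs)) \<Longrightarrow> recfn n (\<lambda>xs. of_bool (Q xs))
    \<Longrightarrow> recfn n (\<lambda>xs. of_bool (P xs \<and> Q xs))"
  by (rule recfn_cong[of n "\<lambda>xs. of_bool (P xs) * of_bool (Q xs)"]) (intro rec_arith, simp_all)

text \<open>Subtraction is truncated, so \<open>F xs - G xs\<close> vanishes exactly when the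
  inequality holds.\<close>

lemma recfn_le:
  "recfn n F \<Longrightarrow> recfn n G \<Longrightarrow> recfn n (\<lambda>xs. of_bool (F xs \<le> G xs))"
  by (rule recfn_cong[of n "\<lambda>xs. 1 - (F xs - G xs)"]) (intro rec_arith, simp_all)

lemma recfn_less:
  "recfn n F \<Longrightarrow> recfn n G \<Longrightarrow> recfn n (\<lambda>xs. of_bool (F xs < G xs))"
  by (rule recfn_cong[of n "\<lambda>xs. of_bool (\<not> G xs \<le> F xs)"])
     (intro recfn_not recfn_le, simp_all add: not_le)

lemma recfn_eq:
  "recfn n F \<Longrightarrow> recfn n G \<Longrightarrow> recfn n (\<lambda>xs. of_bool (F xs = G xs))"
  by (rule recfn_cong[of n "\<lambda>xs. of_bool (F xs \<le> G xs \<and> G xs \<le> F xs)"])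
     (intro recfn_conj recfn_le, auto)

lemma recfn_if:
  "recfn n (\<lambda>xs. of_bool (P xs)) \<Longrightarrow> recfn n F \<Longrightarrow> recfn n G
    \<Longrightarrow> recfn n (\<lambda>xs. if P xs then F xs else G xs)"
  by (rule recfn_cong[of n "\<lambda>xs. of_bool (P xs) * F xs + of_bool (\<not> P xs) * G xs"])
     (intro rec_arith recfn_not, simp_all)

lemmas rec_intros = rec_arith recfn_not recfn_conj recfn_le recfn_less recfn_eq recfn_if

text \<open>Sums of truth values also serve as bounded quantifiers: a positive sum stands for
  existence, a zero sum of counterexamples for universality.\<close>

lemma computable2_sum:
  assumes "computable2 g"
  shows "computable2 (\<lambda>n a. \<Sum>i<n. g i a)"
proof (rule computable2_prim[of "\<lambda>a. 0" "\<lambda>m y a. y + g m a"])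
  show "computable3 (\<lambda>m y a. y + g m a)" unfolding computable3_def
    by (intro rec_intros recfn_app2[OF assms]) simp_all
qed (simp_all add: computable1_def rec_base)

lemma computable2_prod:
  assumes "computable2 g"
  shows "computable2 (\<lambda>n a. \<Prod>i<n. g i a)"
proof (rule computable2_prim[of "\<lambda>a. 1" "\<lambda>m y a. y * g m a"])
  show "computable3 (\<lambda>m y a. y * g m a)" unfolding computable3_def
    by (intro rec_intros recfn_app2[OF assms]) simp_all
qed (simp_all add: computable1_def rec_base)

lemma computable1_sum:
  assumes "computable1 g"
  shows "computable1 (\<lambda>n. \<Sum>i<n. g i)"
proof (rule computable1_prim[of "\<lambda>m y. y + g m"])
  show "computable2 (\<lambda>m y. y + g m)" unfolding computable2_def
    by (intro rec_intros recfn_app1[OF assms]) simp_all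
qed simp

lemma computable1_least:
  assumes "computable2 (\<lambda>m a. of_bool (P m a))" and "\<And>a. \<exists>m. P m a"
  shows "computable1 (\<lambda>a. LEAST m. P m a)"
proof -
  have "recfn 1 (\<lambda>xs. LEAST m. of_bool (\<not> P ((m # xs) ! 0) ((m # xs) ! 1)) = (0::nat))"
    by (rule recfn_least)
       (use assms in \<open>auto simp: computable2_def numeral_2_eq_2 intro!: recfn_not\<close>)
  then show ?thesis unfolding computable1_def by simp
qed

text \<open>The quotient is the number of positive multiples of \<open>b\<close> that do not exceed
  \<open>a\<close>; for \<open>b > 0\<close> it suffices to try \<open>i < a\<close>. The divisor 0
  is treated apart, since the count would then be \<open>a\<close> instead of 0.\<close>

lemma computable_div: "computable2 (\<lambda>a b. a div b)"
proof -
  have t3: "computable3 (\<lambda>n a b. \<Sum>i<n. of_bool (Suc i * b \<le> a))"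
  proof (rule computable3_prim[of "\<lambda>_ _. 0" "\<lambda>m y a b. y + of_bool (Suc m * b \<le> a)"])
    show "recfn 4 (\<lambda>xs. xs ! 1 + of_bool (Suc (xs ! 0) * xs ! 3 \<le> xs ! 2))"
      by (intro rec_intros) simp_all
  qed (simp_all add: recfn_const)
  have eq: "(\<Sum>i<a. of_bool (Suc i * b \<le> a)) = a div b" if "b > 0" for a b :: nat
  proof -
    have "{i. i < a \<and> Suc i * b \<le> a} = {..<a div b}"
    proof (intro set_eqI iffI)
      fix i assume "i \<in> {i. i < a \<and> Suc i * b \<le> a}"
      then show "i \<in> {..<a div b}" using that
        by (metis (no_types, lifting) Suc_le_eq lessThan_iff less_eq_div_iff_mult_less_eq mem_Collect_eq)
    next
      fix i assume "i \<in> {..<a div b}"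
      then have "Suc i * b \<le> a" using that
        by (metis Suc_le_eq lessThan_iff less_eq_div_iff_mult_less_eq)
      moreover have "Suc i \<le> Suc i * b" using that by (cases b) auto
      ultimately show "i \<in> {i. i < a \<and> Suc i * b \<le> a}" by simp
    qed
    moreover have "(\<Sum>i<a. of_bool (Suc i * b \<le> a)) = card {i. i < a \<and> Suc i * b \<le> a}"
      by (simp add: of_bool_def sum.If_cases Int_def)
    ultimately show ?thesis by simp
  qed
  have "recfn 2 (\<lambda>xs. if xs ! 1 = 0 then 0 else \<Sum>i<xs ! 0. of_bool (Suc i * xs ! 1 \<le> xs ! 0))"
    by (intro rec_intros recfn_app3[OF t3]) simp_all
  then show ?thesis unfolding computable2_def
  proof (rule recfn_cong)
    fix xs :: "nat list"
    show "(if xs ! 1 = 0 then 0 else \<Sum>i<xs ! 0. of_bool (Suc i * xs ! 1 \<le> xs ! 0))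
        = xs ! 0 div xs ! 1"
      using eq[of "xs ! 1" "xs ! 0"] by (cases "xs ! 1 = 0") (simp, metis neq0_conv)
  qed
qed

lemma recfn_div: "recfn n F \<Longrightarrow> recfn n G \<Longrightarrow> recfn n (\<lambda>xs. F xs div G xs)"
  by (rule recfn_app2[OF computable_div])

lemma computable_odd: "computable1 (\<lambda>a. of_bool (odd a))"
  unfolding computable1_def
  by (rule recfn_cong[of 1 "\<lambda>xs. xs ! 0 - 2 * (xs ! 0 div 2)"])
     (intro rec_intros recfn_div, simp_all add: minus_mult_div_eq_mod of_bool_odd_eq_mod_2)

section \<open>Pairs and lists coded as numbers\<close>

lemma computable_prod_encode: "computable2 (\<lambda>a b. prod_encode (a, b))"
proof -
  have t: "computable1 triangle"
    by (rule computable1_prim[of "\<lambda>m y. y + Suc m"])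
       (unfold computable2_def, intro rec_intros, simp_all)
  show ?thesis unfolding computable2_def prod_encode_def
    by (auto intro!: rec_intros recfn_app1[OF t])
qed

text \<open>The pairing is inverted by search. The second component is at most \<open>z\<close>, so
  its search is a bounded sum, and the first component is found by an always successful
  minimization.\<close>

lemma computable_fst: "computable1 (\<lambda>z. fst (prod_decode z))"
proof -
  have 1: "computable3 (\<lambda>n a z. \<Sum>b<n. of_bool (prod_encode (a, b) = z))"
  proof (rule computable3_prim[of "\<lambda>_ _. 0" "\<lambda>m y a z. y + of_bool (prod_encode (a, m) = z)"])
    show "recfn 4 (\<lambda>xs. xs ! 1 + of_bool (prod_encode (xs ! 2, xs ! 0) = xs ! 3))"
      by (intro rec_intros recfn_app2[OF computable_prod_encode]) simp_all
  qed (simp_all add: recfn_const)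
  have iff: "0 < (\<Sum>b<Suc z. of_bool (prod_encode (a, b) = z) :: nat) \<longleftrightarrow> a = fst (prod_decode z)" for a z
  proof
    assume "0 < (\<Sum>b<Suc z. of_bool (prod_encode (a, b) = z) :: nat)"
    then have "(\<Sum>b<Suc z. of_bool (prod_encode (a, b) = z) :: nat) \<noteq> 0" by linarith
    then obtain b where "of_bool (prod_encode (a, b) = z) \<noteq> (0::nat)"
      by (rule sum.not_neutral_contains_not_neutral)
    then have "prod_encode (a, b) = z" by (auto split: if_splits)
    then show "a = fst (prod_decode z)" by auto
  next
    assume a: "a = fst (prod_decode z)"
    obtain c b where "prod_decode z = (c, b)" by (cases "prod_decode z")
    then have z: "prod_encode (a, b) = z" using a by (metis fst_conv prod_decode_inverse)
    then have "b < Suc z" using le_prod_encode_2[of b a] by simp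
    with z show "0 < (\<Sum>b<Suc z. of_bool (prod_encode (a, b) = z) :: nat)"
      by (intro sum_pos2[of _ b]) auto
  qed
  have "computable1 (\<lambda>z. LEAST a. 0 < (\<Sum>b<Suc z. of_bool (prod_encode (a, b) = z) :: nat))"
  proof (rule computable1_least)
    show "computable2 (\<lambda>m a. of_bool (0 < (\<Sum>b<Suc a. of_bool (prod_encode (m, b) = a) :: nat)))"
      unfolding computable2_def
    proof (intro recfn_less recfn_const)
      show "recfn 2 (\<lambda>xs. \<Sum>b<Suc (xs ! 1). of_bool (prod_encode (xs ! 0, b) = xs ! 1))"
        by (rule recfn_app3[OF 1]; intro rec_base; simp)
    qed
    show "\<exists>m. 0 < (\<Sum>b<Suc a. of_bool (prod_encode (m, b) = a) :: nat)" for a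
      unfolding iff by blast
  qed
  moreover have "(LEAST a. a = c) = c" for c :: nat by (rule Least_equality) auto
  ultimately show ?thesis unfolding iff by simp
qed

lemma computable_snd: "computable1 (\<lambda>z. snd (prod_decode z))"
proof -
  have "computable1 (\<lambda>z. LEAST b. prod_encode (fst (prod_decode z), b) = z)"
  proof (rule computable1_least)
    show "computable2 (\<lambda>m a. of_bool (prod_encode (fst (prod_decode a), m) = a))"
      unfolding computable2_def
      by (intro rec_intros recfn_app1[OF computable_fst] recfn_app2[OF computable_prod_encode]) simp_all
    show "\<exists>m. prod_encode (fst (prod_decode a), m) = a" for a
      by (rule exI[of _ "snd (prod_decode a)"]) simp
  qed
  moreover have "(LEAST b. prod_encode (fst (prod_decode z), b) = z) = snd (prod_decode z)" for z
    by (rule Least_equality) (auto, metis order_refl prod_encode_inverse snd_conv)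
  ultimately show ?thesis by simp
qed

definition code_tl :: "nat \<Rightarrow> nat" where "code_tl c = snd (prod_decode (c - 1))"
definition code_nth :: "nat \<Rightarrow> nat \<Rightarrow> nat" where
  "code_nth i c = fst (prod_decode ((code_tl ^^ i) c - 1))"
text \<open>Counts how often a tail can be taken before 0, the code of the empty list, is reached.
  The bound \<open>c\<close> is large enough because a list is never longer than its code.\<close>

definition code_length :: "nat \<Rightarrow> nat" where
  "code_length c = (\<Sum>i<c. of_bool ((code_tl ^^ i) c \<noteq> 0))"

lemma computable_code_tl: "computable1 code_tl"
  unfolding computable1_def code_tl_def
  by (intro rec_intros recfn_app1[OF computable_snd]) simp_all

lemma computable_tl_pow: "computable2 (\<lambda>i. code_tl ^^ i)"
  by (rule computable2_prim[of "\<lambda>a. a" "\<lambda>m y a. code_tl y"])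
     (simp_all add: computable1_def computable3_def rec_base recfn_app1[OF computable_code_tl])

lemma computable_code_nth: "computable2 code_nth"
  unfolding computable2_def code_nth_def
  by (intro rec_intros recfn_app1[OF computable_fst] recfn_app2[OF computable_tl_pow]) simp_all

lemma computable_code_length: "computable1 code_length"
proof -
  have "computable2 (\<lambda>n c. \<Sum>i<n. of_bool ((code_tl ^^ i) c \<noteq> 0))"
    by (rule computable2_sum)
       (unfold computable2_def, intro rec_intros recfn_app2[OF computable_tl_pow], simp_all)
  then show ?thesis unfolding computable1_def code_length_def
    by (intro recfn_app2[of "\<lambda>n c. \<Sum>i<n. of_bool ((code_tl ^^ i) c \<noteq> 0)"] rec_intros) simp_all
qed

lemma code_tl_encode: "code_tl (list_encode xs) = list_encode (tl xs)"
proof (cases xs)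
  case Nil
  \<comment> \<open>For the empty list, truncated \<open>0 - 1 = 0\<close> decodes to the pair of
    zeros, so the tail of code 0 is again code 0, in agreement with
    \<open>tl [] = []\<close>.\<close>
  have "prod_decode 0 = (0, 0)"
    using prod_encode_inverse[of "(0,0)"] by (simp add: prod_encode_def)
  then show ?thesis using Nil by (simp add: code_tl_def)
qed (simp add: code_tl_def)

lemma code_tl_pow_encode: "(code_tl ^^ i) (list_encode xs) = list_encode (drop i xs)"
  by (induction i) (simp_all add: code_tl_encode drop_Suc tl_drop)

lemma code_nth_encode: "i < length xs \<Longrightarrow> code_nth i (list_encode xs) = xs ! i"
  by (simp add: code_nth_def code_tl_pow_encode Cons_nth_drop_Suc[symmetric])

lemma length_le_list_encode: "length xs \<le> list_encode xs"
proof (induction xs)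
  case (Cons x xs)
  then show ?case using le_prod_encode_2[of "list_encode xs" x] by simp
qed simp

lemma list_encode_eq_0: "list_encode xs = 0 \<longleftrightarrow> xs = []"
  by (cases xs) simp_all

lemma code_length_encode: "code_length (list_encode xs) = length xs"
proof -
  have "code_length (list_encode xs) = (\<Sum>i<list_encode xs. of_bool (i < length xs))"
    by (simp add: code_length_def code_tl_pow_encode list_encode_eq_0 not_le)
  also have "\<dots> = card ({..<list_encode xs} \<inter> {i. i < length xs})"
    by (simp add: of_bool_def sum.If_cases)
  also have "{..<list_encode xs} \<inter> {i. i < length xs} = {..<length xs}"
    using length_le_list_encode[of xs] by auto
  finally show ?thesis by simp
qed

lemma recfn_list_encode:
  "(\<And>F. F \<in> set Fs \<Longrightarrow> recfn n F) \<Longrightarrow> recfn n (\<lambda>xs. list_encode (map (\<lambda>F. F xs) Fs))"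
  by (induction Fs) (simp_all add: recfn_const recfn_app1[OF computable_Suc]
    recfn_app2[OF computable_prod_encode])

text \<open>A program may have any finite table built in. This is how data without any computability
  assumption, namely rounded probabilities of \<mu>, enter a program.\<close>

lemma computable_finite_table:
  assumes "finite {z. t z \<noteq> c}"
  shows "computable1 t"
proof -
  have "finite A \<Longrightarrow> {z. t z \<noteq> c} \<subseteq> A \<Longrightarrow> computable1 t" for A and t :: "nat \<Rightarrow> nat"
  proof (induction A arbitrary: t rule: finite_induct)
    case empty
    then have "t = (\<lambda>_. c)" by auto
    then show ?case by (simp add: computable1_def recfn_const)
  next
    case (insert a A)
    have "computable1 (t(a := c))" by (rule insert.IH) (use insert.prems in auto)
    then have "recfn 1 (\<lambda>xs. if xs ! 0 = a then t a else (t(a := c)) (xs ! 0))"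
      by (intro rec_intros recfn_app1[of "t(a := c)"]) simp_all
    then show ?case unfolding computable1_def by (rule recfn_cong) auto
  qed
  then show ?thesis using assms by blast
qed

section \<open>Kraft codes\<close>

fun bits :: "nat \<Rightarrow> nat \<Rightarrow> bool list" where
  "bits c 0 = []"
| "bits c (Suc n) = odd (c div 2 ^ n) # bits c n"

lemma length_bits [simp]: "length (bits c n) = n"
  by (induction n) simp_all

lemma bits_prefix_div:
  "prefix (bits c n) (bits d (n + k)) \<Longrightarrow> c < 2 ^ n \<Longrightarrow> d < 2 ^ (n + k) \<Longrightarrow> c = d div 2 ^ k"
proof (induction n arbitrary: c d)
  case (Suc n)
  let ?c = "c mod 2 ^ n" and ?d = "d mod 2 ^ (n + k)"
  \<comment> \<open>The low bits do not see a reduction modulo a higher power of 2. This allows the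
    leading bit to be split off in the induction.\<close>
  have red: "bits (a mod 2 ^ m) m' = bits a m'" if "m' \<le> m" for a m m'
    using that
  proof (induction m')
    case (Suc j)
    have "(a mod 2 ^ m) div 2 ^ j = (a div 2 ^ j) mod 2 ^ (m - j)"
      using Suc.prems by (metis take_bit_eq_mod drop_bit_eq_div drop_bit_take_bit)
    moreover have "2 dvd (2::nat) ^ (m - j)" using Suc.prems by simp
    ultimately have "odd ((a mod 2 ^ m) div 2 ^ j) = odd (a div 2 ^ j)"
      by (metis dvd_mod_iff)
    then show ?case using Suc by simp
  qed simp
  have par: "odd (c div 2 ^ n) = odd (d div 2 ^ (n + k))" and "prefix (bits c n) (bits d (n + k))"
    using Suc.prems(1) by simp_all
  then have "prefix (bits ?c n) (bits ?d (n + k))" by (simp add: red)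
  then have IH: "?c = ?d div 2 ^ k" by (rule Suc.IH) simp_all
  have c1: "c div 2 ^ n < 2" and d1: "d div 2 ^ (n + k) < 2"
    using Suc.prems(2,3) by (simp_all add: less_mult_imp_div_less)
  have eq: "c div 2 ^ n = d div 2 ^ (n + k)"
    using par c1 d1 by (auto simp: less_2_cases_iff)
  have "d div 2 ^ k = (d div 2 ^ (n + k) * 2 ^ (n + k) + ?d) div 2 ^ k"
    by (simp only: div_mult_mod_eq)
  also have "\<dots> = d div 2 ^ (n + k) * 2 ^ n + ?d div 2 ^ k"
    by (simp add: power_add mult.assoc[symmetric] del: div_mult_mod_eq mult_div_mod_eq)
  also have "\<dots> = c div 2 ^ n * 2 ^ n + ?c" using IH eq by simp
  finally show ?case by (simp only: div_mult_mod_eq)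
qed simp

text \<open>A prefix of a codeword is a dyadic interval containing that of the codeword, so codewords with
  disjoint intervals form a prefix-free set.\<close>

lemma bits_prefix_interval:
  assumes pre: "prefix (bits c n) (bits d m)" and c: "c < 2 ^ n" and d: "d < 2 ^ m"
  shows "real c / 2 ^ n \<le> real d / 2 ^ m" and "real d / 2 ^ m < real (c + 1) / 2 ^ n"
proof -
  obtain k where k: "m = n + k"
    using prefix_length_le[OF pre] le_Suc_ex by auto
  have eq: "c = d div 2 ^ k" using bits_prefix_div[of c n d k] assms k by simp
  have "c * 2 ^ k \<le> d" "d < (c + 1) * 2 ^ k"
    unfolding eq by (simp_all add: dividend_less_div_times)
  then have "real (c * 2 ^ k) \<le> real d" "real d < real ((c + 1) * 2 ^ k)"
    by (simp_all only: of_nat_le_iff of_nat_less_iff)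
  then have 1: "real c * 2 ^ k \<le> real d" "real d < real (c + 1) * 2 ^ k"
    by (simp_all only: of_nat_mult of_nat_power of_nat_numeral)
  show "real c / 2 ^ n \<le> real d / 2 ^ m"
    using 1(1) unfolding k power_add by (simp add: divide_simps)
  have "real d / (2 ^ n * 2 ^ k) < real (c + 1) * 2 ^ k / (2 ^ n * 2 ^ k)"
    by (rule divide_strict_right_mono[OF 1(2)]) simp
  then show "real d / 2 ^ m < real (c + 1) / 2 ^ n" unfolding k power_add by simp
qed

context
  fixes V :: "nat \<Rightarrow> bool" and L :: "nat \<Rightarrow> nat"
begin

text \<open>The number \<open>sf_num y / 2 ^ sf_exp y\<close> is the Kraft sum \<open>sf_cum y\<close> of the words before \<open>y\<close>. The word of
  \<open>y\<close> encodes a dyadic interval of length \<open>2 ^ - (L y + 1)\<close> inside \<open>[sf_cum y, sf_cum y + 2 ^ - L y)\<close>.\<close>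

definition sf_exp :: "nat \<Rightarrow> nat" where "sf_exp y = (\<Sum>i<y. L i)"

fun sf_num :: "nat \<Rightarrow> nat" where
  "sf_num 0 = 0"
| "sf_num (Suc y) = sf_num y * 2 ^ L y + of_bool (V y) * 2 ^ sf_exp y"

text \<open>The Kraft sum is rounded down to a multiple of \<open>2 ^ - (L y + 1)\<close> and one
  step is added. The extra bit leaves room for this: rounding uses up at most one of the two halves
  of an interval of length \<open>2 ^ - L y\<close>. The common denominator
  \<open>2 ^ sf_exp y\<close> keeps everything in the natural numbers.\<close>

definition sf_code :: "nat \<Rightarrow> nat" where
  "sf_code y = sf_num y * 2 ^ (L y + 1) div 2 ^ sf_exp y + 1"

definition sf_word :: "nat \<Rightarrow> bool list" where
  "sf_word y = bits (sf_code y) (L y + 1)"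

definition sf_cum :: "nat \<Rightarrow> real" where
  "sf_cum y = (\<Sum>i<y. of_bool (V i) / 2 ^ L i)"

lemma sf_cum_eq: "sf_cum y = real (sf_num y) / 2 ^ sf_exp y"
  by (induction y) (simp_all add: sf_cum_def sf_exp_def power_add field_simps)

lemma sf_cum_mono: "i \<le> j \<Longrightarrow> sf_cum i \<le> sf_cum j"
  unfolding sf_cum_def by (rule sum_mono2) auto

lemma sf_code_gt: "sf_cum y < real (sf_code y) / 2 ^ (L y + 1)"
  and sf_code_le: "real (sf_code y + 1) / 2 ^ (L y + 1) \<le> sf_cum y + 1 / 2 ^ L y"
proof -
  define q where "q = sf_num y * 2 ^ (L y + 1) div 2 ^ sf_exp y"
  have "q * 2 ^ sf_exp y \<le> sf_num y * 2 ^ (L y + 1)" "sf_num y * 2 ^ (L y + 1) < (q + 1) * 2 ^ sf_exp y"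
    unfolding q_def by (simp_all add: dividend_less_div_times)
  then have "real (q * 2 ^ sf_exp y) \<le> real (sf_num y * 2 ^ (L y + 1))"
    "real (sf_num y * 2 ^ (L y + 1)) < real ((q + 1) * 2 ^ sf_exp y)"
    by (simp_all only: of_nat_le_iff of_nat_less_iff)
  then have q: "real q \<le> sf_cum y * 2 ^ (L y + 1)" "sf_cum y * 2 ^ (L y + 1) < real q + 1"
    unfolding sf_cum_eq by (simp_all add: field_simps)
  have code: "sf_code y = q + 1" by (simp add: sf_code_def q_def)
  show "sf_cum y < real (sf_code y) / 2 ^ (L y + 1)"
    using q(2) unfolding code by (subst pos_less_divide_eq) simp_all
  have "real (sf_code y + 1) \<le> (sf_cum y + 1 / 2 ^ L y) * 2 ^ (L y + 1)"
    using q(1) unfolding code by (simp add: algebra_simps)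
  then show "real (sf_code y + 1) / 2 ^ (L y + 1) \<le> sf_cum y + 1 / 2 ^ L y"
    by (subst pos_divide_le_eq) simp_all
qed

lemma sf_cum_step: "V y \<Longrightarrow> y < z \<Longrightarrow> sf_cum y + 1 / 2 ^ L y \<le> sf_cum z"
  using sf_cum_mono[of "Suc y" z] by (simp add: sf_cum_def)

context
  assumes kraft: "\<And>m. sf_cum m \<le> 1"
begin

lemma sf_code_less: "V y \<Longrightarrow> sf_code y < 2 ^ (L y + 1)"
proof -
  assume "V y"
  then have "sf_cum y + 1 / 2 ^ L y \<le> 1" using sf_cum_step[of y "Suc y"] kraft[of "Suc y"] by simp
  then have "real (sf_code y + 1) / 2 ^ (L y + 1) \<le> 1" using sf_code_le[of y] by linarith
  then have "real (sf_code y + 1) \<le> real (2 ^ (L y + 1))" by (simp add: divide_le_eq)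
  then show ?thesis by (simp only: of_nat_le_iff)
qed

text \<open>For two different indices, the interval of the smaller one ends at or before the Kraft
  sum after which the interval of the larger one begins. Neither interval can then contain the left
  endpoint of the other.\<close>

lemma sf_word_prefix:
  assumes V: "V y" "V z" and pre: "prefix (sf_word y) (sf_word z)"
  shows "y = z"
proof (rule ccontr)
  assume "y \<noteq> z"
  note iv = bits_prefix_interval[OF pre[unfolded sf_word_def] sf_code_less[OF V(1)] sf_code_less[OF V(2)]]
  have z: "real (sf_code z) / 2 ^ (L z + 1) \<le> real (sf_code z + 1) / 2 ^ (L z + 1)"
    by (simp add: divide_right_mono)
  show False
  proof (cases "y < z")
    case True
    then show False
      using iv sf_code_gt[of z] sf_code_le[of y] sf_cum_step[OF V(1) True] by linarith
  next
    case False
    then have "z < y" using \<open>y \<noteq> z\<close> by simp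
    then show False
      using iv z sf_code_gt[of y] sf_code_le[of z] sf_cum_step[OF V(2) \<open>z < y\<close>] by linarith
  qed
qed

end

lemma computable_sf_word:
  assumes L: "computable1 L" and V: "computable1 (\<lambda>y. of_bool (V y))"
  shows "computable1 (\<lambda>y. list_encode (map of_bool (sf_word y)))"
proof -
  have E: "computable1 sf_exp"
    using computable1_sum[OF L] by (simp add: computable1_def sf_exp_def)
  have N: "computable1 sf_num"
    by (rule computable1_prim[of "\<lambda>y r. r * 2 ^ L y + of_bool (V y) * 2 ^ sf_exp y"])
       (unfold computable2_def, intro rec_intros recfn_app1[OF L] recfn_app1[OF V] recfn_app1[OF E],
        simp_all)
  have C: "computable1 sf_code" unfolding computable1_def sf_code_def
    by (intro rec_intros recfn_div recfn_app1[OF L] recfn_app1[OF N] recfn_app1[OF E]) simp_all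
  have B: "computable2 (\<lambda>n c. list_encode (map of_bool (bits c n)))"
  proof (rule computable2_prim[of "\<lambda>_. 0" "\<lambda>n r c. Suc (prod_encode (of_bool (odd (c div 2 ^ n)), r))"])
    show "computable3 (\<lambda>n r c. Suc (prod_encode (of_bool (odd (c div 2 ^ n)), r)))"
      unfolding computable3_def
      by (intro rec_intros recfn_app2[OF computable_prod_encode] recfn_app1[OF computable_odd] recfn_div)
         simp_all
  qed (simp_all add: computable1_def recfn_const)
  show ?thesis unfolding computable1_def sf_word_def
    by (intro rec_intros recfn_app2[OF B] recfn_app1[OF L] recfn_app1[OF C]) simp_all
qed

end

section \<open>From code lengths to complexity\<close>

definition symbol_code :: "('a \<Rightarrow> nat) \<Rightarrow> 'a list \<Rightarrow> nat" where
  "symbol_code num x = list_encode (map num x)"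

lemma symbol_code_eq_iff: "inj num \<Longrightarrow> symbol_code num x = symbol_code num y \<longleftrightarrow> x = y"
  by (simp add: symbol_code_def list_encode_eq inj_map_eq_map)

text \<open>Every number codes some list of numbers, so the only condition is that its entries be at
  most \<open>N\<close>.\<close>

lemma computable_range_symbol_code:
  assumes num: "bij_betw num UNIV {0..N}"
  shows "computable1 (\<lambda>y. of_bool (y \<in> range (symbol_code num)))"
proof -
  have r: "range num = {0..N}" using num by (rule bij_betw_imp_surj_on)
  have iff: "y \<in> range (symbol_code num) \<longleftrightarrow>
      (\<Sum>i<code_length y. of_bool (N < code_nth i y) :: nat) = 0" for y
  proof -
    define xs where "xs = list_decode y"
    have y: "y = list_encode xs" by (simp add: xs_def)
    have "(\<Sum>i<code_length y. of_bool (N < code_nth i y) :: nat) = 0 \<longleftrightarrow> (\<forall>i<length xs. xs ! i \<le> N)"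
      by (auto simp: y code_length_encode code_nth_encode not_less)
    also have "\<dots> \<longleftrightarrow> set xs \<subseteq> range num" by (auto simp: r in_set_conv_nth subset_iff)
    also have "\<dots> \<longleftrightarrow> y \<in> range (symbol_code num)"
    proof
      assume "set xs \<subseteq> range num"
      then have "xs = map num (map (inv num) xs)"
        by (intro nth_equalityI) (auto simp: f_inv_into_f subset_iff)
      then show "y \<in> range (symbol_code num)" unfolding y symbol_code_def by (metis rangeI)
    next
      assume "y \<in> range (symbol_code num)"
      then have "list_encode xs \<in> range (\<lambda>x. list_encode (map num x))" by (simp add: y symbol_code_def)
      then show "set xs \<subseteq> range num" by (auto simp: list_encode_eq)
    qed
    finally show ?thesis by simp
  qed
  have 2: "computable2 (\<lambda>n y. \<Sum>i<n. of_bool (N < code_nth i y))"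
    by (rule computable2_sum)
       (unfold computable2_def, intro rec_intros recfn_app2[OF computable_code_nth], simp_all)
  show ?thesis unfolding iff computable1_def
    by (intro rec_intros recfn_app2[OF 2] recfn_app1[OF computable_code_length]) simp_all
qed

text \<open>The Kraft sum runs over strings of all lengths together, so one machine with input words
  \<open>sf_word\<close> serves all strings, and optimality gives one constant for all of them.
  Numbers that code no string are switched off by \<open>?V\<close>, since \<open>kraft\<close> says
  nothing about them.\<close>

theorem coding_theorem:
  fixes num :: "'a::finite \<Rightarrow> nat"
  assumes num: "bij_betw num UNIV {0..N}"
    and opt: "additively_optimal num \<phi>"
    and L: "computable1 L"
    and kraft: "\<And>X. finite X \<Longrightarrow> (\<Sum>x\<in>X. 1 / 2 ^ L (symbol_code num x) :: real) \<le> 1"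
  shows "\<exists>c::real. \<forall>x. ereal_of_enat (kolm \<phi> x) \<le> ereal (real (L (symbol_code num x)) + c)"
proof -
  have inj: "inj num" using num by (simp add: bij_betw_def)
  let ?V = "\<lambda>y. y \<in> range (symbol_code num)"
  let ?w = "sf_word ?V L"
  have V: "computable1 (\<lambda>y. of_bool (?V y))" by (rule computable_range_symbol_code[OF num])
  have W: "computable1 (\<lambda>y. list_encode (map of_bool (?w y)))" by (rule computable_sf_word[OF L V])
  have cum: "sf_cum ?V L m \<le> 1" for m
  proof -
    have "sf_cum ?V L m = (\<Sum>i\<in>{i. i < m \<and> ?V i}. 1 / 2 ^ L i)"
      unfolding sf_cum_def by (rule sum.mono_neutral_cong_right) auto
    also have "{i. i < m \<and> ?V i} = symbol_code num ` {x. symbol_code num x < m}" by auto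
    also have "(\<Sum>i\<in>symbol_code num ` {x. symbol_code num x < m}. 1 / 2 ^ L i)
        = (\<Sum>x\<in>{x. symbol_code num x < m}. 1 / 2 ^ L (symbol_code num x) :: real)"
      by (rule sum.reindex_cong[OF _ refl refl]) (simp add: inj_on_def symbol_code_eq_iff[OF inj])
    also have "\<dots> \<le> 1"
    proof (rule kraft)
      have "finite (symbol_code num ` {x. symbol_code num x < m})"
        by (rule finite_subset[of _ "{..<m}"]) auto
      then show "finite {x. symbol_code num x < m}"
        by (rule finite_imageD) (simp add: inj_on_def symbol_code_eq_iff[OF inj])
    qed
    finally show ?thesis .
  qed
  note pre = sf_word_prefix[of ?V L, OF cum]
  define \<psi> where "\<psi> p = (if \<exists>x. ?w (symbol_code num x) = p
      then Some (SOME x. ?w (symbol_code num x) = p) else None)" for p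
  have \<psi>: "\<psi> (?w (symbol_code num x)) = Some x" for x
  proof -
    have "y = x" if "?w (symbol_code num y) = ?w (symbol_code num x)" for y
      using pre[of "symbol_code num y" "symbol_code num x"] that symbol_code_eq_iff[OF inj] by auto
    then have "(SOME y. ?w (symbol_code num y) = ?w (symbol_code num x)) = x"
      by (metis (mono_tags, lifting) someI_ex)
    then show ?thesis unfolding \<psi>_def by auto
  qed
  have dom: "dom \<psi> = range (\<lambda>x. ?w (symbol_code num x))" by (auto simp: \<psi>_def split: if_splits)
  have wp: "?w (symbol_code num x) = ?w (symbol_code num y)"
    if "prefix (?w (symbol_code num x)) (?w (symbol_code num y))" for x y
    using pre[OF rangeI rangeI that] by simp
  have "prefix_free (dom \<psi>)" unfolding prefix_free_def dom
  proof (intro ballI impI)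
    fix p q assume p: "p \<in> range (\<lambda>x. ?w (symbol_code num x))"
      and q: "q \<in> range (\<lambda>x. ?w (symbol_code num x))" and pq: "prefix p q"
    from p obtain x where x: "p = ?w (symbol_code num x)" by (rule rangeE)
    from q obtain y where y: "q = ?w (symbol_code num y)" by (rule rangeE)
    show "p = q" using wp[of x y] pq unfolding x y by simp
  qed
  moreover have "partial_recursive num \<psi>"
  proof -
    have "recfn 2 (\<lambda>xs. of_bool (\<not> (?V (xs ! 0) \<and> list_encode (map of_bool (?w (xs ! 0))) = xs ! 1)))"
      by (intro rec_intros recfn_app1[OF V] recfn_app1[OF W]) simp_all
    then obtain r where r': "\<forall>xs. length xs = 2 \<longrightarrow> rec_eval r xs =
        Some (of_bool (\<not> (?V (xs ! 0) \<and> list_encode (map of_bool (?w (xs ! 0))) = xs ! 1)))"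
      unfolding recfn_def by blast
    have r: "rec_eval r [y, p] = Some (of_bool (\<not> (?V y \<and> list_encode (map of_bool (?w y)) = p)))" for y p
      using r'[rule_format, of "[y, p]"] by simp
    \<comment> \<open>\<open>r\<close> is total, so the search diverges exactly when no word equals
      \<open>p\<close>, which is where \<psi> is \<open>None\<close>. A hit is unique by
      prefix-freeness, so the least hit is the code of the decoded string.\<close>
    have "rec_eval (Minimize r) [list_encode (map of_bool p)]
        = map_option (\<lambda>x. list_encode (map num x)) (\<psi> p)" for p
    proof (cases "\<exists>x. ?w (symbol_code num x) = p")
      case True
      then obtain x where x: "?w (symbol_code num x) = p" by blast
      have ob: "inj (of_bool :: bool \<Rightarrow> nat)" by (simp add: inj_def)
      have iff: "rec_eval r [y, list_encode (map of_bool p)] = Some 0 \<longleftrightarrow> y = symbol_code num x" for y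
      proof -
        have "y = symbol_code num x" if "?V y" "?w y = p"
          using pre[of y "symbol_code num x"] that x by auto
        then show ?thesis using x
          by (auto simp: r list_encode_eq inj_map_eq_map[OF ob])
      qed
      have S: "\<exists>z. rec_eval r [y, list_encode (map of_bool p)] = Some (Suc z)"
        if "y \<noteq> symbol_code num x" for y
        using iff[of y] that r[of y "list_encode (map of_bool p)"] by (auto simp: r)
      have "rec_eval (Minimize r) [list_encode (map of_bool p)] = Some (symbol_code num x)"
        using S iff Least_equality[of "\<lambda>y. y = symbol_code num x" "symbol_code num x"]
        by (auto intro!: exI[of _ "symbol_code num x"])
      then show ?thesis using \<psi>[of x] x by (simp add: symbol_code_def)
    next
      case False
      have ob: "inj (of_bool :: bool \<Rightarrow> nat)" by (simp add: inj_def)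
      have "rec_eval r [y, list_encode (map of_bool p)] \<noteq> Some 0" for y
        using False by (auto simp: r list_encode_eq inj_map_eq_map[OF ob])
      then show ?thesis using False by (simp add: \<psi>_def)
    qed
    then show ?thesis unfolding partial_recursive_def by blast
  qed
  ultimately have "partial_recursive_prefix num \<psi>" by (simp add: partial_recursive_prefix_def)
  then obtain c :: real where c: "\<And>x. ereal_of_enat (kolm \<phi> x) \<le> ereal_of_enat (kolm \<psi> x) + ereal c"
    using opt unfolding additively_optimal_def by blast
  \<comment> \<open>The 1 pays for the extra bit in the length of \<open>sf_word\<close>.\<close>
  have "ereal_of_enat (kolm \<phi> x) \<le> ereal (real (L (symbol_code num x)) + (1 + c))" for x
  proof -
    have "kolm \<psi> x \<le> enat (L (symbol_code num x) + 1)"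
      unfolding kolm_def
    proof (rule INF_lower2)
      show "?w (symbol_code num x) \<in> {p. \<psi> p = Some x}" using \<psi> by simp
    qed (simp add: sf_word_def)
    then have "ereal_of_enat (kolm \<psi> x) \<le> ereal_of_enat (enat (L (symbol_code num x) + 1))"
      by (simp only: ereal_of_enat_le_iff)
    then have "ereal_of_enat (kolm \<psi> x) + ereal c \<le> ereal (real (L (symbol_code num x) + 1)) + ereal c"
      by (intro add_right_mono) simp
    then show ?thesis using c[of x] by (simp add: add.assoc order_trans)
  qed
  then show ?thesis by blast
qed

section \<open>Codes from computable weights\<close>

text \<open>\<open>pos v j\<close> is going to be the index of the site number \<open>j\<close>
  translated by \<open>v\<close>, so a factor looks up the pattern seen through one translate of a
  fixed window. Windows that leave the string contribute 1.\<close>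

definition string_weight ::
    "('v \<Rightarrow> nat \<Rightarrow> nat) \<Rightarrow> 'v list \<Rightarrow> ('a list \<Rightarrow> nat) \<Rightarrow> 'a list \<Rightarrow> nat" where
  "string_weight pos vs tab x =
     (\<Prod>j<length x. if \<forall>v\<in>set vs. pos v j < length x then tab (map (\<lambda>v. x ! pos v j) vs) else 1)"

lemma recfn_ball:
  "(\<And>F. F \<in> set Fs \<Longrightarrow> recfn n (\<lambda>xs. of_bool (P F xs)))
    \<Longrightarrow> recfn n (\<lambda>xs. of_bool (\<forall>F\<in>set Fs. P F xs))"
proof (induction Fs)
  case (Cons F Fs)
  have "recfn n (\<lambda>xs. of_bool (P F xs \<and> (\<forall>F\<in>set Fs. P F xs)))"
    using Cons by (intro recfn_conj) auto
  then show ?case by simp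
qed (simp add: recfn_const)

text \<open>Positivity of \<open>w\<close> is claimed on all numbers, not only on codes of strings,
  because the search for a code length has to terminate on every input. The default 1 of
  \<open>T\<close> provides it.\<close>

lemma computable_string_weight:
  fixes num :: "'a::finite \<Rightarrow> nat"
  assumes inj: "inj num" and pos: "\<And>v. v \<in> set vs \<Longrightarrow> computable1 (pos v)"
  shows "\<exists>w. computable1 w \<and> (\<forall>x. w (symbol_code num x) = string_weight pos vs tab x) \<and>
           ((\<forall>c. tab c > 0) \<longrightarrow> (\<forall>y. w y > 0))"
proof -
  let ?sc = "symbol_code num"
  define C where "C = {c :: 'a list. set c \<subseteq> UNIV \<and> length c = length vs}"
  define T where "T z = (if z \<in> ?sc ` C then tab (inv ?sc z) else 1)" for z
  have isc: "inj ?sc" by (auto simp: inj_def symbol_code_eq_iff[OF inj])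
  have T: "T (?sc c) = tab c" if "length c = length vs" for c
    using that by (simp add: T_def C_def inv_f_f[OF isc])
  have "finite C" unfolding C_def by (rule finite_lists_length_eq) simp
  then have "computable1 T"
    by (intro computable_finite_table[of T 1]) (auto simp: T_def intro: finite_subset[of _ "?sc ` C"] split: if_splits)
  define g where "g j y = (if \<forall>v\<in>set vs. pos v j < code_length y
      then T (list_encode (map (\<lambda>v. code_nth (pos v j) y) vs)) else 1)" for j y
  have g: "computable2 g"
  proof -
    have "recfn 2 (\<lambda>xs. list_encode (map (\<lambda>F. F xs)
        (map (\<lambda>v xs. code_nth (pos v (xs ! 0)) (xs ! 1)) vs)))"
      by (rule recfn_list_encode) (auto intro!: recfn_app2[OF computable_code_nth] rec_intros
          recfn_app1[of "pos _"] pos)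
    then have "recfn 2 (\<lambda>xs. list_encode (map (\<lambda>v. code_nth (pos v (xs ! 0)) (xs ! 1)) vs))"
      by (simp add: comp_def)
    moreover have "recfn 2 (\<lambda>xs. of_bool (\<forall>v\<in>set vs. pos v (xs ! 0) < code_length (xs ! 1)))"
      by (rule recfn_ball) (auto intro!: rec_intros recfn_app1[of "pos _"] pos
          recfn_app1[OF computable_code_length])
    ultimately show ?thesis unfolding computable2_def g_def
      by (intro recfn_if recfn_app1[OF \<open>computable1 T\<close>] recfn_const)
  qed
  have 1: "computable1 (\<lambda>y. \<Prod>j<code_length y. g j y)"
    unfolding computable1_def
    by (intro recfn_app2[OF computable2_prod[OF g]] recfn_app1[OF computable_code_length] rec_base) simp_all
  have 2: "(\<Prod>j<code_length (?sc x). g j (?sc x)) = string_weight pos vs tab x" for x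
  proof -
    have len: "code_length (?sc x) = length x" by (simp add: symbol_code_def code_length_encode)
    have "list_encode (map (\<lambda>v. code_nth (pos v j) (?sc x)) vs) = ?sc (map (\<lambda>v. x ! pos v j) vs)"
      if "\<forall>v\<in>set vs. pos v j < length x" for j
      using that by (auto simp: symbol_code_def code_nth_encode intro!: arg_cong[of _ _ list_encode])
    then have "g j (?sc x) = (if \<forall>v\<in>set vs. pos v j < length x then tab (map (\<lambda>v. x ! pos v j) vs) else 1)" for j
      by (simp add: g_def len T)
    then show ?thesis unfolding string_weight_def len by simp
  qed
  have 3: "(\<Prod>j<code_length y. g j y) > 0" if "\<forall>c. tab c > 0" for y
    using that by (intro prod_pos) (simp add: g_def T_def)
  show ?thesis using 1 2 3 by (intro exI[of _ "\<lambda>y. \<Prod>j<code_length y. g j y"]) blast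
qed

text \<open>A distribution on string lengths. It combines the Kraft inequalities of the single
  lengths into one for all strings, and costs only a logarithm of the length.\<close>

lemma sum_inverse_triangular: "(\<Sum>l<n. 1 / (real (l + 1) * real (l + 2))) \<le> 1"
proof -
  have "(\<Sum>l<n. 1 / (real (l + 1) * real (l + 2))) = 1 - 1 / real (n + 1)"
  proof (induction n)
    case (Suc n)
    have "1 / (real (n + 1) * real (n + 2)) = 1 / real (n + 1) - 1 / real (n + 2)"
      by (simp add: divide_simps)
    then show ?case using Suc by (simp del: of_nat_add)
  qed simp
  then show ?thesis by simp
qed

theorem weighted_coding:
  fixes num :: "'a::finite \<Rightarrow> nat"
  assumes num: "bij_betw num UNIV {0..N}"
    and opt: "additively_optimal num \<phi>"
    and pos: "\<And>v. v \<in> set vs \<Longrightarrow> computable1 (pos v)"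
    and tab: "\<And>c. tab c > 0" and D: "D > 0"
    and kraft: "\<And>l. (\<Sum>x\<in>{x. length x = l}. real (string_weight pos vs tab x)) \<le> real D ^ l"
  shows "\<exists>c::real. \<forall>x. ereal_of_enat (kolm \<phi> x) \<le>
     ereal (log 2 (real D ^ length x * (real (length x + 1) * real (length x + 2))
        / real (string_weight pos vs tab x)) + c)"
proof -
  have inj: "inj num" using num by (simp add: bij_betw_def)
  let ?W = "string_weight pos vs tab" and ?sc = "symbol_code num"
  obtain w where w: "computable1 w" "\<And>x. w (?sc x) = ?W x" "\<And>y. w y > 0"
    using computable_string_weight[of num vs pos tab, OF inj pos] tab by blast
  define B where "B l = D ^ l * ((l + 1) * (l + 2))" for l
  have Bpos: "B l > 0" for l using D by (simp add: B_def)
  \<comment> \<open>\<open>L\<close> is the binary logarithm of \<open>B / w\<close> rounded up, but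
    found by comparing integers only.\<close>
  define P where "P m y \<longleftrightarrow> B (code_length y) \<le> 2 ^ m * w y" for m y
  define L where "L y = (LEAST m. P m y)" for y
  have ex: "\<exists>m. P m y" for y
  proof (rule exI[of _ "B (code_length y)"])
    have "B (code_length y) \<le> 2 ^ B (code_length y)" using less_exp by (simp add: less_imp_le)
    also have "\<dots> \<le> 2 ^ B (code_length y) * w y" using w(3)[of y] by (cases "w y") auto
    finally show "P (B (code_length y)) y" unfolding P_def .
  qed
  have cL: "computable1 L" unfolding L_def
  proof (rule computable1_least)
    show "computable2 (\<lambda>m y. of_bool (P m y))" unfolding computable2_def P_def B_def
      by (intro rec_intros recfn_app1[OF computable_code_length] recfn_app1[OF w(1)]) simp_all
  qed (rule ex)
  have W: "?W x > 0" for x using w(2)[of x] w(3)[of "?sc x"] by simp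
  have len: "code_length (?sc x) = length x" for x by (simp add: symbol_code_def code_length_encode)
  have L1: "1 / 2 ^ L (?sc x) \<le> real (?W x) / real (B (length x))" for x
  proof -
    have "P (L (?sc x)) (?sc x)" unfolding L_def by (rule LeastI_ex[OF ex])
    then have "B (length x) \<le> 2 ^ L (?sc x) * ?W x" by (simp add: P_def len w(2))
    then have "real (B (length x)) \<le> real (2 ^ L (?sc x) * ?W x)" by (simp only: of_nat_le_iff)
    then show ?thesis using Bpos[of "length x"] by (simp add: divide_simps mult.commute)
  qed
  have L2: "real (L (?sc x)) \<le> log 2 (real (B (length x)) / real (?W x)) + 1" for x
  proof (cases "L (?sc x)")
    case 0
    have "?W x \<le> D ^ length x"
    proof -
      have "real (?W x) \<le> (\<Sum>x\<in>{y. length y = length x}. real (?W x))"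
      proof (rule member_le_sum)
        show "finite {y :: 'a list. length y = length x}"
          using finite_lists_length_eq[of "UNIV :: 'a set" "length x"] by simp
      qed auto
      also have "\<dots> \<le> real D ^ length x" by (rule kraft)
      finally show ?thesis by (metis of_nat_le_iff of_nat_power)
    qed
    also have "\<dots> \<le> B (length x)" by (simp add: B_def)
    finally have "real (?W x) \<le> real (B (length x))" by simp
    then have "1 \<le> real (B (length x)) / real (?W x)" using W[of x] by simp
    then have "0 \<le> log 2 (real (B (length x)) / real (?W x))" by simp
    then show ?thesis using 0 by simp
  next
    case (Suc m)
    then have "\<not> P m (?sc x)" unfolding L_def by (metis lessI not_less_Least)
    then have "2 ^ m * ?W x < B (length x)" by (simp add: P_def len w(2))
    then have "real (2 ^ m * ?W x) < real (B (length x))" by (simp only: of_nat_less_iff)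
    then have "2 ^ m \<le> real (B (length x)) / real (?W x)" using W[of x] by (simp add: field_simps)
    then have "log 2 (2 ^ m) \<le> log 2 (real (B (length x)) / real (?W x))"
      by (intro log_le_cancel_iff[THEN iffD2]) (use W[of x] Bpos[of "length x"] in auto)
    then show ?thesis using Suc by (simp add: log_nat_power)
  qed
  have "\<exists>c::real. \<forall>x. ereal_of_enat (kolm \<phi> x) \<le> ereal (real (L (?sc x)) + c)"
  proof (rule coding_theorem[OF num opt cL])
    fix X :: "'a list set" assume X: "finite X"
    define n where "n = Suc (Max (insert 0 (length ` X)))"
    have n: "length x < n" if "x \<in> X" for x
      using that X unfolding n_def by (auto simp: less_Suc_eq_le intro!: Max_ge)
    have fin: "finite {x :: 'a list. length x = l}" for l
      using finite_lists_length_eq[of "UNIV :: 'a set" l] by simp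
    have "(\<Sum>x\<in>X. 1 / 2 ^ L (?sc x) :: real) \<le> (\<Sum>x\<in>X. real (?W x) / real (B (length x)))"
      by (intro sum_mono L1)
    also have "\<dots> \<le> (\<Sum>x\<in>(\<Union>l<n. {x. length x = l}). real (?W x) / real (B (length x)))"
      by (rule sum_mono2) (use fin n in auto)
    also have "\<dots> = (\<Sum>l<n. \<Sum>x\<in>{x. length x = l}. real (?W x) / real (B (length x)))"
      by (rule sum.UNION_disjoint) (use fin in auto)
    also have "\<dots> = (\<Sum>l<n. (\<Sum>x\<in>{x. length x = l}. real (?W x)) / real (B l))"
      by (simp add: sum_divide_distrib)
    also have "\<dots> \<le> (\<Sum>l<n. 1 / (real (l + 1) * real (l + 2)))"
    proof (rule sum_mono)
      fix l
      have "(\<Sum>x\<in>{x. length x = l}. real (?W x)) / real (B l) \<le> real D ^ l / real (B l)"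
        by (intro divide_right_mono kraft) simp
      also have "\<dots> = 1 / (real (l + 1) * real (l + 2))"
        unfolding B_def of_nat_mult of_nat_power using D by (intro nonzero_divide_mult_cancel_left) simp
      finally show "(\<Sum>x\<in>{x. length x = l}. real (?W x)) / real (B l) \<le> 1 / (real (l + 1) * real (l + 2))" .
    qed
    also have "\<dots> \<le> 1" by (rule sum_inverse_triangular)
    finally show "(\<Sum>x\<in>X. 1 / 2 ^ L (?sc x) :: real) \<le> 1" .
  qed
  then obtain c where c: "\<And>x. ereal_of_enat (kolm \<phi> x) \<le> ereal (real (L (?sc x)) + c)" by blast
  have "ereal_of_enat (kolm \<phi> x) \<le> ereal (log 2 (real D ^ length x * (real (length x + 1) * real (length x + 2))
        / real (?W x)) + (1 + c))" for x
  proof -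
    have "real (B (length x)) = real D ^ length x * (real (length x + 1) * real (length x + 2))"
      unfolding B_def of_nat_mult of_nat_power ..
    then have "real (L (?sc x)) + c \<le> log 2 (real D ^ length x * (real (length x + 1) * real (length x + 2))
        / real (?W x)) + (1 + c)" using L2[of x] by simp
    then show ?thesis using c[of x] by (meson ereal_less_eq(3) order_trans)
  qed
  then show ?thesis by blast
qed

abbreviation index_set :: "(int ^ 'd) set \<Rightarrow> bool" where
  "index_set G \<equiv> G = UNIV \<or> G = {g. \<forall>i. 0 \<le> g $ i}"

definition site :: "(int ^ 'd) set \<Rightarrow> (int ^ 'd \<Rightarrow> nat) \<Rightarrow> int ^ 'd \<Rightarrow> nat \<Rightarrow> nat" where
  "site G f v j = f (inv_into G f j + v)"

lemma computable_int_add: "computable1 (\<lambda>m. int_encode (int_decode m + int n))"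
proof (induction n)
  case 0
  then show ?case by (simp add: computable1_def rec_base)
next
  case (Suc n)
  \<comment> \<open>Even codes stand for nonnegative integers and odd ones for negative integers.
    The code of -1 is 1, and truncated \<open>1 - 2 = 0\<close> is the code of 0, as it should
    be.\<close>
  have inc: "int_encode (int_decode m + 1) = (if odd m then m - 2 else m + 2)" for m
  proof (cases "odd m")
    case True
    then obtain b where "m = 2 * b + 1" by (rule oddE)
    then show ?thesis by (cases b) (simp_all add: int_decode_def sum_decode_def int_encode_def sum_encode_def)
  next
    case False
    then obtain b where "m = 2 * b" by auto
    then show ?thesis by (simp add: int_decode_def sum_decode_def int_encode_def sum_encode_def nat_add_distrib)
  qed
  have "int_encode (int_decode m + int (Suc n)) = (let h = int_encode (int_decode m + int n) in
      if odd h then h - 2 else h + 2)" for m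
    using inc[of "int_encode (int_decode m + int n)"] by (simp add: algebra_simps Let_def)
  then show ?case unfolding computable1_def Let_def
    by (simp only:) (intro rec_intros recfn_app1[OF computable_odd] recfn_app1[OF Suc], simp_all)
qed

text \<open>The program for \<open>f\<close> may diverge outside the codes of \<open>G\<close>. It is therefore only run on codes of
  points \<open>U t + x\<close>, which lie in \<open>G\<close> for every \<open>t\<close>.\<close>

lemma computable_site:
  fixes G :: "(int ^ 'd) set" and v :: "int ^ 'd"
  assumes G: "index_set G" and f: "bij_betw f G UNIV" "computable_index G f" and v: "\<forall>i. 0 \<le> v $ i"
  shows "computable1 (site G f v)"
proof -
  \<comment> \<open>\<open>2 * m\<close> codes the nonnegative integer \<open>m\<close>; this keeps
    \<open>U t\<close> in the orthant for every \<open>t\<close>.\<close>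
  define e where "e m = (if G = UNIV then m else 2 * m)" for m :: nat
  define k where "k = to_nat_on (UNIV :: 'd set)"
  define U :: "nat \<Rightarrow> int ^ 'd" where "U t = (\<chi> i. int_decode (e (code_nth (k i) t)))" for t
  have ce: "computable1 e"
    by (cases "G = UNIV") (auto simp: computable1_def e_def intro!: rec_intros)
  have k: "k (from_nat_into UNIV n) = n" if "n < CARD('d)" for n
    unfolding k_def using bij_betw_imp_surj_on[OF to_nat_on_finite[of "UNIV :: 'd set"]] that by simp
  have k2: "from_nat_into UNIV (k i) = i" for i
    unfolding k_def by (simp add: countable_finite)
  have k3: "k i < CARD('d)" for i unfolding k_def
    using bij_betwE[OF to_nat_on_finite[of "UNIV :: 'd set"]] by simp
  have code: "vec_code (U t + x) =
     list_encode (map (\<lambda>n. int_encode (int_decode (e (code_nth n t)) + x $ from_nat_into UNIV n)) [0..<CARD('d)])"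
    for t x
    unfolding vec_code_def by (intro arg_cong[of _ _ list_encode] map_cong) (simp_all add: U_def k)
  have dec2: "int_decode (2 * m) = int m" for m by (simp add: int_decode_def sum_decode_def)
  have UG: "U t + x \<in> G" if "\<forall>i. 0 \<le> x $ i" for t x
    using G that by (cases "G = UNIV") (auto simp: U_def e_def dec2)
  have ran: "\<exists>t. U t = g" if "g \<in> G" for g
  proof (cases "G = UNIV")
    case True
    have "U (list_encode (map (\<lambda>n. int_encode (g $ from_nat_into UNIV n)) [0..<CARD('d)])) = g"
      using True by (simp add: U_def e_def vec_eq_iff code_nth_encode k3 k2)
    then show ?thesis by blast
  next
    case False
    then have "0 \<le> g $ i" for i using G that by auto
    then have "U (list_encode (map (\<lambda>n. nat (g $ from_nat_into UNIV n)) [0..<CARD('d)])) = g"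
      using False by (simp add: U_def e_def vec_eq_iff code_nth_encode k3 k2 dec2)
    then show ?thesis by blast
  qed
  have cf: "computable1 (\<lambda>t. f (U t + x))" if x: "\<forall>i. 0 \<le> x $ i" for x
  proof -
    obtain r where r: "\<And>g. g \<in> G \<Longrightarrow> rec_eval r [vec_code g] = Some (f g)"
      using f(2) unfolding computable_index_def by blast
    define y where "y n = nat (x $ from_nat_into UNIV n)" for n
    have y: "x $ from_nat_into UNIV n = int (y n)" for n using x by (simp add: y_def)
    have entry: "recfn 1 (\<lambda>xs. int_encode (int_decode (e (code_nth n (xs ! 0))) + int (y n)))" for n
      by (rule recfn_app1[OF computable_int_add], rule recfn_app1[OF ce],
          rule recfn_app2[OF computable_code_nth], rule recfn_const, rule recfn_nth) simp
    have "recfn 1 (\<lambda>xs. list_encode (map (\<lambda>F. F xs) (map (\<lambda>n xs.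
        int_encode (int_decode (e (code_nth n (xs ! 0))) + int (y n))) [0..<CARD('d)])))"
      by (rule recfn_list_encode) (use entry in \<open>auto simp del: One_nat_def\<close>)
    then have "recfn 1 (\<lambda>xs. vec_code (U (xs ! 0) + x))"
      by (simp add: code y comp_def)
    then obtain q where "\<And>xs. length xs = 1 \<Longrightarrow> rec_eval q xs = Some (vec_code (U (xs ! 0) + x))"
      unfolding recfn_def by blast
    then show ?thesis unfolding computable1_def recfn_def
      by (intro exI[of _ "Comp r [q]"]) (simp add: r UG[OF x])
  qed
  have c0: "computable1 (\<lambda>t. f (U t))" using cf[of 0] by simp
  have ex: "\<exists>t. f (U t) = j" for j
    using ran bij_betw_imp_surj_on[OF f(1)] by (metis imageE UNIV_I)
  \<comment> \<open>This inverts \<open>f\<close> by search over parameters. Several parameters may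
    name the same site; the least one is taken.\<close>
  have cl: "computable1 (\<lambda>j. LEAST t. f (U t) = j)"
    by (rule computable1_least) (use ex in \<open>auto simp: computable2_def intro!: rec_intros recfn_app1[OF c0]\<close>)
  have UG0: "U t \<in> G" for t using UG[of 0 t] by simp
  have "U (LEAST t. f (U t) = j) = inv_into G f j" for j
    using LeastI_ex[OF ex[of j]] UG0 f(1) by (metis bij_betw_inv_into_left)
  then have "site G f v = (\<lambda>j. f (U (LEAST t. f (U t) = j) + v))"
    by (simp add: site_def fun_eq_iff)
  then show ?thesis unfolding computable1_def
    by (simp only:) (intro recfn_app1[OF cf[OF v]] recfn_app1[OF cl] rec_base, simp)
qed

section \<open>The lexicographic order and boxes\<close>

definition lexless :: "int ^ 'd \<Rightarrow> int ^ 'd \<Rightarrow> bool" where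
  "lexless g h \<longleftrightarrow> (\<exists>i. g $ i < h $ i \<and>
     (\<forall>j. to_nat_on (UNIV :: 'd set) j < to_nat_on (UNIV :: 'd set) i \<longrightarrow> g $ j = h $ j))"

lemma lexless_irrefl [simp]: "\<not> lexless g g"
  by (simp add: lexless_def)

lemma lexless_add [simp]: "lexless (g + t) (h + t) \<longleftrightarrow> lexless g h"
  by (simp add: lexless_def)

lemma lexless_trans:
  fixes a b c :: "int ^ 'd"
  assumes "lexless a b" "lexless b c"
  shows "lexless a c"
proof -
  let ?k = "to_nat_on (UNIV :: 'd set)"
  have k: "?k i = ?k j \<longleftrightarrow> i = j" for i j by (simp add: countable_finite)
  obtain i where i: "a $ i < b $ i" "\<forall>j. ?k j < ?k i \<longrightarrow> a $ j = b $ j"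
    using assms(1) unfolding lexless_def by blast
  obtain i' where i': "b $ i' < c $ i'" "\<forall>j. ?k j < ?k i' \<longrightarrow> b $ j = c $ j"
    using assms(2) unfolding lexless_def by blast
  consider "?k i < ?k i'" | "i = i'" | "?k i' < ?k i" using k by (metis linorder_cases)
  then show ?thesis
  proof cases
    case 1
    then show ?thesis unfolding lexless_def using i i' by (intro exI[of _ i]) force
  next
    case 2
    then show ?thesis unfolding lexless_def using i i' by (intro exI[of _ i]) force
  next
    case 3
    then show ?thesis unfolding lexless_def using i i' by (intro exI[of _ i']) force
  qed
qed

lemma lexless_total:
  fixes a b :: "int ^ 'd"
  assumes "a \<noteq> b"
  shows "lexless a b \<or> lexless b a"
proof -
  let ?k = "to_nat_on (UNIV :: 'd set)"
  have ex: "\<exists>i. a $ i \<noteq> b $ i" using assms by (simp add: vec_eq_iff)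
  obtain i where i: "a $ i \<noteq> b $ i" "\<And>j. a $ j \<noteq> b $ j \<Longrightarrow> ?k i \<le> ?k j"
    using ex_has_least_nat[of "\<lambda>i. a $ i \<noteq> b $ i" _ ?k] ex by blast
  then have "\<forall>j. ?k j < ?k i \<longrightarrow> a $ j = b $ j" using not_less by blast
  moreover have "a $ i < b $ i \<or> b $ i < a $ i" using i(1) by linarith
  ultimately show ?thesis unfolding lexless_def by metis
qed

lemma lexless_asym: "lexless a b \<Longrightarrow> \<not> lexless b a"
  using lexless_trans lexless_irrefl by blast

text \<open>Sites are added in increasing order, so at each step the whole set built so far is the
  past of the new site. All chain rules are proved this way.\<close>

lemma finite_lex_induct [consumes 1, case_names empty insert]:
  fixes F :: "(int ^ 'd) set"
  assumes fin: "finite F" and empty: "P {}"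
    and insert: "\<And>g F. finite F \<Longrightarrow> g \<notin> F \<Longrightarrow> (\<forall>h\<in>F. lexless h g) \<Longrightarrow> P F \<Longrightarrow> P (insert g F)"
  shows "P F"
  using fin
proof (induction F rule: finite_psubset_induct)
  case (psubset F)
  show ?case
  proof (cases "F = {}")
    case False
    have "\<exists>g\<in>F. \<forall>h\<in>F. h \<noteq> g \<longrightarrow> lexless h g" using psubset(1) False
    proof (induction F rule: finite_ne_induct)
      case (insert x F)
      then obtain g where g: "g \<in> F" "\<forall>h\<in>F. h \<noteq> g \<longrightarrow> lexless h g" by blast
      show ?case
      proof (cases "lexless x g")
        case True
        then show ?thesis using g by blast
      next
        case False
        then have "lexless g x" using lexless_total[of g x] insert.hyps g(1) by auto
        then have "\<forall>h\<in>insert x F. h \<noteq> x \<longrightarrow> lexless h x"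
          using g(2) lexless_trans[of _ g x] by auto
        then show ?thesis by blast
      qed
    qed simp
    then obtain g where g: "g \<in> F" "\<forall>h\<in>F. h \<noteq> g \<longrightarrow> lexless h g" by blast
    have "P (insert g (F - {g}))"
    proof (rule insert)
      show "P (F - {g})" by (rule psubset(2)) (use g in auto)
    qed (use g psubset(1) in auto)
    then show ?thesis using g by (simp add: insert_absorb)
  qed (simp add: empty)
qed

section \<open>Patterns and sums over them\<close>

abbreviation pat :: "'v set \<Rightarrow> ('v \<Rightarrow> 'a) set" where
  "pat F \<equiv> PiE F (\<lambda>_. UNIV)"

lemma finite_pat [simp]: "finite F \<Longrightarrow> finite (pat F :: ('v \<Rightarrow> 'a::finite) set)"
  by (rule finite_PiE) auto

lemma sum_pat_insert:
  fixes X :: "('v \<Rightarrow> 'a::finite) \<Rightarrow> real"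
  assumes "finite F" "g \<notin> F"
  shows "(\<Sum>s\<in>pat (insert g F). X s) = (\<Sum>s\<in>pat F. \<Sum>a\<in>UNIV. X (s(g := a)))"
proof -
  have inj: "inj_on (\<lambda>(a, s). s(g := a)) (UNIV \<times> (pat F :: ('v \<Rightarrow> 'a) set))"
    by (rule inj_combinator[OF assms(2)])
  have "(\<Sum>s\<in>pat (insert g F). X s) = (\<Sum>(a, s)\<in>UNIV \<times> pat F. X (s(g := a)))"
    unfolding PiE_insert_eq by (subst sum.reindex[OF inj]) (simp add: case_prod_unfold comp_def)
  also have "\<dots> = (\<Sum>a\<in>UNIV. \<Sum>s\<in>pat F. X (s(g := a)))"
    by (rule sum.cartesian_product[symmetric])
  also have "\<dots> = (\<Sum>s\<in>pat F. \<Sum>a\<in>UNIV. X (s(g := a)))" by (rule sum.swap)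
  finally show ?thesis .
qed

text \<open>Summing out the coordinates in decreasing order, the factor of a coordinate outside \<open>F\<close>
  disappears when that coordinate is the largest one left, while a coordinate of \<open>F\<close> is absorbed
  into the weight \<open>\<rho>\<close>.\<close>

lemma sum_conditional_prod_le:
  fixes q :: "int ^ 'd \<Rightarrow> (int ^ 'd \<Rightarrow> 'a::finite) \<Rightarrow> real" and \<rho> :: "(int ^ 'd \<Rightarrow> 'a) \<Rightarrow> real"
  assumes "finite B" and "F \<subseteq> B"
    and "\<And>g s. g \<in> B \<Longrightarrow> 0 \<le> q g s" and "\<And>s. 0 \<le> \<rho> s"
    and "\<And>g s s'. g \<in> B \<Longrightarrow> (\<And>h. h \<in> B \<Longrightarrow> h = g \<or> lexless h g \<Longrightarrow> s h = s' h) \<Longrightarrow> q g s = q g s'"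
    and "\<And>g s. g \<in> B \<Longrightarrow> (\<Sum>a\<in>UNIV. q g (s(g := a))) \<le> 1"
  shows "(\<Sum>s\<in>pat B. \<rho> (restrict s F) * (\<Prod>g\<in>B - F. q g s)) \<le> (\<Sum>s\<in>pat F. \<rho> s)"
  using assms
proof (induction B arbitrary: F \<rho> rule: finite_lex_induct)
  case empty
  from empty(1) show ?case by (simp add: restrict_def)
next
  case (insert g B)
  have loc: "q h s = q h s'" if "h \<in> B" "\<And>k. k \<in> B \<Longrightarrow> k = h \<or> lexless k h \<Longrightarrow> s k = s' k" for h s s'
  proof (rule insert.prems(4))
    fix k assume k: "k \<in> insert g B" "k = h \<or> lexless k h"
    have "k \<noteq> g" using k(2) that(1) insert.hyps lexless_asym by blast
    then show "s k = s' k" using that(2) k by blast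
  qed (use that in simp)
  \<comment> \<open>\<open>g\<close> is larger than all sites of \<open>B\<close>, so the remaining
    factors do not see the symbol at \<open>g\<close>.\<close>
  have upd: "q h (s(g := a)) = q h s" if "h \<in> B" for h s a
    by (rule loc[OF that]) (use insert.hyps(2) in auto)
  have IH: "(\<Sum>s\<in>pat B. \<rho> (restrict s F) * (\<Prod>g\<in>B - F. q g s)) \<le> (\<Sum>s\<in>pat F. \<rho> s)"
    if "F \<subseteq> B" "\<And>s. 0 \<le> \<rho> s" for F and \<rho> :: "(int ^ 'd \<Rightarrow> 'a) \<Rightarrow> real"
    by (rule insert.IH[OF that(1) insert.prems(2) that(2) loc insert.prems(5)]) simp_all
  show ?case
  proof (cases "g \<in> F")
    case False
    then have F: "F \<subseteq> B" using insert.prems(1) by blast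
    have "(\<Sum>s\<in>pat (insert g B). \<rho> (restrict s F) * (\<Prod>g\<in>insert g B - F. q g s))
      = (\<Sum>s\<in>pat B. \<Sum>a\<in>UNIV. \<rho> (restrict (s(g := a)) F) * (\<Prod>h\<in>insert g B - F. q h (s(g := a))))"
      by (rule sum_pat_insert[OF insert.hyps(1,2)])
    also have "\<dots> = (\<Sum>s\<in>pat B. \<rho> (restrict s F) * (\<Prod>h\<in>B - F. q h s) * (\<Sum>a\<in>UNIV. q g (s(g := a))))"
    proof (rule sum.cong[OF refl])
      fix s :: "int ^ 'd \<Rightarrow> 'a"
      have "restrict (s(g := a)) F = restrict s F" for a using False by (auto simp: restrict_def)
      moreover have "(\<Prod>h\<in>insert g B - F. q h (s(g := a))) = q g (s(g := a)) * (\<Prod>h\<in>B - F. q h s)" for a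
        using False insert.hyps by (simp add: insert_Diff_if upd)
      ultimately show "(\<Sum>a\<in>UNIV. \<rho> (restrict (s(g := a)) F) * (\<Prod>h\<in>insert g B - F. q h (s(g := a))))
         = \<rho> (restrict s F) * (\<Prod>h\<in>B - F. q h s) * (\<Sum>a\<in>UNIV. q g (s(g := a)))"
        by (simp add: sum_distrib_left mult_ac)
    qed
    also have "\<dots> \<le> (\<Sum>s\<in>pat B. \<rho> (restrict s F) * (\<Prod>h\<in>B - F. q h s))"
      by (intro sum_mono mult_left_le insert.prems(5) mult_nonneg_nonneg prod_nonneg)
         (use insert.prems(2,3) in auto)
    also have "\<dots> \<le> (\<Sum>s\<in>pat F. \<rho> s)"
      by (rule IH[OF F]) (use insert.prems(3) in auto)
    finally show ?thesis .
  next
    case True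
    define F' where "F' = F - {g}"
    have F': "F = insert g F'" "g \<notin> F'" "F' \<subseteq> B" using True insert.prems(1) by (auto simp: F'_def)
    have finF': "finite F'" using F'(3) insert.hyps(1) finite_subset by blast
    define \<rho>' where "\<rho>' s = (\<Sum>a\<in>UNIV. \<rho> (s(g := a)))" for s
    have "(\<Sum>s\<in>pat (insert g B). \<rho> (restrict s F) * (\<Prod>g\<in>insert g B - F. q g s))
      = (\<Sum>s\<in>pat B. \<Sum>a\<in>UNIV. \<rho> (restrict (s(g := a)) F) * (\<Prod>h\<in>insert g B - F. q h (s(g := a))))"
      by (rule sum_pat_insert[OF insert.hyps(1,2)])
    also have "\<dots> = (\<Sum>s\<in>pat B. \<rho>' (restrict s F') * (\<Prod>h\<in>B - F'. q h s))"
    proof (rule sum.cong[OF refl])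
      fix s :: "int ^ 'd \<Rightarrow> 'a"
      have "restrict (s(g := a)) F = (restrict s F')(g := a)" for a
        using F' by (auto simp: restrict_def)
      moreover have "insert g B - F = B - F'" using F' insert.hyps(2) by auto
      moreover have "(\<Prod>h\<in>B - F'. q h (s(g := a))) = (\<Prod>h\<in>B - F'. q h s)" for a
        by (rule prod.cong[OF refl]) (simp add: upd)
      ultimately show "(\<Sum>a\<in>UNIV. \<rho> (restrict (s(g := a)) F) * (\<Prod>h\<in>insert g B - F. q h (s(g := a))))
         = \<rho>' (restrict s F') * (\<Prod>h\<in>B - F'. q h s)"
        by (simp add: \<rho>'_def sum_distrib_right)
    qed
    also have "\<dots> \<le> (\<Sum>s\<in>pat F'. \<rho>' s)"
      by (rule IH[OF F'(3)]) (use insert.prems(3) in \<open>auto simp: \<rho>'_def intro!: sum_nonneg\<close>)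
    also have "\<dots> = (\<Sum>s\<in>pat F. \<rho> s)"
      unfolding \<rho>'_def F'(1) by (rule sum_pat_insert[OF finF' F'(2), symmetric])
    finally show ?thesis .
  qed
qed

section \<open>Boxes: cardinality and covering\<close>

lemma card_vec_box:
  "finite I \<Longrightarrow> finite {g :: 'b ^ 'd. \<forall>i. g $ i \<in> I}
    \<and> card {g :: 'b ^ 'd. \<forall>i. g $ i \<in> I} = card I ^ CARD('d)"
proof -
  assume I: "finite I"
  have b: "bij_betw vec_lambda (PiE (UNIV :: 'd set) (\<lambda>_. I)) {g :: 'b ^ 'd. \<forall>i. g $ i \<in> I}"
    by (rule bij_betwI[of _ _ _ vec_nth]) auto
  have "finite (PiE (UNIV :: 'd set) (\<lambda>_. I))" using I by (intro finite_PiE) auto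
  then show ?thesis
    using bij_betw_same_card[OF b] bij_betw_finite[OF b] by (simp add: card_PiE)
qed

lemma Lam_box:
  fixes G :: "(int ^ 'd) set"
  assumes "index_set G"
  shows "Lam G n = {g. \<forall>i. g $ i \<in> (if G = UNIV then {- int n<..<int n} else {0..<int n})}"
proof (cases "G = UNIV")
  case True
  then show ?thesis unfolding Lam_def
    by (fastforce simp: abs_less_iff minus_less_iff)
next
  case False
  then have "G = {g. \<forall>i. 0 \<le> g $ i}" using assms by blast
  moreover have "(\<forall>i. 0 \<le> g $ i) \<and> (\<forall>i. \<bar>g $ i\<bar> < int n) \<longleftrightarrow> (\<forall>i. g $ i \<in> {0..<int n})"
    for g :: "int ^ 'd" by (fastforce simp: abs_less_iff)
  ultimately show ?thesis using False unfolding Lam_def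
    by simp
qed

lemma finite_Lam [simp]: "index_set G \<Longrightarrow> finite (Lam G n)"
  unfolding Lam_box by (intro card_vec_box[THEN conjunct1]) simp

lemma card_Lam:
  fixes G :: "(int ^ 'd) set"
  assumes "index_set G"
  shows "card (Lam G n) = (if G = UNIV then 2 * n - 1 else n) ^ CARD('d)"
  unfolding Lam_box[OF assms] by (subst card_vec_box[THEN conjunct2]) (auto intro!: arg_cong[where f="\<lambda>k. k ^ CARD('d)"])

lemma card_Lam_ge:
  fixes G :: "(int ^ 'd) set"
  assumes "index_set G"
  shows "n ^ CARD('d) \<le> card (Lam G n)"
proof -
  have "n \<le> (if G = UNIV then 2 * n - 1 else n)" by auto
  then show ?thesis unfolding card_Lam[OF assms] by (rule power_mono) simp
qed

lemma card_Lam_ge1: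
  fixes G :: "(int ^ 'd) set"
  assumes "index_set G"
  shows "n \<le> card (Lam G n)"
proof -
  have "n \<le> n ^ CARD('d)" by (cases n) (simp_all add: self_le_power Suc_leI)
  then show ?thesis using card_Lam_ge[OF assms, of n] by simp
qed

lemma Lam_subset [simp]: "Lam G n \<subseteq> G"
  by (auto simp: Lam_def)

lemma Lam_mono: "m \<le> n \<Longrightarrow> Lam G m \<subseteq> Lam G n"
  by (auto simp: Lam_def intro: order_less_le_trans)

lemma Lam_add: "index_set G \<Longrightarrow> g \<in> Lam G m \<Longrightarrow> h \<in> Lam G n \<Longrightarrow> g + h \<in> Lam G (m + n)"
  by (auto simp: Lam_def intro: order_le_less_trans[OF abs_triangle_ineq add_strict_mono])

text \<open>The Folner property of the boxes; it disposes of all boundary terms below.\<close>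

lemma card_Lam_ratio:
  fixes G :: "(int ^ 'd) set"
  assumes G: "index_set G"
  shows "(\<lambda>n. real (card (Lam G (n + m))) / real (card (Lam G n))) \<longlonglongrightarrow> 1"
    and "(\<lambda>n. real (card (Lam G (n - m))) / real (card (Lam G n))) \<longlonglongrightarrow> 1"
proof -
  define b :: "nat \<Rightarrow> real" where "b n = real (if G = UNIV then 2 * n - 1 else n)" for n
  have c: "real (card (Lam G n)) = b n ^ CARD('d)" for n
    by (simp add: card_Lam[OF G] b_def)
  have 1: "(\<lambda>n. b (n + m) / b n) \<longlonglongrightarrow> 1"
  proof (cases "G = UNIV")
    case True
    have "(\<lambda>n. (2 * (real n + real m) - 1) / (2 * real n - 1)) \<longlonglongrightarrow> 1" by real_asymp
    then show ?thesis
      by (rule Lim_transform_eventually)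
         (use True in \<open>auto simp: b_def of_nat_diff eventually_sequentially intro!: exI[of _ 1]\<close>)
  next
    case False
    have "(\<lambda>n. (real n + real m) / real n) \<longlonglongrightarrow> 1" by real_asymp
    then show ?thesis using False by (simp add: b_def)
  qed
  have 2: "(\<lambda>n. b (n - m) / b n) \<longlonglongrightarrow> 1"
  proof (cases "G = UNIV")
    case True
    have "(\<lambda>n. (2 * (real n - real m) - 1) / (2 * real n - 1)) \<longlonglongrightarrow> 1" by real_asymp
    then show ?thesis
      by (rule Lim_transform_eventually)
         (use True in \<open>auto simp: b_def of_nat_diff eventually_sequentially intro!: exI[of _ "Suc m"]\<close>)
  next
    case False
    have "(\<lambda>n. (real n - real m) / real n) \<longlonglongrightarrow> 1" by real_asymp
    then show ?thesis
      by (rule Lim_transform_eventually)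
         (use False in \<open>auto simp: b_def of_nat_diff eventually_sequentially intro!: exI[of _ "Suc m"]\<close>)
  qed
  show "(\<lambda>n. real (card (Lam G (n + m))) / real (card (Lam G n))) \<longlonglongrightarrow> 1"
    using tendsto_power[OF 1, of "CARD('d)"] by (simp add: c power_divide)
  show "(\<lambda>n. real (card (Lam G (n - m))) / real (card (Lam G n))) \<longlonglongrightarrow> 1"
    using tendsto_power[OF 2, of "CARD('d)"] by (simp add: c power_divide)
qed

lemma Lam_add_nonneg:
  assumes G: "index_set G" and v: "\<And>i. 0 \<le> v $ i \<and> v $ i \<le> int m" and g: "g \<in> Lam G (n - m)"
  shows "g + v \<in> Lam G n"
proof -
  have "\<bar>g $ i + v $ i\<bar> < int n" for i
  proof -
    have "\<bar>g $ i\<bar> < int (n - m)" using g by (simp add: Lam_def)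
    then show ?thesis using v[of i] by linarith
  qed
  then show ?thesis using G g v by (auto simp: Lam_def)
qed

text \<open>Greedy choice of a largest box, of size \<open>m\<close> say. The base points whose
  boxes meet it differ from its own base point by less than \<open>2 * m\<close> in each coordinate;
  there are fewer than \<open>(4 * m) ^ d\<close> of them, while the box has at least
  \<open>m ^ d\<close> sites. This is the origin of the factor \<open>4 ^ d\<close>. The boxes that
  remain are disjoint from the chosen one, so its part of \<open>E\<close> can be taken out before
  the induction goes on.\<close>

lemma vitali_count:
  fixes G :: "(int ^ 'd) set" and D :: "int ^ 'd \<Rightarrow> real"
  assumes G: "index_set G" and "finite A" and "finite E" and D: "\<And>g. 0 \<le> D g" and lam: "0 \<le> \<kappa>"
    and pos: "\<And>t. 0 < n t"
    and "\<And>t. t \<in> A \<Longrightarrow> (+) t ` Lam G (n t) \<subseteq> E"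
    and "\<And>t. t \<in> A \<Longrightarrow> \<kappa> * real (card (Lam G (n t))) \<le> (\<Sum>g\<in>Lam G (n t). D (t + g))"
  shows "\<kappa> * real (card A) \<le> 4 ^ CARD('d) * (\<Sum>g\<in>E. D g)"
  using assms(2,3,7,8)
proof (induction A arbitrary: E rule: finite_psubset_induct)
  case (psubset A)
  show ?case
  proof (cases "A = {}")
    case True
    then show ?thesis using D by (simp add: sum_nonneg)
  next
    case False
    obtain t where t: "t \<in> A" "\<And>x. x \<in> A \<Longrightarrow> n x \<le> n t"
      using Max_in[of "n ` A"] Max_ge[of "n ` A"] psubset(1) False
      by (metis (no_types, lifting) finite_imageI imageE image_eqI image_is_empty)
    define m where "m = n t"
    let ?Q = "{y :: int ^ 'd. \<forall>i. y $ i \<in> {- 2 * int m<..<2 * int m}}"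
    let ?R = "(+) t ` Lam G m"
    define X where "X = {x \<in> A. x - t \<in> ?Q}"
    have "finite ?Q" by (rule card_vec_box[THEN conjunct1]) simp
    then have "card X \<le> card ?Q"
      by (rule card_inj_on_le[of "\<lambda>x. x - t", rotated 2]) (auto simp: X_def inj_on_def)
    also have "card ?Q = (4 * m - 1) ^ CARD('d)"
      by (subst card_vec_box[THEN conjunct2]) (auto intro!: arg_cong[where f="\<lambda>k. k ^ CARD('d)"])
    also have "\<dots> \<le> (4 * m) ^ CARD('d)" by (rule power_mono) auto
    also have "\<dots> \<le> 4 ^ CARD('d) * card (Lam G m)"
      unfolding power_mult_distrib by (intro mult_left_mono card_Lam_ge[OF G]) simp
    finally have "real (card X) \<le> real (4 ^ CARD('d) * card (Lam G m))" by (simp only: of_nat_le_iff)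
    then have "\<kappa> * real (card X) \<le> \<kappa> * (4 ^ CARD('d) * real (card (Lam G m)))"
      using lam by (intro mult_left_mono) simp_all
    also have "\<dots> \<le> 4 ^ CARD('d) * (\<Sum>g\<in>Lam G m. D (t + g))"
      using psubset.prems(3)[OF t(1)] unfolding m_def[symmetric] by (simp add: mult.left_commute)
    also have "(\<Sum>g\<in>Lam G m. D (t + g)) = (\<Sum>g\<in>?R. D g)"
      by (subst sum.reindex) simp_all
    finally have X: "\<kappa> * real (card X) \<le> 4 ^ CARD('d) * (\<Sum>g\<in>?R. D g)" .
    have tX: "t \<in> X" if "m > 0" using t(1) that by (simp add: X_def)
    have disj: "(+) x ` Lam G (n x) \<inter> ?R = {}" if x: "x \<in> A" "x \<notin> X" for x
    proof -
      have "x - t \<in> ?Q" if ab: "a \<in> Lam G (n x)" "b \<in> Lam G m" "x + a = t + b" for a b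
      proof -
        have "(x - t) $ i \<in> {- 2 * int m<..<2 * int m}" for i
        proof -
          have "x $ i + a $ i = t $ i + b $ i" using ab(3) by (metis vector_add_component)
          moreover have "\<bar>a $ i\<bar> < int m" "\<bar>b $ i\<bar> < int m"
            using ab t(2)[OF x(1)] by (auto simp: Lam_def m_def intro: order_less_le_trans)
          ultimately show ?thesis by auto
        qed
        then show ?thesis by blast
      qed
      then show ?thesis using x by (auto simp: X_def)
    qed
    have IH: "\<kappa> * real (card (A - X)) \<le> 4 ^ CARD('d) * (\<Sum>g\<in>E - ?R. D g)" if "m > 0"
    proof (rule psubset.IH)
      show "A - X \<subset> A" using t(1) tX[OF that] by blast
      show "finite (E - ?R)" using psubset.prems(1) by simp
      show "(+) x ` Lam G (n x) \<subseteq> E - ?R" if "x \<in> A - X" for x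
        using psubset.prems(2) disj that by blast
    qed (use psubset.prems(3) in blast)
    have RE: "?R \<subseteq> E" using psubset.prems(2)[OF t(1)] by (simp add: m_def)
    have True: "m > 0" using pos by (simp add: m_def)
    have "card A = card X + card (A - X)"
      using psubset(1) by (metis (no_types, lifting) X_def card_Diff_subset card_mono finite_subset
          le_add_diff_inverse mem_Collect_eq subsetI)
    then have "\<kappa> * real (card A) = \<kappa> * real (card X) + \<kappa> * real (card (A - X))"
      by (simp add: algebra_simps)
    also have "\<dots> \<le> 4 ^ CARD('d) * ((\<Sum>g\<in>?R. D g) + (\<Sum>g\<in>E - ?R. D g))"
      using X IH[OF True] by (simp add: algebra_simps)
    also have "(\<Sum>g\<in>?R. D g) + (\<Sum>g\<in>E - ?R. D g) = (\<Sum>g\<in>E. D g)"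
      using sum.subset_diff[OF RE psubset.prems(1), of D] by simp
    finally show ?thesis .
  qed
qed

text \<open>A string of length \<open>l\<close> is a pattern on the first \<open>l\<close> sites,
  which in general do not form a box. Divided by \<open>D ^ l\<close>, its weight is a product of
  factors \<open>q g\<close> that depend on \<open>g\<close> and smaller sites only and sum to at
  most 1 over the symbol at \<open>g\<close>. So \<open>sum_conditional_prod_le\<close> applies with
  \<open>F = {}\<close>.\<close>

lemma string_weight_kraft:
  fixes G :: "(int ^ 'd) set" and f :: "int ^ 'd \<Rightarrow> nat" and u :: "int ^ 'd" and vs :: "(int ^ 'd) list"
    and tab :: "'a::finite list \<Rightarrow> nat"
  assumes G: "index_set G" and f: "bij_betw f G UNIV"
    and u: "\<forall>i. 0 \<le> u $ i" and vs: "\<And>v. v \<in> set vs \<Longrightarrow> (\<forall>i. 0 \<le> v $ i) \<and> lexless v u"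
    and D: "\<And>c. (\<Sum>a\<in>UNIV. tab (a # c)) \<le> D" and D2: "CARD('a) \<le> D"
  shows "(\<Sum>x\<in>{x. length x = l}. real (string_weight (site G f) (u # vs) tab x)) \<le> real D ^ l"
proof -
  define B where "B = inv_into G f ` {..<l}"
  have inj: "inj_on f G" and surj: "f ` G = UNIV" using f by (auto simp: bij_betw_def)
  have B: "g \<in> B \<longleftrightarrow> g \<in> G \<and> f g < l" for g
  proof
    assume "g \<in> B"
    then obtain j where "j < l" "g = inv_into G f j" by (auto simp: B_def)
    then show "g \<in> G \<and> f g < l" using surj by (simp add: f_inv_into_f inv_into_into)
  next
    assume "g \<in> G \<and> f g < l"
    then show "g \<in> B" unfolding B_def by (metis inj inv_into_f_f image_eqI lessThan_iff)
  qed
  have finB: "finite B" by (simp add: B_def)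
  have bijB: "bij_betw (inv_into G f) {..<l} B"
    unfolding B_def by (rule inj_on_imp_bij_betw) (use surj in \<open>auto intro: inj_on_inv_into inj_on_subset\<close>)
  have cardB: "card B = l" using bij_betw_same_card[OF bijB] by simp
  have fi: "f (inv_into G f j) = j" for j using surj by (simp add: f_inv_into_f)
  have Gadd: "c + v \<in> G" if "c \<in> G" "\<forall>i. 0 \<le> v $ i" for c v using G that by auto
  define good where "good g \<longleftrightarrow> g - u \<in> B \<and> (\<forall>v\<in>set vs. (g - u) + v \<in> B)" for g
  \<comment> \<open>A site without a complete window gets the uniform value \<open>1 / D\<close>,
    which sums to at most 1 because \<open>D\<close> is at least the size of the alphabet.\<close>
  define q where "q g s = (if good g then real (tab (s g # map (\<lambda>v. s ((g - u) + v)) vs)) else 1) / real D"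
    for g and s :: "int ^ 'd \<Rightarrow> 'a"
  have Dpos: "D > 0" using D2 by (metis finite_UNIV_card_ge_0 finite not_le_imp_less order_less_le_trans)
  define T where "T x = restrict (\<lambda>g. x ! f g) B" for x :: "'a list"
  have bij: "bij_betw T {x. length x = l} (pat B)"
  proof (rule bij_betwI[of _ _ _ "\<lambda>s. map (\<lambda>j. s (inv_into G f j)) [0..<l]"])
    show "map (\<lambda>j. T x (inv_into G f j)) [0..<l] = x" if "x \<in> {x. length x = l}" for x
      using that by (intro nth_equalityI) (auto simp: T_def B_def fi)
    show "T (map (\<lambda>j. s (inv_into G f j)) [0..<l]) = s" if s: "s \<in> pat B" for s
    proof (rule ext)
      fix g show "T (map (\<lambda>j. s (inv_into G f j)) [0..<l]) g = s g"
        using s B[of g] by (cases "g \<in> B") (simp_all add: T_def inv_into_f_f[OF inj] PiE_arb[OF s])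
    qed
  qed (auto simp: T_def)
  have weight: "real (string_weight (site G f) (u # vs) tab x) = real D ^ l * (\<Prod>g\<in>B. q g (T x))"
    if x: "length x = l" for x
  proof -
    let ?C = "{c \<in> B. \<forall>v\<in>set (u # vs). c + v \<in> B}"
    let ?t = "\<lambda>c. real (tab (map (\<lambda>v. T x (c + v)) (u # vs)))"
    have site: "site G f v (f c) < l \<longleftrightarrow> c + v \<in> B" if "c \<in> B" "v \<in> set (u # vs)" for c v
      using B Gadd that u vs inj by (auto simp: site_def inv_into_f_f)
    have "real (string_weight (site G f) (u # vs) tab x) = (\<Prod>j<l. (\<lambda>c.
        if \<forall>v\<in>set (u # vs). c + v \<in> B then ?t c else 1) (inv_into G f j))"
      unfolding string_weight_def x of_nat_prod
    proof (rule prod.cong[OF refl])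
      fix j assume j: "j \<in> {..<l}"
      define c where "c = inv_into G f j"
      have c: "c \<in> B" "j = f c" using j fi by (auto simp: c_def B_def)
      have m1: "(\<forall>v\<in>set (u # vs). site G f v j < l) \<longleftrightarrow> (\<forall>v\<in>set (u # vs). c + v \<in> B)"
        unfolding c(2) using site[OF c(1)] by blast
      have "x ! site G f v j = T x (c + v)" if "c + v \<in> B" for v
        using that by (simp add: T_def site_def c_def)
      then have m2: "map (\<lambda>v. x ! site G f v j) (u # vs) = map (\<lambda>v. T x (c + v)) (u # vs)"
        if "\<forall>v\<in>set (u # vs). c + v \<in> B" using that by (intro map_cong) auto
      show "real (if \<forall>v\<in>set (u # vs). site G f v j < l
          then tab (map (\<lambda>v. x ! site G f v j) (u # vs)) else 1)
          = (if \<forall>v\<in>set (u # vs). inv_into G f j + v \<in> B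
             then real (tab (map (\<lambda>v. T x (inv_into G f j + v)) (u # vs))) else 1)"
        unfolding c_def[symmetric] if_distrib[of real] of_nat_1
        by (rule if_cong[OF m1]) (simp_all only: m2)
    qed
    also have "\<dots> = (\<Prod>c\<in>B. if \<forall>v\<in>set (u # vs). c + v \<in> B then ?t c else 1)"
      by (rule prod.reindex_bij_betw[OF bijB])
    also have "\<dots> = (\<Prod>c\<in>?C. ?t c)" using finB by (intro prod.inter_filter[symmetric])
    \<comment> \<open>Each factor moves from the base point \<open>c\<close> of its window to the
      site \<open>c + u\<close> whose symbol it predicts.\<close>
    also have "\<dots> = (\<Prod>g\<in>{g\<in>B. good g}. real (tab (T x g # map (\<lambda>v. T x ((g - u) + v)) vs)))"
      by (rule prod.reindex_bij_witness[of _ "\<lambda>g. g - u" "\<lambda>c. c + u"]) (auto simp: good_def)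
    also have "\<dots> = (\<Prod>g\<in>B. if good g then real (tab (T x g # map (\<lambda>v. T x ((g - u) + v)) vs)) else 1)"
      using finB by (intro prod.inter_filter)
    also have "\<dots> = (\<Prod>g\<in>B. real D * q g (T x))"
      using Dpos by (intro prod.cong) (auto simp: q_def)
    also have "\<dots> = real D ^ l * (\<Prod>g\<in>B. q g (T x))" by (simp add: prod.distrib cardB)
    finally show ?thesis .
  qed
  have "(\<Sum>x\<in>{x. length x = l}. real (string_weight (site G f) (u # vs) tab x))
      = real D ^ l * (\<Sum>x\<in>{x. length x = l}. \<Prod>g\<in>B. q g (T x))"
    by (simp add: weight sum_distrib_left)
  also have "(\<Sum>x\<in>{x. length x = l}. \<Prod>g\<in>B. q g (T x)) = (\<Sum>s\<in>pat B. \<Prod>g\<in>B. q g s)"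
    by (rule sum.reindex_bij_betw[OF bij])
  also have "real D ^ l * \<dots> \<le> real D ^ l"
  proof -
    have "(\<Sum>s\<in>pat B. 1 * (\<Prod>g\<in>B - {}. q g s)) \<le> (\<Sum>s\<in>(pat {} :: (int ^ 'd \<Rightarrow> 'a) set). 1)"
    proof (rule sum_conditional_prod_le[OF finB, of "{}" q "\<lambda>_. 1"])
      fix g and s s' :: "int ^ 'd \<Rightarrow> 'a"
      assume g: "g \<in> B" and eq: "\<And>h. h \<in> B \<Longrightarrow> h = g \<or> lexless h g \<Longrightarrow> s h = s' h"
      show "q g s = q g s'"
      proof (cases "good g")
        case True
        have "s ((g - u) + v) = s' ((g - u) + v)" if v: "v \<in> set vs" for v
        proof (rule eq)
          show "(g - u) + v \<in> B" using True v by (simp add: good_def)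
          have "lexless (v + (g - u)) (u + (g - u))" unfolding lexless_add using vs[OF v] by simp
          then show "(g - u) + v = g \<or> lexless ((g - u) + v) g" by (simp add: add.commute)
        qed
        then have e: "map (\<lambda>v. s ((g - u) + v)) vs = map (\<lambda>v. s' ((g - u) + v)) vs" by simp
        have sg: "s g = s' g" using eq[OF g] by simp
        show ?thesis by (simp only: q_def e sg)
      qed (simp add: q_def)
    next
      fix g and s :: "int ^ 'd \<Rightarrow> 'a" assume g: "g \<in> B"
      show "(\<Sum>a\<in>UNIV. q g (s(g := a))) \<le> 1"
      proof (cases "good g")
        case True
        have "(g - u) + v \<noteq> g" if "v \<in> set vs" for v
          using vs[OF that] by (auto simp: algebra_simps)
        then have e: "map (\<lambda>v. (s(g := a)) ((g - u) + v)) vs = map (\<lambda>v. s ((g - u) + v)) vs" for a by simp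
        have "(\<Sum>a\<in>UNIV. q g (s(g := a)))
            = real (\<Sum>a\<in>UNIV. tab (a # map (\<lambda>v. s ((g - u) + v)) vs)) / real D"
          unfolding q_def e using True by (simp add: sum_divide_distrib)
        also have "\<dots> \<le> 1" using D[of "map (\<lambda>v. s ((g - u) + v)) vs"] Dpos
          by (simp add: divide_le_eq_1 del: of_nat_sum)
        finally show ?thesis .
      next
        case False
        then show ?thesis using D2 Dpos by (simp add: q_def)
      qed
    qed (auto simp: q_def)
    then show ?thesis by (intro mult_left_le) simp_all
  qed
  finally show ?thesis .
qed

section \<open>Entropy of a shift-invariant measure\<close>

locale shift_measure =
  fixes G :: "(int ^ 'd) set" and S :: "(int ^ 'd \<Rightarrow> 'a::finite) set" and \<mu> :: "(int ^ 'd \<Rightarrow> 'a) measure"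
  assumes index: "index_set G" and sub: "subshift G S" and inv: "\<mu> \<in> invariant_measures G S"
begin

lemma space_\<mu> [simp]: "space \<mu> = S" and prob_\<mu>: "prob_space \<mu>"
  using inv by (auto simp: invariant_measures_def)

sublocale prob_space \<mu> by (rule prob_\<mu>)

lemma prob_S [simp]: "prob S = 1"
  using prob_space by simp

lemma G_add: "g \<in> G \<Longrightarrow> h \<in> G \<Longrightarrow> g + h \<in> G"
  using index by auto

lemma zero_G [simp]: "0 \<in> G"
  using index by auto

lemma shift_in: "g \<in> G \<Longrightarrow> \<omega> \<in> S \<Longrightarrow> shift G g \<omega> \<in> S"
  using sub unfolding subshift_def by blast

lemma shift_apply: "i \<in> G \<Longrightarrow> shift G g \<omega> i = \<omega> (i + g)"
  by (simp add: shift_def)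

lemma S_ext: "S \<subseteq> PiE G (\<lambda>_. UNIV)"
  using sub closedin_subset[of "full_shift G" S] by (auto simp: subshift_def full_shift_def)

lemma sets_\<mu>: "sets \<mu> = sigma_sets S {U. openin (subtopology (full_shift G) S) U}"
proof -
  have "{U. openin (subtopology (full_shift G) S) U} \<subseteq> Pow S"
    using openin_subset[of "subtopology (full_shift G) S"] by (auto simp: topspace_subtopology)
  then show ?thesis using inv by (simp add: invariant_measures_def borel_subshift_def)
qed

section \<open>Cylinders and local functions\<close>

definition cyl :: "(int ^ 'd) set \<Rightarrow> (int ^ 'd \<Rightarrow> 'a) \<Rightarrow> (int ^ 'd \<Rightarrow> 'a) set" where
  "cyl V s = {\<omega> \<in> S. \<forall>g\<in>V. \<omega> g = s g}"

text \<open>The second argument is a whole configuration of which only the part on \<open>V\<close>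
  matters. This makes \<open>m V\<close> a random variable, and
  \<open>- log 2 (m V \<omega>)\<close> the information contained in the symbols of \<omega> on
  \<open>V\<close>.\<close>

definition m :: "(int ^ 'd) set \<Rightarrow> (int ^ 'd \<Rightarrow> 'a) \<Rightarrow> real" where
  "m V s = prob (cyl V s)"

lemma openin_cyl:
  assumes "finite V" "V \<subseteq> G"
  shows "openin (subtopology (full_shift G) S) (cyl V s)"
proof -
  let ?X = "\<lambda>g. if g \<in> V then {s g} else UNIV"
  have "openin (full_shift G) (PiE G ?X)"
    unfolding full_shift_def
    by (subst openin_PiE_gen) (use assms in \<open>auto intro: finite_subset[of _ V]\<close>)
  moreover have "cyl V s = PiE G ?X \<inter> S"
    using S_ext assms(2) by (auto simp: cyl_def PiE_iff split: if_splits)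
  ultimately show ?thesis by (auto simp: openin_subtopology)
qed

lemma cyl_sets: "finite V \<Longrightarrow> V \<subseteq> G \<Longrightarrow> cyl V s \<in> sets \<mu>"
  unfolding sets_\<mu> using openin_cyl by (intro sigma_sets.Basic) simp

text \<open>The quantifiers range over all functions, not only over points of \<open>S\<close>, so
  that a local function can also be evaluated at a pattern.\<close>

definition local_on :: "(int ^ 'd) set \<Rightarrow> ((int ^ 'd \<Rightarrow> 'a) \<Rightarrow> 'b) \<Rightarrow> bool" where
  "local_on V F \<longleftrightarrow> (\<forall>\<omega> \<omega>'. (\<forall>g\<in>V. \<omega> g = \<omega>' g) \<longrightarrow> F \<omega> = F \<omega>')"

lemma local_onI: "(\<And>\<omega> \<omega>'. (\<And>g. g \<in> V \<Longrightarrow> \<omega> g = \<omega>' g) \<Longrightarrow> F \<omega> = F \<omega>') \<Longrightarrow> local_on V F"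
  unfolding local_on_def by blast

lemma local_onD: "local_on V F \<Longrightarrow> (\<And>g. g \<in> V \<Longrightarrow> \<omega> g = \<omega>' g) \<Longrightarrow> F \<omega> = F \<omega>'"
  unfolding local_on_def by blast

lemma local_on_restrict: "local_on V F \<Longrightarrow> F (restrict \<omega> V) = F \<omega>"
  by (rule local_onD[of V]) auto

lemma local_on_mono: "local_on V F \<Longrightarrow> V \<subseteq> V' \<Longrightarrow> local_on V' F"
  unfolding local_on_def by blast

lemma local_on_m: "local_on V (m V)"
  by (rule local_onI) (simp add: m_def cyl_def)

lemma local_on_comp:
  assumes "local_on V F"
  shows "local_on V (\<lambda>\<omega>. k (F \<omega>))"
proof (rule local_onI)
  fix \<omega> \<omega>' :: "int ^ 'd \<Rightarrow> 'a" assume "\<And>g. g \<in> V \<Longrightarrow> \<omega> g = \<omega>' g"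
  then have "F \<omega> = F \<omega>'" by (rule local_onD[OF assms])
  then show "k (F \<omega>) = k (F \<omega>')" by simp
qed

lemma local_on_comp2:
  assumes "local_on V F" "local_on V F'"
  shows "local_on V (\<lambda>\<omega>. k (F \<omega>) (F' \<omega>))"
proof (rule local_onI)
  fix \<omega> \<omega>' :: "int ^ 'd \<Rightarrow> 'a" assume eq: "\<And>g. g \<in> V \<Longrightarrow> \<omega> g = \<omega>' g"
  have "F \<omega> = F \<omega>'" by (rule local_onD[OF assms(1)]) (rule eq)
  moreover have "F' \<omega> = F' \<omega>'" by (rule local_onD[OF assms(2)]) (rule eq)
  ultimately show "k (F \<omega>) (F' \<omega>) = k (F \<omega>') (F' \<omega>')" by simp
qed

lemma cyl_partition:
  assumes "finite V" "V \<subseteq> G" "local_on V Q"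
  shows "{\<omega> \<in> S. Q \<omega>} = (\<Union>s\<in>{s \<in> pat V. Q s}. cyl V s)"
proof (intro set_eqI iffI)
  fix \<omega> assume \<omega>: "\<omega> \<in> {\<omega> \<in> S. Q \<omega>}"
  then have "restrict \<omega> V \<in> {s \<in> pat V. Q s}" using local_on_restrict[OF assms(3)] by simp
  moreover have "\<omega> \<in> cyl V (restrict \<omega> V)" using \<omega> by (simp add: cyl_def)
  ultimately show "\<omega> \<in> (\<Union>s\<in>{s \<in> pat V. Q s}. cyl V s)" by blast
next
  fix \<omega> assume "\<omega> \<in> (\<Union>s\<in>{s \<in> pat V. Q s}. cyl V s)"
  then obtain s where s: "Q s" "\<omega> \<in> cyl V s" by blast
  then have "Q \<omega> = Q s" by (intro local_onD[OF assms(3)]) (simp add: cyl_def)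
  then show "\<omega> \<in> {\<omega> \<in> S. Q \<omega>}" using s by (simp add: cyl_def)
qed

lemma local_sets:
  assumes "finite V" "V \<subseteq> G" "local_on V Q"
  shows "{\<omega> \<in> S. Q \<omega>} \<in> sets \<mu>"
  unfolding cyl_partition[OF assms]
  by (rule sets.finite_UN) (use assms cyl_sets in auto)

lemma expectation_local:
  fixes F :: "(int ^ 'd \<Rightarrow> 'a) \<Rightarrow> real"
  assumes V: "finite V" "V \<subseteq> G" and F: "local_on V F"
  shows integrable_local: "integrable \<mu> F"
    and integral_local: "integral\<^sup>L \<mu> F = (\<Sum>s\<in>pat V. m V s * F s)"
proof -
  have "F \<omega> = (\<Sum>s\<in>pat V. F s * indicator (cyl V s) \<omega>)" if "\<omega> \<in> S" for \<omega>
  proof -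
    have *: "\<omega> \<in> cyl V s \<longleftrightarrow> s = restrict \<omega> V" if "s \<in> pat V" for s
      using that \<open>\<omega> \<in> S\<close> by (auto simp: cyl_def PiE_iff fun_eq_iff extensional_def)
    have "(\<Sum>s\<in>pat V. F s * indicator (cyl V s) \<omega>) = (\<Sum>s\<in>pat V. if s = restrict \<omega> V then F s else 0)"
      by (rule sum.cong) (auto simp: indicator_def *)
    also have "\<dots> = F (restrict \<omega> V)" using V by (subst sum.delta) auto
    finally show ?thesis by (simp add: local_on_restrict[OF F])
  qed
  moreover have "has_bochner_integral \<mu> (\<lambda>\<omega>. \<Sum>s\<in>pat V. F s * indicator (cyl V s) \<omega>) (\<Sum>s\<in>pat V. F s * m V s)"
    unfolding m_def
    by (intro has_bochner_integral_sum has_bochner_integral_mult_right has_bochner_integral_real_indicator)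
       (use V cyl_sets in \<open>auto simp: less_top[symmetric]\<close>)
  ultimately have "has_bochner_integral \<mu> F (\<Sum>s\<in>pat V. F s * m V s)"
    by (subst has_bochner_integral_cong[OF refl _ refl]) auto
  then show "integrable \<mu> F" "integral\<^sup>L \<mu> F = (\<Sum>s\<in>pat V. m V s * F s)"
    by (auto simp: has_bochner_integral_iff mult.commute)
qed

lemma m_nonneg [simp]: "0 \<le> m V s" and m_le_1: "m V s \<le> 1"
  by (simp_all add: m_def)

lemma m_mono: "V \<subseteq> V' \<Longrightarrow> finite V' \<Longrightarrow> V' \<subseteq> G \<Longrightarrow> m V' s \<le> m V s"
  unfolding m_def by (intro finite_measure_mono cyl_sets) (auto simp: cyl_def intro: finite_subset)

lemma sum_m: "finite V \<Longrightarrow> V \<subseteq> G \<Longrightarrow> (\<Sum>s\<in>pat V. m V s) = 1"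
  using integral_local[of V "\<lambda>_. 1"] by (simp add: local_on_def)

lemma m_empty [simp]: "m {} s = 1"
  using prob_space by (simp add: m_def cyl_def)

lemma sum_m_insert:
  assumes "finite V" "insert g V \<subseteq> G" "g \<notin> V"
  shows "(\<Sum>a\<in>UNIV. m (insert g V) (s(g := a))) = m V s"
proof -
  have "cyl V s = (\<Union>a\<in>UNIV. cyl (insert g V) (s(g := a)))"
    using assms(3) by (auto simp: cyl_def)
  then have "m V s = prob (\<Union>a\<in>UNIV. cyl (insert g V) (s(g := a)))" by (simp add: m_def)
  also have "\<dots> = (\<Sum>a\<in>UNIV. prob (cyl (insert g V) (s(g := a))))"
  proof (rule finite_measure_finite_Union)
    show "(\<lambda>a. cyl (insert g V) (s(g := a))) ` UNIV \<subseteq> sets \<mu>"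
      using assms by (intro image_subsetI cyl_sets) auto
  qed (auto simp: disjoint_family_on_def cyl_def)
  finally show ?thesis by (simp add: m_def)
qed

section \<open>Consequences of invariance\<close>

lemma emeasure_shift:
  "g \<in> G \<Longrightarrow> A \<in> sets \<mu> \<Longrightarrow> emeasure \<mu> (shift G g -` A \<inter> S) = emeasure \<mu> A"
  using inv by (auto simp: invariant_measures_def)

text \<open>The measure of a nonmeasurable set is 0 by convention, so invariance itself forces the
  preimage of a non-null set to be measurable. For a null set the argument is applied to the
  complement, which has probability 1.\<close>

lemma shift_sets:
  assumes g: "g \<in> G" and A: "A \<in> sets \<mu>"
  shows "shift G g -` A \<inter> S \<in> sets \<mu>"
proof (cases "emeasure \<mu> A = 0")
  case False
  then show ?thesis using emeasure_shift[OF g A] emeasure_notin_sets by metis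
next
  case True
  let ?B = "space \<mu> - A"
  have B: "?B \<in> sets \<mu>" using A by (rule sets.compl_sets)
  have "prob ?B = 1" using prob_compl[OF A] True by (simp add: measure_def)
  then have "emeasure \<mu> ?B \<noteq> 0" by (metis measure_eq_emeasure_eq_ennreal emeasure_eq_measure ennreal_0 ennreal_eq_0_iff not_one_le_zero)
  then have "shift G g -` ?B \<inter> S \<in> sets \<mu>"
    using emeasure_shift[OF g B] emeasure_notin_sets by metis
  then have "space \<mu> - (shift G g -` ?B \<inter> S) \<in> sets \<mu>" by (rule sets.compl_sets)
  moreover have "space \<mu> - (shift G g -` ?B \<inter> S) = shift G g -` A \<inter> S"
    using shift_in[OF g] by auto
  ultimately show ?thesis by simp
qed

lemma prob_shift:
  "g \<in> G \<Longrightarrow> A \<in> sets \<mu> \<Longrightarrow> prob (shift G g -` A \<inter> S) = prob A"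
  by (simp add: measure_def emeasure_shift)

lemma measurable_shift: "g \<in> G \<Longrightarrow> shift G g \<in> measurable \<mu> \<mu>"
  by (rule measurableI) (auto simp: shift_in shift_sets)

lemma distr_shift: "g \<in> G \<Longrightarrow> distr \<mu> \<mu> (shift G g) = \<mu>"
  by (rule measure_eqI) (auto simp: emeasure_distr measurable_shift emeasure_shift)

lemma AE_shift:
  assumes "g \<in> G" "AE \<omega> in \<mu>. P \<omega>"
  shows "AE \<omega> in \<mu>. P (shift G g \<omega>)"
proof (rule AE_distrD[OF measurable_shift[OF assms(1)]])
  show "AE \<omega> in distr \<mu> \<mu> (shift G g). P \<omega>" unfolding distr_shift[OF assms(1)] by fact
qed

lemma m_shift:
  assumes t: "t \<in> G" and V: "finite V" "V \<subseteq> G"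
  shows "m ((\<lambda>g. g + t) ` V) s = m V (\<lambda>g. s (g + t))"
proof -
  have "shift G t -` cyl V (\<lambda>g. s (g + t)) \<inter> S = cyl ((\<lambda>g. g + t) ` V) s"
    using V shift_in[OF t] by (auto simp: cyl_def shift_apply subset_iff)
  then show ?thesis using prob_shift[OF t cyl_sets[OF V, of "\<lambda>g. s (g + t)"]] by (simp add: m_def)
qed

lemma m_shift_config:
  assumes t: "t \<in> G" and V: "finite V" "V \<subseteq> G"
  shows "m V (shift G t \<omega>) = m ((\<lambda>g. g + t) ` V) \<omega>"
proof -
  have "m V (shift G t \<omega>) = m V (\<lambda>g. \<omega> (g + t))"
    by (rule local_onD[OF local_on_m]) (use V in \<open>auto simp: shift_apply\<close>)
  then show ?thesis by (simp add: m_shift[OF assms])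
qed

text \<open>There are only finitely many patterns on \<open>V\<close>, so the null cylinders
  together have measure 0.\<close>

lemma AE_m_pos:
  assumes "finite V" "V \<subseteq> G"
  shows "AE \<omega> in \<mu>. 0 < m V \<omega>"
proof -
  have loc: "local_on V (\<lambda>\<omega>. of_bool (m V \<omega> = 0) :: real)"
    using local_onD[OF local_on_m[of V]] by (intro local_onI) metis
  have "integral\<^sup>L \<mu> (\<lambda>\<omega>. of_bool (m V \<omega> = 0) :: real) = 0"
    unfolding integral_local[OF assms loc] by (intro sum.neutral) auto
  then have "AE \<omega> in \<mu>. of_bool (m V \<omega> = 0) = (0 :: real)"
    by (subst (asm) integral_nonneg_eq_0_iff_AE[OF integrable_local[OF assms loc]]) auto
  then show ?thesis by eventually_elim (auto simp: less_le)
qed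

text \<open>On null cylinders \<open>cp\<close> is 0, since \<open>x / 0 = 0\<close>.\<close>

definition cp :: "int ^ 'd \<Rightarrow> (int ^ 'd) set \<Rightarrow> (int ^ 'd \<Rightarrow> 'a) \<Rightarrow> real" where
  "cp g V \<omega> = m (insert g V) \<omega> / m V \<omega>"

definition H :: "(int ^ 'd) set \<Rightarrow> real" where
  "H V = (\<integral>\<omega>. - log 2 (m V \<omega>) \<partial>\<mu>)"

definition h :: "int ^ 'd \<Rightarrow> (int ^ 'd) set \<Rightarrow> real" where
  "h g V = (\<integral>\<omega>. - log 2 (cp g V \<omega>) \<partial>\<mu>)"

lemma local_on_cp: "local_on (insert g V) (cp g V)"
proof (rule local_onI)
  fix \<omega> \<omega>' :: "int ^ 'd \<Rightarrow> 'a" assume *: "\<And>k. k \<in> insert g V \<Longrightarrow> \<omega> k = \<omega>' k"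
  have "m (insert g V) \<omega> = m (insert g V) \<omega>'" by (rule local_onD[OF local_on_m]) (rule *)
  moreover have "m V \<omega> = m V \<omega>'" by (rule local_onD[OF local_on_m]) (use * in auto)
  ultimately show "cp g V \<omega> = cp g V \<omega>'" by (simp add: cp_def)
qed

lemma cp_nonneg [simp]: "0 \<le> cp g V \<omega>"
  by (simp add: cp_def)

lemma cp_le_1: "finite V \<Longrightarrow> insert g V \<subseteq> G \<Longrightarrow> cp g V \<omega> \<le> 1"
  using m_mono[of V "insert g V" \<omega>] m_nonneg[of V \<omega>] unfolding cp_def
  by (cases "m V \<omega> = 0") (auto simp: divide_le_eq_1 less_le)

lemma AE_cp_pos:
  assumes "finite V" "insert g V \<subseteq> G"
  shows "AE \<omega> in \<mu>. 0 < cp g V \<omega>"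
proof -
  have "AE \<omega> in \<mu>. 0 < m V \<omega>" "AE \<omega> in \<mu>. 0 < m (insert g V) \<omega>"
    by (rule AE_m_pos, use assms in auto)+
  then show ?thesis by eventually_elim (simp add: cp_def)
qed

text \<open>The sum is 1 where \<open>m V s\<close> is positive. On null cylinders it is 0, because
  division by zero makes all its terms vanish.\<close>

lemma sum_cp_le_1:
  assumes "finite V" "insert g V \<subseteq> G" "g \<notin> V"
  shows "(\<Sum>a\<in>UNIV. cp g V (s(g := a))) \<le> 1"
proof -
  have "m V (s(g := a)) = m V s" for a
    by (rule local_onD[OF local_on_m]) (use assms in auto)
  then have "(\<Sum>a\<in>UNIV. cp g V (s(g := a))) = m V s / m V s"
    using sum_m_insert[OF assms, of s] by (simp add: cp_def flip: sum_divide_distrib)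
  then show ?thesis by (simp add: divide_self_if)
qed

lemma h_eq:
  assumes "finite V" "insert g V \<subseteq> G"
  shows "h g V = H (insert g V) - H V"
proof -
  have l: "local_on (insert g V) (\<lambda>\<omega>. - log 2 (cp g V \<omega>))"
    "local_on (insert g V) (\<lambda>\<omega>. - log 2 (m (insert g V) \<omega>))" "local_on V (\<lambda>\<omega>. - log 2 (m V \<omega>))"
    using local_on_cp[of g V] local_on_m[of V] local_on_m[of "insert g V"]
    unfolding local_on_def by metis+
  have int: "integrable \<mu> (\<lambda>\<omega>. - log 2 (m (insert g V) \<omega>))" "integrable \<mu> (\<lambda>\<omega>. - log 2 (m V \<omega>))"
    using integrable_local[OF _ _ l(2)] integrable_local[OF _ _ l(3)] assms by auto
  have "AE \<omega> in \<mu>. 0 < m V \<omega>" "AE \<omega> in \<mu>. 0 < m (insert g V) \<omega>"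
    by (rule AE_m_pos, use assms in auto)+
  then have "AE \<omega> in \<mu>. - log 2 (cp g V \<omega>) = - log 2 (m (insert g V) \<omega>) - - log 2 (m V \<omega>)"
    by eventually_elim (simp add: cp_def log_divide)
  then have "h g V = (\<integral>\<omega>. - log 2 (m (insert g V) \<omega>) - - log 2 (m V \<omega>) \<partial>\<mu>)"
    unfolding h_def using integrable_local[OF _ _ l(1)] assms int
    by (intro integral_cong_AE borel_measurable_integrable) (auto intro!: borel_measurable_diff borel_measurable_integrable simp del: minus_diff_eq)
  also have "\<dots> = H (insert g V) - H V" unfolding H_def by (rule Bochner_Integration.integral_diff[OF int])
  finally show ?thesis .
qed

lemma H_empty [simp]: "H {} = 0"
  by (simp add: H_def)

lemma h_nonneg:
  assumes "finite V" "insert g V \<subseteq> G"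
  shows "0 \<le> h g V"
proof -
  have "AE \<omega> in \<mu>. 0 \<le> - log 2 (cp g V \<omega>)"
    using AE_cp_pos[OF assms] by eventually_elim (use cp_le_1[OF assms] in simp)
  then show ?thesis unfolding h_def by (rule integral_nonneg_AE)
qed

lemma h_shift:
  assumes t: "t \<in> G" and V: "finite V" "insert g V \<subseteq> G"
  shows "h (g + t) ((\<lambda>v. v + t) ` V) = h g V"
proof -
  have H: "H ((\<lambda>v. v + t) ` V) = H V" if V: "finite V" "V \<subseteq> G" for V
  proof -
    have "H V = (\<integral>\<omega>. - log 2 (m V \<omega>) \<partial>distr \<mu> \<mu> (shift G t))"
      by (simp add: H_def distr_shift[OF t])
    also have "\<dots> = (\<integral>\<omega>. - log 2 (m V (shift G t \<omega>)) \<partial>\<mu>)"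
    proof (rule integral_distr[OF measurable_shift[OF t]])
      have "local_on V (\<lambda>\<omega>. - log 2 (m V \<omega>))"
        using local_on_m[of V] unfolding local_on_def by metis
      then show "(\<lambda>\<omega>. - log 2 (m V \<omega>)) \<in> borel_measurable \<mu>"
        using integrable_local[OF V] by blast
    qed
    also have "\<dots> = H ((\<lambda>v. v + t) ` V)" by (simp add: H_def m_shift_config[OF t V])
    finally show ?thesis by simp
  qed
  have "insert (g + t) ((\<lambda>v. v + t) ` V) \<subseteq> G" using V t G_add by auto
  then have "h (g + t) ((\<lambda>v. v + t) ` V) = H ((\<lambda>v. v + t) ` insert g V) - H ((\<lambda>v. v + t) ` V)"
    using V by (subst h_eq) auto
  then show ?thesis using V H[of "insert g V"] H[of V] by (simp add: h_eq)
qed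

text \<open>The mean of \<open>- ln r\<close> is \<open>ln 2\<close> times the entropy drop from
  \<open>V\<close> to \<open>W\<close>, a relative entropy. The mean of \<open>r\<close> is at most
  1: \<open>r\<close> times the probability given \<open>W\<close> is the probability given
  \<open>V\<close>, whose sum over symbols is at most 1. Adding \<open>r - 1\<close> makes the
  integrand nonnegative without increasing the integral.\<close>

lemma cp_ratio:
  assumes V: "finite W" "V \<subseteq> W" "insert g W \<subseteq> G" "g \<notin> W"
  defines "r \<equiv> \<lambda>\<omega>. cp g V \<omega> / cp g W \<omega>"
  shows "local_on (insert g W) (\<lambda>\<omega>. r \<omega> - 1 - ln (r \<omega>))"
    and "integral\<^sup>L \<mu> (\<lambda>\<omega>. r \<omega> - 1 - ln (r \<omega>)) \<le> ln 2 * (h g V - h g W)"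
proof -
  have finV: "finite V" "insert g V \<subseteq> G" "g \<notin> V" using V finite_subset by auto
  have lV: "local_on (insert g W) (cp g V)" by (rule local_on_mono[OF local_on_cp]) (use V in auto)
  have lr: "local_on (insert g W) r" unfolding r_def
    using lV local_on_cp[of g W] unfolding local_on_def by metis
  then show l: "local_on (insert g W) (\<lambda>\<omega>. r \<omega> - 1 - ln (r \<omega>))"
    unfolding local_on_def by metis
  have l2: "local_on (insert g W) (\<lambda>\<omega>. - log 2 (cp g V \<omega>))" "local_on (insert g W) (\<lambda>\<omega>. - log 2 (cp g W \<omega>))"
    using lV local_on_cp[of g W] unfolding local_on_def by metis+
  have finW: "finite (insert g W)" using V by simp
  note int = integrable_local[OF finW V(3)]
  have "(\<integral>\<omega>. r \<omega> \<partial>\<mu>) = (\<Sum>s\<in>pat (insert g W). m (insert g W) s * r s)"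
    by (rule integral_local[OF finW V(3) lr])
  \<comment> \<open>Equality holds at patterns of positive probability. At null patterns the left
    side is 0.\<close>
  also have "\<dots> \<le> (\<Sum>s\<in>pat (insert g W). m W s * cp g V s)"
    by (rule sum_mono) (auto simp: r_def cp_def mult.commute)
  also have "\<dots> = (\<Sum>s\<in>pat W. \<Sum>a\<in>UNIV. m W (s(g := a)) * cp g V (s(g := a)))"
    by (rule sum_pat_insert[OF V(1,4)])
  also have "\<dots> = (\<Sum>s\<in>pat W. m W s * (\<Sum>a\<in>UNIV. cp g V (s(g := a))))"
  proof (rule sum.cong[OF refl])
    fix s
    have "m W (s(g := a)) = m W s" for a by (rule local_onD[OF local_on_m]) (use V in auto)
    then show "(\<Sum>a\<in>UNIV. m W (s(g := a)) * cp g V (s(g := a))) = m W s * (\<Sum>a\<in>UNIV. cp g V (s(g := a)))"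
      by (simp add: sum_distrib_left)
  qed
  also have "\<dots> \<le> (\<Sum>s\<in>pat W. m W s)"
    by (intro sum_mono mult_left_le sum_cp_le_1[OF finV]) simp
  also have "\<dots> = 1" using V by (intro sum_m) auto
  finally have Er: "(\<integral>\<omega>. r \<omega> \<partial>\<mu>) \<le> 1" .
  have "AE \<omega> in \<mu>. 0 < cp g V \<omega>" "AE \<omega> in \<mu>. 0 < cp g W \<omega>"
    by (rule AE_cp_pos, use finV V in auto)+
  then have ae: "AE \<omega> in \<mu>. r \<omega> - 1 - ln (r \<omega>) = r \<omega> - 1 + (ln 2 * (- log 2 (cp g V \<omega>)) - ln 2 * (- log 2 (cp g W \<omega>)))"
    by eventually_elim (simp add: r_def ln_div log_def)
  have "integrable \<mu> (\<lambda>\<omega>. r \<omega> - 1 + (ln 2 * (- log 2 (cp g V \<omega>)) - ln 2 * (- log 2 (cp g W \<omega>))))"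
    using int[OF lr] int[OF l2(1)] int[OF l2(2)]
    by (intro Bochner_Integration.integrable_add Bochner_Integration.integrable_diff integrable_mult_right) auto
  then have "(\<integral>\<omega>. r \<omega> - 1 - ln (r \<omega>) \<partial>\<mu>)
      = (\<integral>\<omega>. r \<omega> - 1 + (ln 2 * (- log 2 (cp g V \<omega>)) - ln 2 * (- log 2 (cp g W \<omega>))) \<partial>\<mu>)"
    by (rule integral_cong_AE[OF borel_measurable_integrable[OF int[OF l]] borel_measurable_integrable ae])
  also have "\<dots> = (\<integral>\<omega>. r \<omega> \<partial>\<mu>) - 1 + (ln 2 * h g V - ln 2 * h g W)"
    using int[OF lr] int[OF l2(1)] int[OF l2(2)]
    by (simp add: h_def)
  also have "\<dots> \<le> ln 2 * (h g V - h g W)" using Er by (simp add: algebra_simps)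
  finally show "(\<integral>\<omega>. r \<omega> - 1 - ln (r \<omega>) \<partial>\<mu>) \<le> ln 2 * (h g V - h g W)" .
qed

section \<open>The entropy rate\<close>

definition past :: "int ^ 'd \<Rightarrow> (int ^ 'd) set \<Rightarrow> bool" where
  "past g V \<longleftrightarrow> finite V \<and> insert g V \<subseteq> G \<and> (\<forall>v\<in>V. lexless v g)"

text \<open>The site varies together with its past because in the orthant a pair cannot always be
  translated to one with \<open>g = 0\<close>: its past would leave \<open>G\<close>.\<close>

definition entropy_rate :: real where
  "entropy_rate = Inf {h g V | g V. past g V}"

lemma past_notin: "past g V \<Longrightarrow> g \<notin> V"
  unfolding past_def by auto

lemma past_empty [simp]: "past 0 {}"
  by (simp add: past_def)

lemma entropy_rate_le: "past g V \<Longrightarrow> entropy_rate \<le> h g V"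
  unfolding entropy_rate_def
  by (rule cInf_lower) (auto simp: past_def intro!: h_nonneg bdd_belowI[of _ 0])

lemma entropy_rate_nonneg: "0 \<le> entropy_rate"
  unfolding entropy_rate_def
proof (rule cInf_greatest)
  show "{h g V | g V. past g V} \<noteq> {}" using past_empty by blast
qed (auto simp: past_def intro!: h_nonneg)

text \<open>Gibbs' inequality: \<open>ln x \<le> x - 1\<close> makes the integrand in
  \<open>cp_ratio\<close> nonnegative.\<close>

lemma h_mono:
  assumes "finite W" "V \<subseteq> W" "insert g W \<subseteq> G" "g \<notin> W"
  shows "h g W \<le> h g V"
proof -
  let ?r = "\<lambda>\<omega>. cp g V \<omega> / cp g W \<omega>"
  have fin: "finite V" "insert g V \<subseteq> G" using assms finite_subset by auto
  have "AE \<omega> in \<mu>. 0 < cp g V \<omega>" "AE \<omega> in \<mu>. 0 < cp g W \<omega>"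
    by (rule AE_cp_pos, use fin assms in auto)+
  then have "AE \<omega> in \<mu>. 0 \<le> ?r \<omega> - 1 - ln (?r \<omega>)"
  proof eventually_elim
    case (elim \<omega>)
    then have "0 < ?r \<omega>" by simp
    then show ?case using ln_le_minus_one[of "?r \<omega>"] by linarith
  qed
  then have "0 \<le> (\<integral>\<omega>. ?r \<omega> - 1 - ln (?r \<omega>) \<partial>\<mu>)" by (rule integral_nonneg_AE)
  also have "\<dots> \<le> ln 2 * (h g V - h g W)" by (rule cp_ratio(2)[OF assms])
  finally show ?thesis by (simp add: zero_le_mult_iff)
qed

lemma past_shift: "past g V \<Longrightarrow> t \<in> G \<Longrightarrow> past (g + t) ((\<lambda>v. v + t) ` V)"
  unfolding past_def using G_add by auto

lemma h_past_shift: "past g V \<Longrightarrow> t \<in> G \<Longrightarrow> h (g + t) ((\<lambda>v. v + t) ` V) = h g V"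
  by (rule h_shift) (auto simp: past_def)

text \<open>In the full lattice a constant vector is added to make all coordinates nonnegative,
  which leaves \<open>h\<close> unchanged. Nonnegative windows are what
  \<open>computable_site\<close>, \<open>string_weight_kraft\<close> and
  \<open>Lam_add_nonneg\<close> work with.\<close>

lemma near_optimal_past:
  assumes "0 < \<epsilon>"
  obtains u A where "past u A" "\<And>v i. v \<in> insert u A \<Longrightarrow> 0 \<le> v $ i" "h u A < entropy_rate + \<epsilon>"
proof -
  have "\<exists>x\<in>{h g V | g V. past g V}. x < entropy_rate + \<epsilon>"
  proof (rule cInf_lessD)
    show "{h g V | g V. past g V} \<noteq> {}" using past_empty by blast
    show "Inf {h g V | g V. past g V} < entropy_rate + \<epsilon>" using assms by (simp add: entropy_rate_def)
  qed
  then obtain g V where gV: "past g V" "h g V < entropy_rate + \<epsilon>" by blast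
  show ?thesis
  proof (cases "G = UNIV")
    case False
    then have "0 \<le> v $ i" if "v \<in> insert g V" for v i
      using gV(1) index that by (auto simp: past_def)
    then show ?thesis using that gV by blast
  next
    case True
    let ?Z = "(\<lambda>(v, i). \<bar>v $ i\<bar>) ` (insert g V \<times> UNIV)"
    have finZ: "finite ?Z" using gV(1) by (auto simp: past_def)
    define M where "M = Max ?Z"
    define t :: "int ^ 'd" where "t = (\<chi> i. M)"
    have t: "0 \<le> (v + t) $ i" if "v \<in> insert g V" for v i
    proof -
      have "\<bar>v $ i\<bar> \<le> M" unfolding M_def using finZ that by (intro Max_ge) auto
      then show ?thesis by (simp add: t_def)
    qed
    have "t \<in> G" using True by simp
    show ?thesis
    proof (rule that)
      show "past (g + t) ((\<lambda>v. v + t) ` V)" by (rule past_shift[OF gV(1) \<open>t \<in> G\<close>])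
      show "h (g + t) ((\<lambda>v. v + t) ` V) < entropy_rate + \<epsilon>"
        using gV(2) h_past_shift[OF gV(1) \<open>t \<in> G\<close>] by simp
    qed (use t in auto)
  qed
qed

lemma H_chain:
  assumes "finite F" "F \<subseteq> G"
  shows "H F = (\<Sum>g\<in>F. h g {v \<in> F. lexless v g})"
  using assms
proof (induction F rule: finite_lex_induct)
  case (insert g F)
  have e1: "{v \<in> insert g F. lexless v g} = F" using insert.hyps by auto
  have e2: "{v \<in> insert g F. lexless v k} = {v \<in> F. lexless v k}" if "k \<in> F" for k
    using insert.hyps that lexless_asym by auto
  have "h g F = H (insert g F) - H F" by (rule h_eq) (use insert in auto)
  then have "H (insert g F) = h g F + H F" by simp
  also have "H F = (\<Sum>k\<in>F. h k {v \<in> F. lexless v k})" using insert by simp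
  also have "\<dots> = (\<Sum>k\<in>F. h k {v \<in> insert g F. lexless v k})"
    by (rule sum.cong) (use e2 in auto)
  finally show ?case using insert.hyps(1,2) by (simp only: sum.insert e1 not_False_eq_True)
qed simp

lemma past_below: "finite F \<Longrightarrow> F \<subseteq> G \<Longrightarrow> g \<in> F \<Longrightarrow> past g {v \<in> F. lexless v g}"
  by (auto simp: past_def)

lemma H_ge: "finite F \<Longrightarrow> F \<subseteq> G \<Longrightarrow> real (card F) * entropy_rate \<le> H F"
  unfolding H_chain by (rule sum_bounded_below) (use past_below entropy_rate_le in blast)

text \<open>In the chain rule for \<open>F\<close>, the past of a good site contains a translate of
  \<open>A\<close>, so the site is charged at most \<open>h u A\<close>. Each site of
  \<open>B\<close> is charged the entropy of a single symbol.\<close>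

lemma H_le:
  assumes F: "finite F" "F \<subseteq> G" and uA: "past u A" and B: "B \<subseteq> F"
    and good: "\<And>g. g \<in> F - B \<Longrightarrow> \<exists>c\<in>G. g = u + c \<and> (\<lambda>v. v + c) ` A \<subseteq> F"
  shows "H F \<le> real (card F) * h u A + real (card B) * h 0 {}"
proof -
  have 0: "0 \<le> h u A" "0 \<le> h 0 {}" using uA by (auto simp: past_def intro!: h_nonneg)
  have "H F = (\<Sum>g\<in>B. h g {v \<in> F. lexless v g}) + (\<Sum>g\<in>F - B. h g {v \<in> F. lexless v g})"
    unfolding H_chain[OF F] using sum.subset_diff[OF B F(1)] by (simp add: add.commute)
  also have "(\<Sum>g\<in>F - B. h g {v \<in> F. lexless v g}) \<le> real (card (F - B)) * h u A"
  proof (rule sum_bounded_above)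
    fix g assume g: "g \<in> F - B"
    then obtain c where c: "c \<in> G" "g = u + c" "(\<lambda>v. v + c) ` A \<subseteq> F" using good by blast
    have "h g {v \<in> F. lexless v g} \<le> h g ((\<lambda>v. v + c) ` A)"
      by (rule h_mono) (use F g c uA in \<open>auto simp: past_def\<close>)
    also have "\<dots> = h u A" unfolding c(2) by (rule h_past_shift[OF uA c(1)])
    finally show "h g {v \<in> F. lexless v g} \<le> h u A" .
  qed
  also have "\<dots> \<le> real (card F) * h u A"
    using F 0 by (intro mult_right_mono) (auto intro: card_mono)
  also have "(\<Sum>g\<in>B. h g {v \<in> F. lexless v g}) \<le> real (card B) * h 0 {}"
  proof (rule sum_bounded_above)
    fix g assume g: "g \<in> B"
    then have gG: "g \<in> G" using B F by blast
    have "h g {v \<in> F. lexless v g} \<le> h g {}"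
      by (rule h_mono) (use F g B in auto)
    also have "\<dots> = h 0 {}" using h_past_shift[OF past_empty gG] by simp
    finally show "h g {v \<in> F. lexless v g} \<le> h 0 {}" .
  qed
  finally show ?thesis by simp
qed

lemma past_bound:
  assumes "past u A" "\<And>v i. v \<in> insert u A \<Longrightarrow> 0 \<le> v $ i"
  obtains M where "\<And>v i. v \<in> insert u A \<Longrightarrow> 0 \<le> v $ i \<and> v $ i \<le> int M"
proof -
  let ?Z = "(\<lambda>(v, i). nat (v $ i)) ` (insert u A \<times> UNIV)"
  have "finite ?Z" using assms(1) by (auto simp: past_def)
  then have "nat (v $ i) \<le> Max ?Z" if "v \<in> insert u A" for v i
    using that by (intro Max_ge) auto
  then have "v $ i \<le> int (Max ?Z)" if "v \<in> insert u A" for v i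
    using that by (simp add: nat_le_iff[symmetric])
  then show ?thesis using assms(2) by (intro that) blast
qed

lemma H_Lam_le:
  assumes uA: "past u A" and M: "\<And>v i. v \<in> insert u A \<Longrightarrow> 0 \<le> v $ i \<and> v $ i \<le> int M"
  shows "H (Lam G n) \<le> real (card (Lam G n)) * h u A
    + (real (card (Lam G n)) - real (card (Lam G (n - M)))) * h 0 {}"
proof -
  let ?C = "(\<lambda>c. u + c) ` Lam G (n - M)"
  have add: "v + c \<in> Lam G n" if "c \<in> Lam G (n - M)" "v \<in> insert u A" for c v
    using Lam_add_nonneg[OF index M[OF that(2)] that(1)] by (simp add: add.commute)
  have C: "?C \<subseteq> Lam G n" using add by auto
  have "card ?C = card (Lam G (n - M))" by (rule card_image) simp
  then have card: "real (card (Lam G n - ?C)) = real (card (Lam G n)) - real (card (Lam G (n - M)))"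
    using C card_mono[OF finite_Lam[OF index] C] finite_Lam[OF index]
    by (simp add: card_Diff_subset finite_subset of_nat_diff)
  show ?thesis unfolding card[symmetric]
  proof (rule H_le[OF finite_Lam[OF index] Lam_subset uA Diff_subset])
    fix g assume "g \<in> Lam G n - (Lam G n - ?C)"
    then obtain c where c: "c \<in> Lam G (n - M)" "g = u + c" by blast
    then show "\<exists>c\<in>G. g = u + c \<and> (\<lambda>v. v + c) ` A \<subseteq> Lam G n"
      using add subsetD[OF Lam_subset c(1)] by (intro bexI[of _ c]) auto
  qed
qed

text \<open>The enlargement by \<open>k\<close> makes room for the windows from which the cells of a
  general partition are guessed later. The lower estimate is \<open>H_ge\<close>; the upper one is
  \<open>H_Lam_le\<close> for a nearly optimal past.\<close>

lemma H_Lam_limit: "(\<lambda>n. H (Lam G (n + k)) / real (card (Lam G n))) \<longlonglongrightarrow> entropy_rate"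
proof -
  let ?c = "\<lambda>n. real (card (Lam G n))"
  have pos: "0 < ?c n" if "0 < n" for n using card_Lam_ge1[OF index, of n] that by simp
  show ?thesis
  proof (rule order_tendstoI)
    fix a assume a: "a < entropy_rate"
    show "\<forall>\<^sub>F n in sequentially. a < H (Lam G (n + k)) / ?c n"
      using eventually_gt_at_top[of 0]
    proof eventually_elim
      case (elim n)
      have "?c n * entropy_rate \<le> ?c (n + k) * entropy_rate"
        using entropy_rate_nonneg finite_Lam[OF index] by (intro mult_right_mono) (auto intro!: card_mono Lam_mono)
      also have "\<dots> \<le> H (Lam G (n + k))" by (rule H_ge[OF finite_Lam[OF index] Lam_subset])
      finally have "entropy_rate \<le> H (Lam G (n + k)) / ?c n" using pos[OF elim] by (simp add: field_simps)
      then show ?case using a by simp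
    qed
  next
    fix a assume a: "entropy_rate < a"
    then have "0 < a - entropy_rate" by simp
    then obtain u A where uA: "past u A" "\<And>v i. v \<in> insert u A \<Longrightarrow> 0 \<le> v $ i"
        "h u A < entropy_rate + (a - entropy_rate)"
      by (rule near_optimal_past) blast
    obtain M where M: "\<And>v i. v \<in> insert u A \<Longrightarrow> 0 \<le> v $ i \<and> v $ i \<le> int M"
      using past_bound[OF uA(1,2)] by blast
    \<comment> \<open>The boundary term is written with two quotients so that each of them is a
      limit from \<open>card_Lam_ratio\<close>.\<close>
    let ?B = "\<lambda>n. ?c (n + k) / ?c n * h u A + (?c (n + k) / ?c n
        - ?c (n + k) / ?c n * (?c ((n + k) - M) / ?c (n + k))) * h 0 {}"
    have "?B \<longlonglongrightarrow> 1 * h u A + (1 - 1 * 1) * h 0 {}"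
      by (intro tendsto_intros card_Lam_ratio[OF index]
          LIMSEQ_ignore_initial_segment[OF card_Lam_ratio(2)[OF index]])
    then have "\<forall>\<^sub>F n in sequentially. ?B n < a"
      using uA(3) by (intro order_tendstoD(2)[of ?B]) auto
    then show "\<forall>\<^sub>F n in sequentially. H (Lam G (n + k)) / ?c n < a"
      using eventually_gt_at_top[of 0]
    proof eventually_elim
      case (elim n)
      have "H (Lam G (n + k)) / ?c n \<le> (?c (n + k) * h u A + (?c (n + k) - ?c ((n + k) - M)) * h 0 {}) / ?c n"
        by (intro divide_right_mono H_Lam_le[OF uA(1) M]) simp_all
      also have "\<dots> = ?B n"
        using pos[of n] pos[of "n + k"] elim by (simp add: field_simps)
      finally show ?case using elim by simp
    qed
  qed
qed

end

section \<open>The upper bound\<close>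

locale complexity_setting = shift_measure G S \<mu>
  for G :: "(int ^ 'd) set" and S :: "(int ^ 'd \<Rightarrow> 'a::finite) set" and \<mu> +
  fixes num :: "'a \<Rightarrow> nat" and N :: nat and \<phi> :: "bool list \<Rightarrow> 'a list option" and f :: "int ^ 'd \<Rightarrow> nat"
  assumes num: "bij_betw num UNIV {0..N}" and opt: "additively_optimal num \<phi>"
    and enum: "admissible_enum G f" and erg: "\<mu> \<in> ergodic_measures G S"
begin

lemma bij_f: "bij_betw f G UNIV" and inj_f: "inj_on f G"
  and f_Lam: "0 < n \<Longrightarrow> f ` Lam G n = {..<card (Lam G n)}"
  using enum by (auto simp: admissible_enum_def bij_betw_def Suc_le_eq)

lemma countable_G: "countable G"
  using inj_f by (rule countableI)

lemma ergodic_average: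
  assumes "integrable \<mu> F"
  shows "AE \<omega> in \<mu>. (\<lambda>n. (\<Sum>g\<in>Lam G n. F (shift G g \<omega>)) / real (card (Lam G n)))
            \<longlonglongrightarrow> integral\<^sup>L \<mu> F"
  using erg assms by (simp add: ergodic_measures_def)

definition string :: "nat \<Rightarrow> (int ^ 'd \<Rightarrow> 'a) \<Rightarrow> 'a list" where
  "string n \<omega> = pattern_string G f n (restrict \<omega> (Lam G n))"

lemma length_string [simp]: "length (string n \<omega>) = card (Lam G n)"
  by (simp add: string_def pattern_string_def)

lemma nth_string:
  assumes "0 < n" "g \<in> Lam G n"
  shows "string n \<omega> ! f g = \<omega> g"
proof -
  have "f g < card (Lam G n)" using f_Lam[OF assms(1)] assms(2) by blast
  moreover have "inv_into G f (f g) = g"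
    by (rule inv_into_f_f[OF inj_f]) (use assms Lam_subset in blast)
  ultimately show ?thesis using assms by (simp add: string_def pattern_string_def)
qed

lemma f_less_iff: "0 < n \<Longrightarrow> g \<in> G \<Longrightarrow> f g < card (Lam G n) \<longleftrightarrow> g \<in> Lam G n"
  using f_Lam[of n] inj_on_image_mem_iff[OF inj_f _ Lam_subset, of g n] by simp

lemma string_weight_string:
  assumes n: "0 < n" and vs: "\<And>v. v \<in> set vs \<Longrightarrow> v \<in> G"
  shows "string_weight (site G f) vs tab (string n \<omega>)
    = (\<Prod>c\<in>Lam G n. if \<forall>v\<in>set vs. c + v \<in> Lam G n then tab (map (\<lambda>v. \<omega> (c + v)) vs) else 1)"
proof -
  have bij: "bij_betw f (Lam G n) {..<card (Lam G n)}"
    using f_Lam[OF n] inj_on_subset[OF inj_f Lam_subset] by (simp add: bij_betw_def)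
  have "string_weight (site G f) vs tab (string n \<omega>) = (\<Prod>c\<in>Lam G n.
      if \<forall>v\<in>set vs. site G f v (f c) < card (Lam G n)
      then tab (map (\<lambda>v. string n \<omega> ! site G f v (f c)) vs) else 1)"
    unfolding string_weight_def length_string by (rule prod.reindex_bij_betw[OF bij, symmetric])
  also have "\<dots> = (\<Prod>c\<in>Lam G n. if \<forall>v\<in>set vs. c + v \<in> Lam G n then tab (map (\<lambda>v. \<omega> (c + v)) vs) else 1)"
  proof (rule prod.cong[OF refl])
    fix c assume c: "c \<in> Lam G n"
    then have cG: "c \<in> G" using Lam_subset by blast
    have site: "site G f v (f c) = f (c + v)" for v
      using cG by (simp add: site_def inv_into_f_f[OF inj_f])
    show "(if \<forall>v\<in>set vs. site G f v (f c) < card (Lam G n)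
      then tab (map (\<lambda>v. string n \<omega> ! site G f v (f c)) vs) else 1)
      = (if \<forall>v\<in>set vs. c + v \<in> Lam G n then tab (map (\<lambda>v. \<omega> (c + v)) vs) else 1)"
    proof (rule if_cong)
      show "(\<forall>v\<in>set vs. site G f v (f c) < card (Lam G n)) = (\<forall>v\<in>set vs. c + v \<in> Lam G n)"
        using vs G_add[OF cG] f_less_iff[OF n] by (auto simp: site)
      assume "\<forall>v\<in>set vs. c + v \<in> Lam G n"
      then have "map (\<lambda>v. string n \<omega> ! site G f v (f c)) vs = map (\<lambda>v. \<omega> (c + v)) vs"
        by (intro map_cong) (auto simp: site nth_string[OF n])
      then show "tab (map (\<lambda>v. string n \<omega> ! site G f v (f c)) vs) = tab (map (\<lambda>v. \<omega> (c + v)) vs)"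
        by (rule arg_cong[of _ _ tab])
    qed simp
  qed
  finally show ?thesis .
qed

text \<open>The junk value of \<open>the_enat \<infinity>\<close> does not matter, by \<open>AE_K_finite\<close> below.\<close>

definition K :: "nat \<Rightarrow> (int ^ 'd \<Rightarrow> 'a) \<Rightarrow> real" where
  "K n \<omega> = real (the_enat (kolm \<phi> (string n \<omega>)))"

text \<open>The entry is the integer part of \<open>M * cp\<close> plus 1. The added 1 makes it
  positive and at least \<open>M * cp\<close>, and raises the sum over the predicted symbol to at
  most \<open>M + CARD('a)\<close>. Divided by this number the table is a rational approximation
  that undercuts \<open>cp\<close> by at most the factor \<open>M / (M + CARD('a))\<close>.\<close>

lemma context_table:
  assumes uA: "past u (set vs)" "distinct vs" and M: "0 < (M::nat)"
  obtains tab :: "'a list \<Rightarrow> nat" where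
    "\<And>c. (\<Sum>a\<in>UNIV. tab (a # c)) \<le> M + CARD('a)"
    "\<And>s. real M * cp u (set vs) s \<le> real (tab (map s (u # vs)))"
    "\<And>c. 0 < tab c"
proof -
  define cfg :: "'a list \<Rightarrow> int ^ 'd \<Rightarrow> 'a" where "cfg l g = the (map_of (zip (u # vs) l) g)" for l g
  define tab where "tab l = (if length l = length (u # vs) then nat \<lfloor>real M * cp u (set vs) (cfg l)\<rfloor> + 1 else 1)"
    for l
  have u: "u \<notin> set vs" using past_notin[OF uA(1)] .
  have fin: "insert u (set vs) \<subseteq> G" using uA(1) by (simp add: past_def)
  have bound: "real (nat \<lfloor>real M * cp u (set vs) s\<rfloor> + 1) \<le> real M * cp u (set vs) s + 1" for s by simp
  show ?thesis
  proof (rule that[of tab])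
    fix c :: "'a list"
    show "(\<Sum>a\<in>UNIV. tab (a # c)) \<le> M + CARD('a)"
    proof (cases "length c = length vs")
      case True
      \<comment> \<open>Changing the first list entry changes the configuration at \<open>u\<close>
        only, since \<open>u\<close> is the first key. \<open>undefined\<close> is a placeholder
        that is overwritten.\<close>
      have c1: "cfg (a # c) = (cfg (undefined # c))(u := a)" for a by (auto simp: cfg_def fun_eq_iff)
      have "tab (a # c) = nat \<lfloor>real M * cp u (set vs) (cfg (a # c))\<rfloor> + 1" for a
        unfolding tab_def using True by simp
      then have "real (tab (a # c)) \<le> real M * cp u (set vs) ((cfg (undefined # c))(u := a)) + 1" for a
        using bound[of "cfg (a # c)"] unfolding c1[of a, symmetric] by metis
      then have "real (\<Sum>a\<in>UNIV. tab (a # c))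
          \<le> (\<Sum>a\<in>UNIV. real M * cp u (set vs) ((cfg (undefined # c))(u := a)) + 1)"
        unfolding of_nat_sum by (intro sum_mono)
      also have "\<dots> = real M * (\<Sum>a\<in>UNIV. cp u (set vs) ((cfg (undefined # c))(u := a))) + real CARD('a)"
        by (simp add: sum.distrib sum_distrib_left)
      also have "\<dots> \<le> real M + real CARD('a)"
        using sum_cp_le_1[OF _ fin u] by (intro add_right_mono mult_left_le) simp_all
      finally show ?thesis by (simp only: of_nat_le_iff of_nat_add[symmetric])
    next
      case False
      then show ?thesis by (simp add: tab_def)
    qed
  next
    fix s :: "int ^ 'd \<Rightarrow> 'a"
    have "cp u (set vs) (cfg (map s (u # vs))) = cp u (set vs) s"
      by (rule local_onD[OF local_on_cp]) (auto simp: cfg_def map_of_zip_map)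
    then show "real M * cp u (set vs) s \<le> real (tab (map s (u # vs)))"
      by (simp add: tab_def) linarith
  qed (simp add: tab_def)
qed

text \<open>The terms after the ergodic sum are the price of the code: \<open>log 2 (D / M)\<close>
  per site for rounding the probabilities, \<open>log 2 D\<close> for each site near the boundary
  whose window leaves the box, a logarithm for encoding the length, and the constant of the optimal
  machine, which depends on neither \<open>n\<close> nor \<omega>.\<close>

lemma kolm_string_le:
  assumes uA: "past u A" and nn: "\<And>v i. v \<in> insert u A \<Longrightarrow> 0 \<le> v $ i \<and> v $ i \<le> int b" and M: "0 < (M::nat)"
  defines "D \<equiv> real (M + CARD('a))"
  shows "\<exists>C::real. \<forall>n>0. \<forall>\<omega>. (\<forall>g\<in>G. 0 < cp u A (shift G g \<omega>)) \<longrightarrow>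
     kolm \<phi> (string n \<omega>) \<noteq> \<infinity> \<and>
     K n \<omega> \<le> (\<Sum>g\<in>Lam G n. - log 2 (cp u A (shift G g \<omega>))) + real (card (Lam G n)) * log 2 (D / real M)
       + (real (card (Lam G n)) - real (card (Lam G (n - b)))) * log 2 D
       + log 2 (real (card (Lam G n) + 1) * real (card (Lam G n) + 2)) + C"
proof -
  obtain vs where vs: "set vs = A" "distinct vs"
    using finite_distinct_list[of A] uA by (auto simp: past_def)
  obtain tab :: "'a list \<Rightarrow> nat" where tab: "\<And>c. (\<Sum>a\<in>UNIV. tab (a # c)) \<le> M + CARD('a)"
    "\<And>s. real M * cp u A s \<le> real (tab (map s (u # vs)))" "\<And>c. 0 < tab c"
    using context_table[of u vs M] uA vs M by metis
  have G: "v \<in> G" if "v \<in> set (u # vs)" for v using uA that vs by (auto simp: past_def)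
  have comp: "computable1 (site G f v)" if "v \<in> set (u # vs)" for v
  proof (rule computable_site[OF index bij_f])
    show "computable_index G f" using enum by (simp add: admissible_enum_def)
    have "v \<in> insert u A" using that vs by simp
    then show "\<forall>i. 0 \<le> v $ i" using nn by blast
  qed
  have "\<exists>C::real. \<forall>x. ereal_of_enat (kolm \<phi> x) \<le> ereal (log 2 (real (M + CARD('a)) ^ length x
      * (real (length x + 1) * real (length x + 2)) / real (string_weight (site G f) (u # vs) tab x)) + C)"
  proof (rule weighted_coding[OF num opt comp])
    show "(\<Sum>x\<in>{x. length x = l}. real (string_weight (site G f) (u # vs) tab x)) \<le> real (M + CARD('a)) ^ l" for l
      by (rule string_weight_kraft[OF index bij_f])
         (use nn vs uA tab in \<open>auto simp: past_def\<close>)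
  qed (use tab M in auto)
  then obtain C where C: "\<And>x. ereal_of_enat (kolm \<phi> x) \<le> ereal (log 2 (D ^ length x
      * (real (length x + 1) * real (length x + 2)) / real (string_weight (site G f) (u # vs) tab x)) + C)"
    unfolding D_def by blast
  have D1: "1 \<le> D" "0 < D" using M by (simp_all add: D_def)
  show ?thesis
  proof (intro exI[of _ C] allI impI)
    fix n \<omega> assume n: "0 < (n::nat)" and pos: "\<forall>g\<in>G. 0 < cp u A (shift G g \<omega>)"
    let ?x = "string n \<omega>" and ?L = "Lam G n"
    let ?l = "card (Lam G n)" and ?J = "\<lambda>g. - log 2 (cp u A (shift G g \<omega>))"
    define good where "good c \<longleftrightarrow> (\<forall>v\<in>set (u # vs). c + v \<in> ?L)" for c
    define w where "w c = (if good c then real (tab (map (\<lambda>v. \<omega> (c + v)) (u # vs))) else 1)" for c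
    have W: "real (string_weight (site G f) (u # vs) tab ?x) = (\<Prod>c\<in>?L. w c)"
      by (subst string_weight_string[OF n G])
         (simp_all only: w_def[abs_def] good_def of_nat_prod if_distrib[of real] of_nat_1)
    have wpos: "0 < w c" for c using tab(3) by (simp add: w_def)
    have J: "0 \<le> ?J c" if "c \<in> G" for c
      using pos[rule_format, OF that] cp_le_1[of A u "shift G c \<omega>"] uA by (simp add: past_def)
    \<comment> \<open>A good site pays its ideal cost and the rounding loss. A bad site has factor 1
      and pays \<open>log 2 D\<close>; the first two terms are nonnegative and may stay.\<close>
    have fac: "log 2 (D / w c) \<le> ?J c + log 2 (D / real M) + (if good c then 0 else log 2 D)"
      if c: "c \<in> ?L" for c
    proof -
      have cG: "c \<in> G" using c Lam_subset by blast
      show ?thesis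
      proof (cases "good c")
        case True
        let ?p = "cp u A (shift G c \<omega>)"
        have p: "0 < ?p" using pos cG by blast
        have e: "map (\<lambda>v. \<omega> (c + v)) (u # vs) = map (shift G c \<omega>) (u # vs)"
          using G by (intro map_cong) (auto simp: shift_apply add.commute)
        have "real M * ?p \<le> w c"
          using tab(2)[of "shift G c \<omega>"] True unfolding w_def e by (simp only: if_True)
        then have "log 2 (real M * ?p) \<le> log 2 (w c)" using M p wpos by simp
        then show ?thesis using True p M D1 wpos[of c] by (simp add: log_mult log_divide)
      next
        case False
        have "1 \<le> D / real M" using M by (simp add: D_def)
        then have "0 \<le> log 2 (D / real M)" by simp
        then show ?thesis using False J[OF cG] by (simp add: w_def)
      qed
    qed
    have bad: "real (card {c \<in> ?L. \<not> good c}) \<le> real ?l - real (card (Lam G (n - b)))"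
    proof -
      have sub: "Lam G (n - b) \<subseteq> ?L" by (rule Lam_mono) simp
      have "{c \<in> ?L. \<not> good c} \<subseteq> ?L - Lam G (n - b)"
        using Lam_add_nonneg[OF index nn] vs by (auto simp: good_def)
      then have "card {c \<in> ?L. \<not> good c} \<le> card (?L - Lam G (n - b))"
        using finite_Lam[OF index] by (intro card_mono) auto
      also have "\<dots> = ?l - card (Lam G (n - b))"
        using sub finite_Lam[OF index] by (intro card_Diff_subset)
      finally show ?thesis using card_mono[OF finite_Lam[OF index] sub] by linarith
    qed
    have "log 2 (D ^ ?l / (\<Prod>c\<in>?L. w c)) = log 2 (\<Prod>c\<in>?L. D / w c)" by (simp add: prod_dividef)
    also have "\<dots> = (\<Sum>c\<in>?L. log 2 (D / w c))"
    proof -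
      have "ln (\<Prod>c\<in>?L. D / w c) = (\<Sum>c\<in>?L. ln (D / w c))"
        using less_imp_neq[OF divide_pos_pos[OF D1(2) wpos], symmetric]
        by (intro ln_prod finite_Lam[OF index])
      then show ?thesis by (simp add: log_def sum_divide_distrib)
    qed
    also have "\<dots> \<le> (\<Sum>c\<in>?L. ?J c + log 2 (D / real M) + (if good c then 0 else log 2 D))"
      by (rule sum_mono) (rule fac)
    also have "\<dots> = (\<Sum>c\<in>?L. ?J c) + real ?l * log 2 (D / real M) + real (card {c \<in> ?L. \<not> good c}) * log 2 D"
      using finite_Lam[OF index, of n]
      by (simp only: sum.distrib) (simp add: sum.If_cases Int_def)
    also have "\<dots> \<le> (\<Sum>c\<in>?L. ?J c) + real ?l * log 2 (D / real M) + (real ?l - real (card (Lam G (n - b)))) * log 2 D"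
      using D1 by (intro add_left_mono mult_right_mono bad) simp
    finally have main: "log 2 (D ^ ?l / (\<Prod>c\<in>?L. w c)) \<le> (\<Sum>c\<in>?L. ?J c) + real ?l * log 2 (D / real M)
        + (real ?l - real (card (Lam G (n - b)))) * log 2 D" .
    let ?ll = "real (?l + 1) * real (?l + 2)"
    have Wpos: "0 < (\<Prod>c\<in>?L. w c)" using wpos by (intro prod_pos) auto
    have "log 2 (D ^ ?l * ?ll / (\<Prod>c\<in>?L. w c)) = log 2 (D ^ ?l / (\<Prod>c\<in>?L. w c) * ?ll)" by simp
    also have "\<dots> = log 2 (D ^ ?l / (\<Prod>c\<in>?L. w c)) + log 2 ?ll"
      using D1 Wpos by (subst log_mult_pos) auto
    finally have split: "log 2 (D ^ ?l * ?ll / (\<Prod>c\<in>?L. w c)) = log 2 (D ^ ?l / (\<Prod>c\<in>?L. w c)) + log 2 ?ll" .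
    note CC = C[of ?x, unfolded length_string W split]
    obtain k where k: "kolm \<phi> ?x = enat k" using CC by (cases "kolm \<phi> ?x") auto
    show "kolm \<phi> (string n \<omega>) \<noteq> \<infinity> \<and> K n \<omega> \<le> (\<Sum>g\<in>?L. ?J g) + real ?l * log 2 (D / real M)
       + (real ?l - real (card (Lam G (n - b)))) * log 2 D + log 2 ?ll + C"
      using CC main by (simp add: K_def k)
  qed
qed

lemma filterlim_card_Lam: "filterlim (\<lambda>n. card (Lam G n)) at_top sequentially"
  by (rule filterlim_at_top_mono[OF filterlim_ident]) (simp add: card_Lam_ge1[OF index])

text \<open>The code for the empty past already gives every string a program, on the almost sure
  event that all symbols occurring have positive probability.\<close>

lemma AE_K_finite: "AE \<omega> in \<mu>. \<forall>n>0. kolm \<phi> (string n \<omega>) \<noteq> \<infinity>"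
proof -
  obtain C where C: "\<forall>n>0. \<forall>\<omega>. (\<forall>g\<in>G. 0 < cp 0 {} (shift G g \<omega>)) \<longrightarrow> kolm \<phi> (string n \<omega>) \<noteq> \<infinity>"
    using kolm_string_le[OF past_empty, of 0 1] by auto
  have "AE \<omega> in \<mu>. \<forall>g\<in>G. 0 < cp 0 {} (shift G g \<omega>)"
    by (rule AE_ball_countable'[OF _ countable_G]) (intro AE_shift AE_cp_pos, auto)
  then show ?thesis using C by (auto elim: eventually_mono)
qed

text \<open>\<open>M\<close> is fixed before \<open>n\<close>, large enough for the rounding loss
  per site to stay below \<epsilon>. The boundary and length terms then vanish relative to the size
  of the box.\<close>

lemma upper_past:
  assumes uA: "past u A" and nn: "\<And>v i. v \<in> insert u A \<Longrightarrow> 0 \<le> v $ i" and \<epsilon>: "0 < \<epsilon>"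
  shows "AE \<omega> in \<mu>. \<forall>\<^sub>F n in sequentially. K n \<omega> / real (card (Lam G n)) < h u A + \<epsilon>"
proof -
  let ?l = "\<lambda>n. real (card (Lam G n))"
  obtain b where b: "\<And>v i. v \<in> insert u A \<Longrightarrow> 0 \<le> v $ i \<and> v $ i \<le> int b"
    using past_bound[OF uA nn] by blast
  have "(\<lambda>M. log 2 (real (M + CARD('a)) / real M)) \<longlonglongrightarrow> 0"
  proof -
    have "(\<lambda>M. log 2 ((real M + c) / real M)) \<longlonglongrightarrow> 0" for c :: real
      unfolding log_def by real_asymp
    then show ?thesis by simp
  qed
  then have "\<forall>\<^sub>F M in sequentially. log 2 (real (M + CARD('a)) / real M) < \<epsilon>"
    using \<epsilon> by (rule order_tendstoD)
  then obtain M where M: "0 < M" "log 2 (real (M + CARD('a)) / real M) < \<epsilon>"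
    using eventually_conj[OF _ eventually_gt_at_top[of 0]] eventually_happens'[OF sequentially_bot] by blast
  define D where "D = real (M + CARD('a))"
  obtain C where C: "\<And>n \<omega>. 0 < n \<Longrightarrow> (\<forall>g\<in>G. 0 < cp u A (shift G g \<omega>)) \<Longrightarrow>
     K n \<omega> \<le> (\<Sum>g\<in>Lam G n. - log 2 (cp u A (shift G g \<omega>))) + ?l n * log 2 (D / real M)
       + (?l n - ?l (n - b)) * log 2 D + log 2 (real (card (Lam G n) + 1) * real (card (Lam G n) + 2)) + C"
    using kolm_string_le[OF uA b M(1)] unfolding D_def by blast
  have AE1: "AE \<omega> in \<mu>. \<forall>g\<in>G. 0 < cp u A (shift G g \<omega>)"
    by (rule AE_ball_countable'[OF _ countable_G]) (intro AE_shift AE_cp_pos, use uA in \<open>auto simp: past_def\<close>)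
  have "local_on (insert u A) (\<lambda>\<omega>. - log 2 (cp u A \<omega>))"
    using local_on_cp[of u A] unfolding local_on_def by metis
  then have "integrable \<mu> (\<lambda>\<omega>. - log 2 (cp u A \<omega>))"
    by (rule integrable_local[rotated 2]) (use uA in \<open>auto simp: past_def\<close>)
  note AE2 = ergodic_average[OF this, folded h_def]
  show ?thesis using AE1 AE2
  proof eventually_elim
    case (elim \<omega>)
    let ?A = "\<lambda>n. (\<Sum>g\<in>Lam G n. - log 2 (cp u A (shift G g \<omega>))) / ?l n"
    let ?R = "\<lambda>n. ?A n + log 2 (D / real M) + (1 - ?l (n - b) / ?l n) * log 2 D
        + (log 2 (real (card (Lam G n) + 1) * real (card (Lam G n) + 2)) + C) / ?l n"
    have 1: "(\<lambda>l. (log 2 (real (l + 1) * real (l + 2)) + C) / real l) \<longlonglongrightarrow> 0"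
      unfolding log_def by real_asymp
    have "?R \<longlonglongrightarrow> h u A + log 2 (D / real M) + (1 - 1) * log 2 D + 0"
      by (intro tendsto_intros elim(2) card_Lam_ratio(2)[OF index] filterlim_compose[OF 1 filterlim_card_Lam])
    then have "\<forall>\<^sub>F n in sequentially. ?R n < h u A + \<epsilon>"
      using M(2) by (intro order_tendstoD(2)[of ?R]) (auto simp: D_def)
    then show ?case using eventually_gt_at_top[of 0]
    proof eventually_elim
      case (elim n)
      have l: "0 < ?l n" using card_Lam_ge1[OF index, of n] elim by simp
      have "K n \<omega> / ?l n \<le> ((\<Sum>g\<in>Lam G n. - log 2 (cp u A (shift G g \<omega>))) + ?l n * log 2 (D / real M)
       + (?l n - ?l (n - b)) * log 2 D + log 2 (real (card (Lam G n) + 1) * real (card (Lam G n) + 2)) + C) / ?l n"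
        using C[of n \<omega>] \<open>\<forall>g\<in>G. 0 < cp u A (shift G g \<omega>)\<close> elim(2) by (intro divide_right_mono) auto
      also have "\<dots> = ?R n" using l by (simp add: add_divide_distrib diff_divide_distrib left_diff_distrib)
      finally show ?case using elim(1) by simp
    qed
  qed
qed

theorem upper_bound:
  assumes "0 < \<epsilon>"
  shows "AE \<omega> in \<mu>. \<forall>\<^sub>F n in sequentially. K n \<omega> / real (card (Lam G n)) < entropy_rate + \<epsilon>"
proof -
  have "0 < \<epsilon> / 2" using assms by simp
  then obtain u A where uA: "past u A" "\<And>v i. v \<in> insert u A \<Longrightarrow> 0 \<le> v $ i" "h u A < entropy_rate + \<epsilon> / 2"
    by (rule near_optimal_past) blast
  have "AE \<omega> in \<mu>. \<forall>\<^sub>F n in sequentially. K n \<omega> / real (card (Lam G n)) < h u A + \<epsilon> / 2"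
    by (rule upper_past[OF uA(1,2)]) (use assms in auto)
  then show ?thesis
  proof eventually_elim
    case (elim \<omega>)
    then show ?case by (rule eventually_mono) (use uA(3) in linarith)
  qed
qed

end

section \<open>The lower bound\<close>

text \<open>In terms of \<open>x = - ln r\<close> the gap is \<open>exp (- x) - 1 + x\<close>, a
  convex function. It lies above its tangent at \<delta>, which has slope
  \<open>1 - exp (- \<delta>)\<close> and a nonnegative value there. The lemma replaces
  \<open>- ln r\<close>, which has no sign, by a quantity to which a maximal inequality
  applies.\<close>

lemma neg_ln_le_gap:
  fixes r \<delta> :: real
  assumes r: "0 < r" and \<delta>: "0 < \<delta>"
  shows "- ln r \<le> \<delta> + (r - 1 - ln r) / (1 - exp (- \<delta>))"
proof -
  let ?e = "exp (- \<delta>)"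
  have e: "0 < 1 - ?e" using \<delta> by simp
  have "1 + (\<delta> + ln r) \<le> exp (\<delta> + ln r)" by (rule exp_ge_add_one_self)
  then have "?e * (1 + (\<delta> + ln r)) \<le> ?e * exp (\<delta> + ln r)" by (intro mult_left_mono) simp_all
  also have "\<dots> = r" using r by (simp add: exp_add[symmetric])
  finally have 1: "?e * (1 + (\<delta> + ln r)) \<le> r" .
  have 2: "1 - \<delta> \<le> ?e" using exp_ge_add_one_self[of "- \<delta>"] by simp
  have "(- ln r - \<delta>) * (1 - ?e) \<le> r - 1 - ln r"
    using 1 2 by (simp add: algebra_simps)
  then have "- ln r - \<delta> \<le> (r - 1 - ln r) / (1 - ?e)" using e by (simp add: pos_le_divide_eq)
  then show ?thesis by simp
qed

context shift_measure begin

lemma prob_local: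
  assumes "finite V" "V \<subseteq> G" "local_on V Q"
  shows "prob {\<omega> \<in> S. Q \<omega>} = (\<integral>\<omega>. of_bool (Q \<omega>) \<partial>\<mu>)"
proof -
  have "(\<integral>\<omega>. of_bool (Q \<omega>) \<partial>\<mu>) = (\<integral>\<omega>. indicator {\<omega> \<in> S. Q \<omega>} \<omega> \<partial>\<mu>)"
    by (rule Bochner_Integration.integral_cong) (auto simp: indicator_def)
  also have "\<dots> = prob ({\<omega> \<in> S. Q \<omega>} \<inter> space \<mu>)" by (rule Bochner_Integration.integral_indicator)
  also have "{\<omega> \<in> S. Q \<omega>} \<inter> space \<mu> = {\<omega> \<in> S. Q \<omega>}" by auto
  finally show ?thesis by simp
qed

lemma shift_shift: "k \<in> G \<Longrightarrow> shift G k (shift G t \<omega>) = shift G (t + k) \<omega>"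
  using G_add by (auto simp: shift_def fun_eq_iff add_ac)

lemma cp_shift:
  assumes "c \<in> G" "finite V" "insert g V \<subseteq> G"
  shows "cp g V (shift G c \<omega>) = cp (g + c) ((\<lambda>v. v + c) ` V) \<omega>"
  using m_shift_config[of c V \<omega>] m_shift_config[of c "insert g V" \<omega>] assms by (simp add: cp_def)

section \<open>Products of conditional probabilities in a finite box\<close>

abbreviation below :: "(int ^ 'd) set \<Rightarrow> int ^ 'd \<Rightarrow> (int ^ 'd) set" where
  "below B g \<equiv> {v \<in> B. lexless v g}"

lemma m_chain:
  assumes "finite B" "B \<subseteq> G" "0 < m B \<omega>"
  shows "m B \<omega> = (\<Prod>g\<in>B. cp g (below B g) \<omega>)"
  using assms
proof (induction B rule: finite_lex_induct)
  case (insert g B)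
  have e1: "below (insert g B) g = B" using insert.hyps by auto
  have e2: "below (insert g B) k = below B k" if "k \<in> B" for k
    using insert.hyps that lexless_asym by auto
  have "m (insert g B) \<omega> \<le> m B \<omega>" using insert by (intro m_mono) auto
  then have pos: "0 < m B \<omega>" using insert.prems(2) by linarith
  then have "m (insert g B) \<omega> = cp g B \<omega> * m B \<omega>" by (simp add: cp_def)
  also have "m B \<omega> = (\<Prod>k\<in>B. cp k (below B k) \<omega>)" using insert pos by simp
  also have "\<dots> = (\<Prod>k\<in>B. cp k (below (insert g B) k) \<omega>)" by (rule prod.cong) (use e2 in auto)
  finally show ?case using insert.hyps(1,2) by (simp only: prod.insert e1 not_False_eq_True)
qed simp

text \<open>The product over \<open>F\<close> is not the probability of the pattern on
  \<open>F\<close>: its factors also depend on sites of \<open>B\<close> outside \<open>F\<close>.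
  But on the event the chain rule bounds \<open>m B s\<close> by \<open>z\<close> times the product
  over \<open>B - F\<close>, and summing out those sites leaves at most \<open>z\<close> for each
  pattern on \<open>F\<close>.\<close>

lemma prob_small_conditional_prod:
  assumes B: "finite B" "B \<subseteq> G" and F: "F \<subseteq> B" and Q: "local_on F Q" and z: "0 \<le> z"
  shows "prob {\<omega> \<in> S. Q \<omega> \<and> (\<Prod>g\<in>F. cp g (below B g) \<omega>) \<le> z} \<le> z * real (card {s \<in> pat F. Q s})"
proof -
  let ?p = "\<lambda>g. cp g (below B g)"
  have finF: "finite F" using F B finite_subset by blast
  have lp: "local_on B (?p g)" if "g \<in> B" for g
    by (rule local_on_mono[OF local_on_cp]) (use that in auto)
  have lP: "local_on B (\<lambda>\<omega>. \<Prod>g\<in>F. ?p g \<omega>)"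
  proof (rule local_onI)
    fix \<omega> \<omega>' :: "int ^ 'd \<Rightarrow> 'a" assume eq: "\<And>g. g \<in> B \<Longrightarrow> \<omega> g = \<omega>' g"
    show "(\<Prod>g\<in>F. ?p g \<omega>) = (\<Prod>g\<in>F. ?p g \<omega>')"
    proof (rule prod.cong[OF refl])
      fix g assume "g \<in> F"
      then have "g \<in> B" using F by blast
      show "?p g \<omega> = ?p g \<omega>'" by (rule local_onD[OF lp[OF \<open>g \<in> B\<close>]]) (rule eq)
    qed
  qed
  let ?Q = "\<lambda>\<omega>. Q \<omega> \<and> (\<Prod>g\<in>F. ?p g \<omega>) \<le> z"
  have lQ: "local_on B ?Q"
    by (rule local_on_comp2[OF local_on_mono[OF Q F] lP, of "\<lambda>q x. q \<and> x \<le> z"])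
  have lI: "local_on B (\<lambda>\<omega>. of_bool (?Q \<omega>) :: real)" by (rule local_on_comp[OF lQ])
  have "prob {\<omega> \<in> S. ?Q \<omega>} = (\<integral>\<omega>. of_bool (?Q \<omega>) \<partial>\<mu>)" by (rule prob_local[OF B lQ])
  also have "\<dots> = (\<Sum>s\<in>pat B. m B s * of_bool (?Q s))" by (rule integral_local[OF B lI])
  also have "\<dots> \<le> (\<Sum>s\<in>pat B. (z * of_bool (Q (restrict s F))) * (\<Prod>g\<in>B - F. ?p g s))"
  proof (rule sum_mono)
    fix s
    show "m B s * of_bool (?Q s) \<le> z * of_bool (Q (restrict s F)) * (\<Prod>g\<in>B - F. ?p g s)"
    proof (cases "0 < m B s \<and> ?Q s")
      case True
      have "m B s = (\<Prod>g\<in>B. ?p g s)" using m_chain[OF B, of s] True by blast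
      also have "\<dots> = (\<Prod>g\<in>B - F. ?p g s) * (\<Prod>g\<in>F. ?p g s)" by (rule prod.subset_diff[OF F B(1)])
      also have "\<dots> \<le> (\<Prod>g\<in>B - F. ?p g s) * z"
        using True by (intro mult_left_mono prod_nonneg) auto
      finally show ?thesis using True by (simp add: local_on_restrict[OF Q] mult.commute)
    next
      case False
      then have "m B s * of_bool (?Q s) = 0" using m_nonneg[of B s] by (auto simp: less_le)
      moreover have "0 \<le> z * of_bool (Q (restrict s F)) * (\<Prod>g\<in>B - F. ?p g s)"
        using z by (intro mult_nonneg_nonneg prod_nonneg) auto
      ultimately show ?thesis by linarith
    qed
  qed
  also have "\<dots> \<le> (\<Sum>s\<in>pat F. z * of_bool (Q s))"
  proof (rule sum_conditional_prod_le[OF B(1) F, of ?p "\<lambda>s. z * of_bool (Q s)"])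
    fix g and s s' :: "int ^ 'd \<Rightarrow> 'a"
    assume g: "g \<in> B" and eq: "\<And>h. h \<in> B \<Longrightarrow> h = g \<or> lexless h g \<Longrightarrow> s h = s' h"
    show "?p g s = ?p g s'" by (rule local_onD[OF local_on_cp]) (use g eq in auto)
  next
    fix g and s :: "int ^ 'd \<Rightarrow> 'a" assume g: "g \<in> B"
    show "(\<Sum>a\<in>UNIV. ?p g (s(g := a))) \<le> 1"
      by (rule sum_cp_le_1) (use g B in auto)
  qed (use z in auto)
  also have "\<dots> = z * real (card {s \<in> pat F. Q s})"
    using finF by (simp add: of_bool_def sum.If_cases Int_def flip: sum_distrib_left)
  finally show ?thesis .
qed

section \<open>Tail events and the maximal inequality\<close>

lemma AE_eventually_imp_tail_small:
  fixes A :: "nat \<Rightarrow> (int ^ 'd \<Rightarrow> 'a) set"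
  assumes A: "\<And>n. A n \<in> sets \<mu>" and ae: "AE \<omega> in \<mu>. \<forall>\<^sub>F n in sequentially. \<omega> \<notin> A n" and \<rho>: "0 < \<rho>"
  shows "\<forall>\<^sub>F k in sequentially. prob (\<Union>n\<in>{k..}. A n) < \<rho>"
proof -
  let ?X = "\<lambda>k. \<Union>n\<in>{k..}. A n"
  have sets: "?X k \<in> sets \<mu>" for k using A by auto
  have "AE \<omega> in \<mu>. \<omega> \<notin> (\<Inter>k. ?X k)"
    using ae by eventually_elim (auto simp: eventually_sequentially)
  then have "prob (\<Inter>k. ?X k) = 0"
    using sets by (subst prob_eq_0) auto
  moreover have "(\<lambda>k. prob (?X k)) \<longlonglongrightarrow> prob (\<Inter>k. ?X k)"
  proof (rule finite_Lim_measure_decseq)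
    show "decseq ?X" unfolding decseq_def by (intro allI impI UN_mono) auto
  qed (use sets in auto)
  ultimately show ?thesis using order_tendstoD(2)[of "\<lambda>k. prob (?X k)" 0 sequentially \<rho>] \<rho> by simp
qed

text \<open>Continuity from below in \<open>l\<close>. Since \<open>k\<close> is chosen before
  \<open>l\<close>, the proof of the bound may use a finite box that depends on
  \<open>l\<close>.\<close>

lemma tails_small_imp_AE_eventually:
  fixes A :: "nat \<Rightarrow> (int ^ 'd \<Rightarrow> 'a) set"
  assumes A: "\<And>n. A n \<in> sets \<mu>"
    and small: "\<And>\<rho>. 0 < \<rho> \<Longrightarrow> \<exists>k. \<forall>l. prob (\<Union>n\<in>{k..l}. A n) \<le> \<rho>"
  shows "AE \<omega> in \<mu>. \<forall>\<^sub>F n in sequentially. \<omega> \<notin> A n"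
proof -
  let ?X = "\<lambda>k. \<Union>n\<in>{k..}. A n"
  have sets: "?X k \<in> sets \<mu>" for k using A by auto
  have "prob (\<Inter>k. ?X k) \<le> \<rho>" if \<rho>: "0 < \<rho>" for \<rho>
  proof -
    obtain k where k: "\<And>l. prob (\<Union>n\<in>{k..l}. A n) \<le> \<rho>" using small[OF \<rho>] by blast
    have "(\<lambda>l. prob (\<Union>n\<in>{k..l}. A n)) \<longlonglongrightarrow> prob (\<Union>l. \<Union>n\<in>{k..l}. A n)"
    proof (rule finite_Lim_measure_incseq)
      show "incseq (\<lambda>l. \<Union>n\<in>{k..l}. A n)" unfolding incseq_def by (intro allI impI UN_mono) auto
    qed (use A in auto)
    then have "prob (\<Union>l. \<Union>n\<in>{k..l}. A n) \<le> \<rho>" by (rule LIMSEQ_le_const2) (use k in blast)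
    moreover have "prob (\<Inter>k. ?X k) \<le> prob (\<Union>l. \<Union>n\<in>{k..l}. A n)"
    proof (rule finite_measure_mono)
      show "(\<Inter>k. ?X k) \<subseteq> (\<Union>l. \<Union>n\<in>{k..l}. A n)"
      proof
        fix \<omega> assume "\<omega> \<in> (\<Inter>k. ?X k)"
        then have "\<omega> \<in> ?X k" by blast
        then obtain n where "k \<le> n" "\<omega> \<in> A n" by auto
        then show "\<omega> \<in> (\<Union>l. \<Union>n\<in>{k..l}. A n)" by (intro UN_I[of n] UNIV_I) auto
      qed
      show "(\<Union>l. \<Union>n\<in>{k..l}. A n) \<in> sets \<mu>" using A by auto
    qed
    ultimately show ?thesis by linarith
  qed
  then have "prob (\<Inter>k. ?X k) \<le> 0" by (rule field_le_epsilon[where y=0, simplified])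
  then have "prob (\<Inter>k. ?X k) = 0" by (simp add: order_antisym)
  then have "AE \<omega> in \<mu>. \<omega> \<notin> (\<Inter>k. ?X k)" using sets by (subst (asm) prob_eq_0) auto
  then show ?thesis by eventually_elim (auto simp: eventually_sequentially)
qed

text \<open>The functions \<open>D c\<close> need not be shifts of each other, so the usual transference argument is
  replaced by an average over the base points \<open>t\<close>.\<close>

lemma maximal_inequality:
  fixes D :: "int ^ 'd \<Rightarrow> (int ^ 'd \<Rightarrow> 'a) \<Rightarrow> real"
  assumes V: "finite V" "V \<subseteq> G" and D: "\<And>c. local_on V (D c)" "\<And>c \<omega>. 0 \<le> D c \<omega>"
    and ED: "\<And>c. c \<in> Lam G (T + n1) \<Longrightarrow> integral\<^sup>L \<mu> (D c) \<le> \<eta>" and \<kappa>: "0 < \<kappa>"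
  shows "\<kappa> * (\<Sum>t\<in>Lam G T. prob {\<omega> \<in> S. \<exists>n\<in>{1..n1}. \<kappa> * real (card (Lam G n)) < (\<Sum>k\<in>Lam G n. D (t + k) \<omega>)})
    \<le> 4 ^ CARD('d) * (real (card (Lam G (T + n1))) * \<eta>)"
proof -
  let ?P = "\<lambda>t \<omega>. \<exists>n\<in>{1..n1}. \<kappa> * real (card (Lam G n)) < (\<Sum>k\<in>Lam G n. D (t + k) \<omega>)"
  let ?E = "Lam G (T + n1)"
  note fin = finite_Lam[OF index]
  have loc: "local_on V (?P t)" for t
  proof (rule local_onI)
    fix \<omega> \<omega>' :: "int ^ 'd \<Rightarrow> 'a" assume eq: "\<And>g. g \<in> V \<Longrightarrow> \<omega> g = \<omega>' g"
    have "D c \<omega> = D c \<omega>'" for c by (rule local_onD[OF D(1)]) (rule eq)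
    then show "?P t \<omega> = ?P t \<omega>'" by simp
  qed
  have lI: "local_on V (\<lambda>\<omega>. of_bool (?P t \<omega>) :: real)" for t
    by (rule local_on_comp[OF loc])
  have prob: "prob {\<omega> \<in> S. ?P t \<omega>} = (\<integral>\<omega>. of_bool (?P t \<omega>) \<partial>\<mu>)" for t
    by (rule prob_local[OF V loc])
  have pointwise: "\<kappa> * (\<Sum>t\<in>Lam G T. of_bool (?P t \<omega>)) \<le> 4 ^ CARD('d) * (\<Sum>c\<in>?E. D c \<omega>)" for \<omega>
  proof -
    let ?A = "{t \<in> Lam G T. ?P t \<omega>}"
    \<comment> \<open>The default 1 is there because \<open>vitali_count\<close> wants a positive
      size for every base point.\<close>
    define n where "n t = (if ?P t \<omega> then SOME n. n \<in> {1..n1} \<and> \<kappa> * real (card (Lam G n)) < (\<Sum>k\<in>Lam G n. D (t + k) \<omega>) else 1)" for t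
    have n: "n t \<in> {1..n1} \<and> \<kappa> * real (card (Lam G (n t))) < (\<Sum>k\<in>Lam G (n t). D (t + k) \<omega>)" if "?P t \<omega>" for t
    proof -
      from that have "\<exists>n. n \<in> {1..n1} \<and> \<kappa> * real (card (Lam G n)) < (\<Sum>k\<in>Lam G n. D (t + k) \<omega>)" by blast
      from someI_ex[OF this] that show ?thesis unfolding n_def by simp
    qed
    have n0: "0 < n t" for t using n[of t] by (cases "?P t \<omega>") (auto simp: n_def)
    have "\<kappa> * real (card ?A) \<le> 4 ^ CARD('d) * (\<Sum>c\<in>?E. D c \<omega>)"
    proof (rule vitali_count[OF index, of ?A ?E "\<lambda>c. D c \<omega>" \<kappa> n])
      show "(+) t ` Lam G (n t) \<subseteq> ?E" if "t \<in> ?A" for t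
      proof -
        have "Lam G (n t) \<subseteq> Lam G n1" using n[of t] that by (intro Lam_mono) simp
        then show ?thesis using Lam_add[OF index, of t T _ n1] that by blast
      qed
      show "\<kappa> * real (card (Lam G (n t))) \<le> (\<Sum>g\<in>Lam G (n t). D (t + g) \<omega>)" if "t \<in> ?A" for t
        using n[of t] that by simp
    qed (use fin D n0 \<kappa> in auto)
    then show ?thesis using fin[of T] by (simp add: of_bool_def sum.If_cases Int_def)
  qed
  have "\<kappa> * (\<Sum>t\<in>Lam G T. prob {\<omega> \<in> S. ?P t \<omega>}) = (\<integral>\<omega>. \<kappa> * (\<Sum>t\<in>Lam G T. of_bool (?P t \<omega>)) \<partial>\<mu>)"
    unfolding prob using integrable_local[OF V lI] by simp
  also have "\<dots> \<le> (\<integral>\<omega>. 4 ^ CARD('d) * (\<Sum>c\<in>?E. D c \<omega>) \<partial>\<mu>)"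
    using integrable_local[OF V lI] integrable_local[OF V D(1)] pointwise by (intro integral_mono) auto
  also have "\<dots> = 4 ^ CARD('d) * (\<Sum>c\<in>?E. integral\<^sup>L \<mu> (D c))"
    using integrable_local[OF V D(1)] by simp
  also have "\<dots> \<le> 4 ^ CARD('d) * (real (card ?E) * \<eta>)"
    using ED by (intro mult_left_mono sum_bounded_above) auto
  finally show ?thesis .
qed

end

lemma card_kolm_less:
  fixes \<phi> :: "bool list \<Rightarrow> 'a list option"
  shows "finite {x. kolm \<phi> x < enat j}" and "card {x. kolm \<phi> x < enat j} \<le> 2 ^ j"
proof -
  let ?P = "\<lambda>i. {p :: bool list. set p \<subseteq> UNIV \<and> length p = i}"
  let ?U = "\<Union>i<j. ?P i"
  have fin: "finite ?U" by (intro finite_UN_I finite_lists_length_eq) auto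
  have sub: "{x. kolm \<phi> x < enat j} \<subseteq> (\<lambda>p. the (\<phi> p)) ` ?U"
  proof
    fix x assume "x \<in> {x. kolm \<phi> x < enat j}"
    then obtain p where "\<phi> p = Some x" "length p < j" by (auto simp: kolm_def INF_less_iff)
    then show "x \<in> (\<lambda>p. the (\<phi> p)) ` ?U" by (intro image_eqI[of _ _ p]) auto
  qed
  then show "finite {x. kolm \<phi> x < enat j}" using fin finite_surj by blast
  have "card {x. kolm \<phi> x < enat j} \<le> card ?U" using sub fin by (rule surj_card_le[rotated])
  also have "\<dots> \<le> (\<Sum>i<j. card (?P i))" by (rule card_UN_le) simp
  also have "\<dots> = (\<Sum>i<j. 2 ^ i)" by (intro sum.cong[OF refl]) (subst card_lists_length_eq, simp_all)
  also have "\<dots> \<le> 2 ^ j" by (induction j) auto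
  finally show "card {x. kolm \<phi> x < enat j} \<le> 2 ^ j" .
qed

context complexity_setting begin

text \<open>A natural number is below the ceiling of \<open>x\<close> exactly when it is below
  \<open>x\<close>, so this says that the complexity per site is less than \<open>a\<close>, without
  turning a possibly infinite complexity into a real number.\<close>

definition low :: "real \<Rightarrow> nat \<Rightarrow> (int ^ 'd \<Rightarrow> 'a) \<Rightarrow> bool" where
  "low a n \<omega> \<longleftrightarrow> kolm \<phi> (string n \<omega>) < enat (nat \<lceil>a * real (card (Lam G n))\<rceil>)"

lemma string_cong:
  assumes "\<And>g. g \<in> Lam G n \<Longrightarrow> \<omega> g = \<omega>' g"
  shows "string n \<omega> = string n \<omega>'"
proof -
  have "restrict \<omega> (Lam G n) = restrict \<omega>' (Lam G n)" using assms by (auto simp: restrict_def)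
  then show ?thesis by (simp add: string_def)
qed

lemma local_on_low_shift:
  assumes "t \<in> G"
  shows "local_on ((\<lambda>k. t + k) ` Lam G n) (\<lambda>\<omega>. low a n (shift G t \<omega>))"
proof (rule local_onI)
  fix \<omega> \<omega>' :: "int ^ 'd \<Rightarrow> 'a" assume eq: "\<And>g. g \<in> (\<lambda>k. t + k) ` Lam G n \<Longrightarrow> \<omega> g = \<omega>' g"
  have "string n (shift G t \<omega>) = string n (shift G t \<omega>')"
  proof (rule string_cong)
    fix g assume g: "g \<in> Lam G n"
    then have "g \<in> G" using Lam_subset by blast
    then show "shift G t \<omega> g = shift G t \<omega>' g" using eq[of "t + g"] g by (simp add: shift_apply add.commute)
  qed
  then show "low a n (shift G t \<omega>) = low a n (shift G t \<omega>')" by (simp add: low_def)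
qed

text \<open>The string determines the pattern, so short programs are counted instead of patterns.
  The factor 2 absorbs the ceiling.\<close>

lemma card_low:
  assumes t: "t \<in> G" and n: "0 < n" and a: "0 \<le> a"
  shows "real (card {s \<in> pat ((\<lambda>k. t + k) ` Lam G n). low a n (shift G t s)})
     \<le> 2 * 2 powr (a * real (card (Lam G n)))"
proof -
  let ?j = "nat \<lceil>a * real (card (Lam G n))\<rceil>" and ?F = "(\<lambda>k. t + k) ` Lam G n"
  have "card {s \<in> pat ?F. low a n (shift G t s)} \<le> card {x. kolm \<phi> x < enat ?j}"
  proof (rule card_inj_on_le[of "\<lambda>s. string n (shift G t s)"])
    show "inj_on (\<lambda>s. string n (shift G t s)) {s \<in> pat ?F. low a n (shift G t s)}"
    proof (rule inj_onI)
      fix s s' assume s: "s \<in> {s \<in> pat ?F. low a n (shift G t s)}" and s': "s' \<in> {s \<in> pat ?F. low a n (shift G t s)}"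
        and eq: "string n (shift G t s) = string n (shift G t s')"
      show "s = s'"
      proof (rule PiE_ext[of s ?F "\<lambda>_. UNIV" s'])
        fix g assume "g \<in> ?F"
        then obtain k where k: "k \<in> Lam G n" "g = t + k" by blast
        have "k \<in> G" using k Lam_subset by blast
        moreover have "shift G t s k = shift G t s' k"
          using nth_string[OF n k(1)] eq by metis
        ultimately show "s g = s' g" using k by (simp add: shift_apply add.commute)
      qed (use s s' in auto)
    qed
  qed (auto simp: low_def card_kolm_less)
  also have "\<dots> \<le> 2 ^ ?j" by (rule card_kolm_less)
  finally have "real (card {s \<in> pat ?F. low a n (shift G t s)}) \<le> real (2 ^ ?j)" by (simp only: of_nat_le_iff)
  also have "\<dots> = 2 powr real ?j" by (simp add: powr_realpow)
  also have "\<dots> \<le> 2 powr (a * real (card (Lam G n)) + 1)"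
    using a by (intro powr_mono) (auto simp: of_nat_ceiling intro: order_trans[OF _ ceiling_correct[THEN conjunct1, THEN less_imp_le]])
  also have "\<dots> = 2 * 2 powr (a * real (card (Lam G n)))" by (simp add: powr_add)
  finally show ?thesis .
qed

lemma low_sets: "{\<omega> \<in> S. low a n \<omega>} \<in> sets \<mu>"
proof (rule local_sets[OF finite_Lam[OF index] Lam_subset])
  show "local_on (Lam G n) (low a n)"
    by (rule local_onI) (metis low_def string_cong)
qed

lemma integrable_log_cp: "past u A \<Longrightarrow> integrable \<mu> (\<lambda>\<omega>. - log 2 (cp u A \<omega>))"
  by (rule integrable_local[OF _ _ local_on_comp[OF local_on_cp]]) (auto simp: past_def)

lemma log_cp_average_sets:
  assumes uA: "past u A"
  shows "{\<omega> \<in> S. (\<Sum>g\<in>Lam G n. - log 2 (cp u A (shift G g \<omega>))) < y} \<in> sets \<mu>"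
proof -
  have meas: "(\<lambda>\<omega>. - log 2 (cp u A (shift G g \<omega>))) \<in> borel_measurable \<mu>" if "g \<in> G" for g
    using measurable_compose[OF measurable_shift[OF that] borel_measurable_integrable[OF integrable_log_cp[OF uA]]] .
  have "(\<lambda>\<omega>. \<Sum>g\<in>Lam G n. - log 2 (cp u A (shift G g \<omega>))) \<in> borel_measurable \<mu>"
    by (intro borel_measurable_sum meas) (use Lam_subset in blast)
  then have "{\<omega> \<in> space \<mu>. (\<Sum>g\<in>Lam G n. - log 2 (cp u A (shift G g \<omega>))) < y} \<in> sets \<mu>"
    by (rule borel_measurable_less) simp
  then show ?thesis by simp
qed

lemma log_cp_average_low_tail:
  assumes uA: "past u A" and a: "a < h u A" and \<rho>: "0 < \<rho>"
  shows "\<forall>\<^sub>F k in sequentially. \<forall>l. prob {\<omega> \<in> S. \<exists>n\<in>{k..l}.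
    (\<Sum>g\<in>Lam G n. - log 2 (cp u A (shift G g \<omega>))) < a * real (card (Lam G n))} < \<rho>"
proof -
  let ?J = "\<lambda>\<omega>. - log 2 (cp u A \<omega>)"
  let ?Q = "\<lambda>n \<omega>. (\<Sum>g\<in>Lam G n. ?J (shift G g \<omega>)) < a * real (card (Lam G n))"
  note int = integrable_log_cp[OF uA]
  have sets: "{\<omega> \<in> S. ?Q n \<omega>} \<in> sets \<mu>" for n by (rule log_cp_average_sets[OF uA])
  have "AE \<omega> in \<mu>. \<forall>\<^sub>F n in sequentially. \<omega> \<notin> {\<omega> \<in> S. ?Q n \<omega>}"
    using ergodic_average[OF int]
  proof eventually_elim
    case (elim \<omega>)
    then have "\<forall>\<^sub>F n in sequentially. a < (\<Sum>g\<in>Lam G n. ?J (shift G g \<omega>)) / real (card (Lam G n))"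
      using a by (intro order_tendstoD(1)) (auto simp: h_def)
    then show ?case using eventually_gt_at_top[of 0]
    proof eventually_elim
      case (elim n)
      have "0 < real (card (Lam G n))" using card_Lam_ge1[OF index, of n] elim by simp
      then show ?case using elim by (simp add: field_simps)
    qed
  qed
  from AE_eventually_imp_tail_small[OF sets this \<rho>]
  show ?thesis
  proof eventually_elim
    case (elim k)
    have "prob {\<omega> \<in> S. \<exists>n\<in>{k..l}. ?Q n \<omega>} \<le> prob (\<Union>n\<in>{k..}. {\<omega> \<in> S. ?Q n \<omega>})" for l
      by (rule finite_measure_mono) (use sets in auto)
    then show ?case using elim order_le_less_trans by blast
  qed
qed

lemma geometric_tail:
  assumes "0 < \<epsilon>" "0 < \<rho>"
  shows "\<forall>\<^sub>F k in sequentially. \<forall>l. (\<Sum>n\<in>{k..l}. 2 * 2 powr (- \<epsilon> * real (card (Lam G n)))) < (\<rho> :: real)"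
proof -
  define q :: real where "q = 2 powr (- \<epsilon>)"
  have q: "0 < q" "q < 1" using assms by (auto simp: q_def powr_less_one)
  have "summable (\<lambda>n. 2 * q ^ n)" using q by (intro summable_mult summable_geometric) simp
  from suminf_exist_split2[OF this]
  have "(\<lambda>k. \<Sum>n. 2 * q ^ (n + k)) \<longlonglongrightarrow> 0" .
  then have "\<forall>\<^sub>F k in sequentially. (\<Sum>n. 2 * q ^ (n + k)) < \<rho>" using assms(2) by (rule order_tendstoD)
  then show ?thesis
  proof eventually_elim
    case (elim k)
    show ?case
    proof
      fix l
      have "2 powr (- \<epsilon> * real (card (Lam G n))) \<le> q ^ n" for n
      proof -
        have "2 powr (- \<epsilon> * real (card (Lam G n))) \<le> 2 powr (- \<epsilon> * real n)"
          using card_Lam_ge1[OF index, of n] assms by (intro powr_mono) auto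
        also have "\<dots> = q ^ n" using q by (simp add: q_def powr_powr flip: powr_realpow)
        finally show ?thesis .
      qed
      then have "(\<Sum>n\<in>{k..l}. 2 * 2 powr (- \<epsilon> * real (card (Lam G n)))) \<le> (\<Sum>n\<in>{k..l}. 2 * q ^ n)"
        by (intro sum_mono) simp
      also have "\<dots> \<le> (\<Sum>n\<in>{0 + k..<Suc l + k}. 2 * q ^ n)"
        using q by (intro sum_mono2) auto
      also have "\<dots> = (\<Sum>n\<in>{0..<Suc l}. 2 * q ^ (n + k))" by (rule sum.shift_bounds_nat_ivl)
      also have "\<dots> \<le> (\<Sum>n. 2 * q ^ (n + k))"
        using q by (intro sum_le_suminf summable_ignore_initial_segment summable_mult summable_geometric) auto
      finally show "(\<Sum>n\<in>{k..l}. 2 * 2 powr (- \<epsilon> * real (card (Lam G n)))) < \<rho>" using elim by simp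
    qed
  qed
qed

text \<open>By invariance, low complexity at the origin is as likely as low complexity of a pattern
  based at \<open>t + u\<close>. That event is covered by three others: the product of the
  \<open>p\<^sub>g\<close> is small (\<open>E1\<close>, union bound over \<open>n\<close>), it is
  far from the product of the \<open>r\<^sub>g\<close> (\<open>E2\<close>, maximal inequality), or
  the ergodic average of \<open>- log 2 (cp u A)\<close> is too small (\<open>X\<close>). Each of
  them is allotted \<open>\<rho> / 3\<close>, the second one only on average over
  \<open>t\<close>.\<close>

lemma low_prob_small:
  assumes \<epsilon>: "0 < \<epsilon>" "\<epsilon> \<le> entropy_rate" and \<rho>: "0 < \<rho>"
  shows "\<exists>n0. \<forall>n1. prob (\<Union>n\<in>{n0..n1}. {\<omega> \<in> S. low (entropy_rate - \<epsilon>) n \<omega>}) \<le> \<rho>"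
proof -
  define a where "a = entropy_rate - \<epsilon>"
  \<comment> \<open>The constants come from the end of the argument. \<delta> and \<kappa> each cost
    \<open>\<epsilon> / 8\<close> per site, so that together they use up the difference between
    \<open>\<epsilon> / 2\<close> and \<open>\<epsilon> / 4\<close>. \<eta> makes the right side of
    the maximal inequality equal to \<kappa> times \<open>\<rho> / 3\<close> times the number of
    base points; its 6 is 3 times the ratio bound 2 for the boxes.\<close>
  define \<delta> where "\<delta> = \<epsilon> * ln 2 / 8"
  define e where "e = 1 - exp (- \<delta>)"
  define \<kappa> where "\<kappa> = \<epsilon> * ln 2 * e / 8"
  define \<eta> where "\<eta> = \<rho> * \<kappa> / (6 * 4 ^ CARD('d) * ln 2)"
  have ln2: "0 < ln (2::real)" by simp
  have \<delta>: "0 < \<delta>" using \<epsilon> by (simp add: \<delta>_def)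
  have e: "0 < e" using \<delta> by (simp add: e_def)
  have \<kappa>: "0 < \<kappa>" using \<epsilon> e by (simp add: \<kappa>_def)
  have \<eta>: "0 < \<eta>" using \<rho> \<kappa> by (simp add: \<eta>_def)
  obtain u A where uA: "past u A" and nn: "\<And>v i. v \<in> insert u A \<Longrightarrow> 0 \<le> v $ i" and hu: "h u A < entropy_rate + \<eta>"
    using \<eta> by (rule near_optimal_past) blast
  obtain b where b: "\<And>v i. v \<in> insert u A \<Longrightarrow> 0 \<le> v $ i \<and> v $ i \<le> int b"
    using past_bound[OF uA nn] by blast
  have uG: "u \<in> G" and AG: "A \<subseteq> G" and finA: "finite A" using uA by (auto simp: past_def)
  have hrle: "entropy_rate \<le> h u A" by (rule entropy_rate_le[OF uA])
  let ?c = "\<lambda>n. real (card (Lam G n))"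
  have "\<forall>\<^sub>F k in sequentially. \<forall>l. (\<Sum>n\<in>{k..l}. 2 * 2 powr (- (\<epsilon> / 2) * ?c n)) < \<rho> / 3"
    using \<epsilon> \<rho> by (intro geometric_tail) auto
  moreover have "\<forall>\<^sub>F k in sequentially. \<forall>l. prob {\<omega> \<in> S. \<exists>n\<in>{k..l}.
      (\<Sum>g\<in>Lam G n. - log 2 (cp u A (shift G g \<omega>))) < (entropy_rate - \<epsilon> / 4) * ?c n} < \<rho> / 3"
    using \<epsilon> \<rho> hrle by (intro log_cp_average_low_tail[OF uA]) auto
  ultimately have "\<forall>\<^sub>F k in sequentially. 0 < k \<and> (\<forall>l. (\<Sum>n\<in>{k..l}. 2 * 2 powr (- (\<epsilon> / 2) * ?c n)) < \<rho> / 3) \<and>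
      (\<forall>l. prob {\<omega> \<in> S. \<exists>n\<in>{k..l}.
        (\<Sum>g\<in>Lam G n. - log 2 (cp u A (shift G g \<omega>))) < (entropy_rate - \<epsilon> / 4) * ?c n} < \<rho> / 3)"
    using eventually_gt_at_top[of 0] by eventually_elim blast
  then obtain n0 where n0: "0 < n0"
    and geo: "\<And>l. (\<Sum>n\<in>{n0..l}. 2 * 2 powr (- (\<epsilon> / 2) * ?c n)) < \<rho> / 3"
    and avg: "\<And>l. prob {\<omega> \<in> S. \<exists>n\<in>{n0..l}.
        (\<Sum>g\<in>Lam G n. - log 2 (cp u A (shift G g \<omega>))) < (entropy_rate - \<epsilon> / 4) * ?c n} < \<rho> / 3"
    using eventually_happens'[OF sequentially_bot] by blast
  have "prob (\<Union>n\<in>{n0..n1}. {\<omega> \<in> S. low a n \<omega>}) \<le> \<rho>" for n1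
  proof -
    have "\<forall>\<^sub>F T in sequentially. ?c (T + n1) / ?c T < 2"
      using card_Lam_ratio(1)[OF index] by (rule order_tendstoD) simp
    then have "\<forall>\<^sub>F T in sequentially. 0 < T \<and> ?c (T + n1) / ?c T < 2"
      using eventually_gt_at_top[of 0] by eventually_elim blast
    \<comment> \<open>\<open>T\<close> may depend on \<open>n1\<close>. It makes the box that
      contains all patterns at most twice as large as the box of base points, whatever
      \<open>n1\<close> is.\<close>
    then obtain T where T: "0 < T" "?c (T + n1) / ?c T < 2"
      using eventually_happens'[OF sequentially_bot] by blast
    have cT: "0 < ?c T" using card_Lam_ge1[OF index, of T] T(1) by simp
    define B where "B = Lam G (T + n1 + b)"
    define E where "E = Lam G (T + n1)"
    have finB: "finite B" "B \<subseteq> G" using finite_Lam[OF index] Lam_subset by (auto simp: B_def)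
    have inB: "v + c \<in> B" if "c \<in> E" "v \<in> insert u A" for c v
    proof -
      have "c \<in> Lam G (T + n1 + b - b)" using that by (simp add: E_def)
      from Lam_add_nonneg[OF index b[OF that(2)] this] show ?thesis by (simp add: B_def add.commute)
    qed
    have EG: "c \<in> G" if "c \<in> E" for c using that Lam_subset unfolding E_def by blast
    define W where "W c = below B (u + c)" for c
    define V where "V c = (\<lambda>v. v + c) ` A" for c
    have WV: "finite (W c)" "V c \<subseteq> W c" "insert (u + c) (W c) \<subseteq> G" "u + c \<notin> W c" if "c \<in> E" for c
      using finB inB[OF that] uA by (auto simp: W_def V_def past_def)
    have cpV: "cp (u + c) (V c) \<omega> = cp u A (shift G c \<omega>)" if "c \<in> E" for c \<omega>
      unfolding V_def using EG[OF that] uG AG finA by (intro cp_shift[symmetric]) auto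
    define r where "r c \<omega> = cp (u + c) (V c) \<omega> / cp (u + c) (W c) \<omega>" for c \<omega>
    \<comment> \<open>Cutting off at 0 changes the gap only where a conditional probability
      vanishes, a null event. It gives nonnegativity everywhere, as
      \<open>maximal_inequality\<close> requires.\<close>
    define D where "D c \<omega> = (if c \<in> E then max 0 (r c \<omega> - 1 - ln (r c \<omega>)) else 0)" for c \<omega>
    have pos: "AE \<omega> in \<mu>. \<forall>c\<in>E. 0 < cp (u + c) (V c) \<omega> \<and> 0 < cp (u + c) (W c) \<omega>"
    proof (rule AE_ball_countable')
      show "countable E" using finite_Lam[OF index] by (simp add: E_def countable_finite)
      fix c assume c: "c \<in> E"
      have "AE \<omega> in \<mu>. 0 < cp (u + c) (V c) \<omega>" "AE \<omega> in \<mu>. 0 < cp (u + c) (W c) \<omega>"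
        using WV[OF c] by (intro AE_cp_pos; auto intro: finite_subset)+
      then show "AE \<omega> in \<mu>. 0 < cp (u + c) (V c) \<omega> \<and> 0 < cp (u + c) (W c) \<omega>" by eventually_elim simp
    qed
    have locD: "local_on B (D c)" for c
    proof (cases "c \<in> E")
      case True
      have "local_on (insert (u + c) (W c)) (\<lambda>\<omega>. r c \<omega> - 1 - ln (r c \<omega>))"
        using cp_ratio(1)[OF WV[OF True]] by (simp add: r_def)
      then have "local_on B (\<lambda>\<omega>. r c \<omega> - 1 - ln (r c \<omega>))"
        by (rule local_on_mono) (use inB[OF True, of u] in \<open>auto simp: W_def\<close>)
      then have "local_on B (\<lambda>\<omega>. max 0 (r c \<omega> - 1 - ln (r c \<omega>)))" by (rule local_on_comp)
      then show ?thesis using True by (simp add: D_def[abs_def])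
    next
      case False
      then show ?thesis by (simp add: D_def[abs_def] local_on_def)
    qed
    have ED: "integral\<^sup>L \<mu> (D c) \<le> ln 2 * \<eta>" if "c \<in> Lam G (T + n1)" for c
    proof -
      have c: "c \<in> E" using that by (simp add: E_def)
      have lg: "local_on (insert (u + c) (W c)) (\<lambda>\<omega>. r c \<omega> - 1 - ln (r c \<omega>))"
        using cp_ratio(1)[OF WV[OF c]] by (simp add: r_def)
      have "AE \<omega> in \<mu>. D c \<omega> = r c \<omega> - 1 - ln (r c \<omega>)" using pos
      proof eventually_elim
        case (elim \<omega>)
        then have "0 < r c \<omega>" using c by (simp add: r_def)
        then show ?case using ln_le_minus_one[of "r c \<omega>"] c by (simp add: D_def)
      qed
      then have "integral\<^sup>L \<mu> (D c) = (\<integral>\<omega>. r c \<omega> - 1 - ln (r c \<omega>) \<partial>\<mu>)"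
        using integrable_local[OF finB locD] integrable_local[OF _ WV(3)[OF c] lg] WV(1)[OF c]
        by (intro integral_cong_AE borel_measurable_integrable) auto
      also have "\<dots> \<le> ln 2 * (h (u + c) (V c) - h (u + c) (W c))"
        unfolding r_def by (rule cp_ratio(2)[OF WV[OF c]])
      also have "\<dots> \<le> ln 2 * \<eta>"
      proof -
        have "h (u + c) (V c) = h u A" unfolding V_def by (rule h_past_shift[OF uA EG[OF c]])
        \<comment> \<open>The rate bounds \<open>h\<close> from below for every past, so the entropy
          drop is below \<eta> for all \<open>c\<close>, wherever \<open>u + c\<close> lies in the
          box.\<close>
        moreover have "entropy_rate \<le> h (u + c) (W c)"
          unfolding W_def by (intro entropy_rate_le past_below finB) (use inB[OF c] in auto)
        ultimately show ?thesis using hu ln2 by (intro mult_left_mono) auto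
      qed
      finally show ?thesis .
    qed
    have D0: "0 \<le> D c \<omega>" for c \<omega> by (simp add: D_def)
    define E2 where "E2 t = {\<omega> \<in> S. \<exists>n\<in>{1..n1}. \<kappa> * ?c n < (\<Sum>k\<in>Lam G n. D (t + k) \<omega>)}" for t
    have "\<kappa> * (\<Sum>t\<in>Lam G T. prob (E2 t)) \<le> 4 ^ CARD('d) * (?c (T + n1) * (ln 2 * \<eta>))"
      unfolding E2_def by (rule maximal_inequality[OF finB locD D0 ED \<kappa>])
    also have "\<dots> \<le> 4 ^ CARD('d) * ((2 * ?c T) * (ln 2 * \<eta>))"
      using T(2) cT \<eta> by (intro mult_left_mono mult_right_mono) (auto simp: divide_less_eq)
    also have "\<dots> = \<kappa> * (?c T * (\<rho> / 3))" using ln2 by (simp add: \<eta>_def field_simps)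
    finally have sumE2: "(\<Sum>t\<in>Lam G T. prob (E2 t)) \<le> ?c T * (\<rho> / 3)" using \<kappa> by simp
    have E2_sets: "E2 t \<in> sets \<mu>" for t unfolding E2_def
    proof (rule local_sets[OF finB], rule local_onI)
      fix \<omega> \<omega>' :: "int ^ 'd \<Rightarrow> 'a" assume eq: "\<And>g. g \<in> B \<Longrightarrow> \<omega> g = \<omega>' g"
      have "D c \<omega> = D c \<omega>'" for c by (rule local_onD[OF locD]) (rule eq)
      then show "(\<exists>n\<in>{1..n1}. \<kappa> * ?c n < (\<Sum>k\<in>Lam G n. D (t + k) \<omega>))
        = (\<exists>n\<in>{1..n1}. \<kappa> * ?c n < (\<Sum>k\<in>Lam G n. D (t + k) \<omega>'))" by simp
    qed
    define E0 where "E0 = {\<omega> \<in> S. \<exists>n\<in>{n0..n1}. low a n \<omega>}"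
    have E0_eq: "E0 = (\<Union>n\<in>{n0..n1}. {\<omega> \<in> S. low a n \<omega>})" by (auto simp: E0_def)
    have E0_sets: "E0 \<in> sets \<mu>" unfolding E0_eq using low_sets by auto
    define X where "X = {\<omega> \<in> S. \<exists>n\<in>{n0..n1}.
        (\<Sum>g\<in>Lam G n. - log 2 (cp u A (shift G g \<omega>))) < (entropy_rate - \<epsilon> / 4) * ?c n}"
    have X_sets: "X \<in> sets \<mu>"
    proof -
      have "X = (\<Union>n\<in>{n0..n1}. {\<omega> \<in> S. (\<Sum>g\<in>Lam G n. - log 2 (cp u A (shift G g \<omega>)))
          < (entropy_rate - \<epsilon> / 4) * ?c n})" by (auto simp: X_def)
      then show ?thesis using log_cp_average_sets[OF uA] by auto
    qed
    have main: "prob E0 \<le> \<rho> / 3 + prob (E2 t) + \<rho> / 3" if t: "t \<in> Lam G T" for t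
    proof -
      have tG: "t \<in> G" using t Lam_subset by blast
      \<comment> \<open>With this base the site \<open>s + k\<close> of the pattern is the one
        predicted by the window translated by \<open>t + k\<close>, while the ergodic average is
        taken at \<open>t\<close>.\<close>
      define s where "s = t + u"
      have sG: "s \<in> G" using G_add[OF tG uG] by (simp add: s_def)
      define F where "F n = (\<lambda>k. s + k) ` Lam G n" for n
      have tk: "t + k \<in> E" if "k \<in> Lam G n" "n \<le> n1" for k n
        using Lam_add[OF index t] Lam_mono[OF that(2)] that(1) unfolding E_def by blast
      have FB: "F n \<subseteq> B" if "n \<le> n1" for n
        using inB[OF tk[OF _ that], of _ u] by (auto simp: F_def s_def add_ac)
      define z where "z n = 2 powr (- (entropy_rate - \<epsilon> / 2) * ?c n)" for n
      define E1 where "E1 n = {\<omega> \<in> S. low a n (shift G s \<omega>) \<and> (\<Prod>g\<in>F n. cp g (below B g) \<omega>) \<le> z n}" for n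
      have E1_sets: "E1 n \<in> sets \<mu>" if "n \<le> n1" for n
      proof -
        have 1: "local_on B (\<lambda>\<omega>. \<Prod>g\<in>F n. cp g (below B g) \<omega>)"
        proof (rule local_onI)
          fix \<omega> \<omega>' :: "int ^ 'd \<Rightarrow> 'a" assume eq: "\<And>g. g \<in> B \<Longrightarrow> \<omega> g = \<omega>' g"
          show "(\<Prod>g\<in>F n. cp g (below B g) \<omega>) = (\<Prod>g\<in>F n. cp g (below B g) \<omega>')"
          proof (rule prod.cong[OF refl])
            fix g assume "g \<in> F n"
            then have "g \<in> B" using FB[OF that] by blast
            show "cp g (below B g) \<omega> = cp g (below B g) \<omega>'"
              by (rule local_onD[OF local_on_cp]) (use eq \<open>g \<in> B\<close> in auto)
          qed
        qed
        have 2: "local_on B (\<lambda>\<omega>. low a n (shift G s \<omega>))"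
          by (rule local_on_mono[OF local_on_low_shift[OF sG]]) (use FB[OF that] in \<open>simp add: F_def\<close>)
        show ?thesis unfolding E1_def
          by (rule local_sets[OF finB local_on_comp2[OF 2 1, of "\<lambda>q x. q \<and> x \<le> z n"]])
      qed
      have pE1: "prob (E1 n) \<le> 2 * 2 powr (- (\<epsilon> / 2) * ?c n)" if n: "n \<in> {n0..n1}" for n
      proof -
        have "prob (E1 n) \<le> z n * real (card {s' \<in> pat (F n). low a n (shift G s s')})"
          unfolding E1_def
        proof (rule prob_small_conditional_prod[OF finB])
          show "F n \<subseteq> B" using FB n by simp
          show "local_on (F n) (\<lambda>\<omega>. low a n (shift G s \<omega>))"
            unfolding F_def by (rule local_on_low_shift[OF sG])
        qed (simp add: z_def)
        also have "\<dots> \<le> z n * (2 * 2 powr (a * ?c n))"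
          unfolding F_def using n n0 \<epsilon> by (intro mult_left_mono card_low[OF sG]) (auto simp: a_def z_def)
        also have "\<dots> = 2 * 2 powr (- (entropy_rate - \<epsilon> / 2) * ?c n + a * ?c n)"
          by (simp add: z_def powr_add)
        also have "- (entropy_rate - \<epsilon> / 2) * ?c n + a * ?c n = - (\<epsilon> / 2) * ?c n"
          by (simp add: a_def algebra_simps)
        finally show ?thesis .
      qed
      \<comment> \<open>Outside \<open>E1 n\<close> the average of \<open>- log 2\<close> of the
        \<open>p\<^sub>g\<close> is below \<open>entropy_rate - \<epsilon> / 2\<close>. Outside
        \<open>E2 t\<close>, passing to the conditional probabilities given translates of
        \<open>A\<close> adds at most \<open>\<epsilon> / 4\<close> per site. The average at
        \<open>t\<close> is then below \<open>entropy_rate - \<epsilon> / 4\<close>, which is the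
        event \<open>X\<close>.\<close>
      have "AE \<omega> in \<mu>. \<omega> \<in> shift G s -` E0 \<inter> S \<longrightarrow> \<omega> \<in> (\<Union>n\<in>{n0..n1}. E1 n) \<union> E2 t \<union> (shift G t -` X \<inter> S)"
        using pos
      proof eventually_elim
        case (elim \<omega>)
        show ?case
        proof (intro impI)
          assume \<omega>: "\<omega> \<in> shift G s -` E0 \<inter> S"
          then obtain n where n: "n \<in> {n0..n1}" and lown: "low a n (shift G s \<omega>)" by (auto simp: E0_def)
          have n1: "n \<le> n1" using n by simp
          note c = tk[OF _ n1]
          show "\<omega> \<in> (\<Union>n\<in>{n0..n1}. E1 n) \<union> E2 t \<union> (shift G t -` X \<inter> S)"
          proof (cases "\<omega> \<in> E1 n \<or> \<omega> \<in> E2 t")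
            case False
            have z: "z n < (\<Prod>g\<in>F n. cp g (below B g) \<omega>)" using False lown \<omega> by (auto simp: E1_def)
            have "(\<Prod>g\<in>F n. cp g (below B g) \<omega>) = (\<Prod>k\<in>Lam G n. cp (u + (t + k)) (W (t + k)) \<omega>)"
              unfolding F_def W_def s_def by (subst prod.reindex) (simp_all add: add_ac)
            with z have z2: "z n < (\<Prod>k\<in>Lam G n. cp (u + (t + k)) (W (t + k)) \<omega>)" by simp
            have zpos: "0 < z n" by (simp add: z_def)
            have "log 2 (z n) < log 2 (\<Prod>k\<in>Lam G n. cp (u + (t + k)) (W (t + k)) \<omega>)"
              using z2 zpos by simp
            also have "\<dots> = (\<Sum>k\<in>Lam G n. log 2 (cp (u + (t + k)) (W (t + k)) \<omega>))"
            proof -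
              have "ln (\<Prod>k\<in>Lam G n. cp (u + (t + k)) (W (t + k)) \<omega>) = (\<Sum>k\<in>Lam G n. ln (cp (u + (t + k)) (W (t + k)) \<omega>))"
              proof (rule ln_prod[OF finite_Lam[OF index]])
                fix k assume "k \<in> Lam G n"
                then show "cp (u + (t + k)) (W (t + k)) \<omega> \<noteq> 0" using elim c by force
              qed
              then show ?thesis by (simp add: log_def sum_divide_distrib)
            qed
            finally have lg: "- (\<Sum>k\<in>Lam G n. log 2 (cp (u + (t + k)) (W (t + k)) \<omega>)) < (entropy_rate - \<epsilon> / 2) * ?c n"
              by (simp add: z_def algebra_simps)
            have "n \<in> {1..n1}" using n n0 by simp
            then have notE2: "(\<Sum>k\<in>Lam G n. D (t + k) \<omega>) \<le> \<kappa> * ?c n" using False \<omega> by (force simp: E2_def)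
            have log_le: "- log 2 (cp u A (shift G k (shift G t \<omega>)))
                \<le> - log 2 (cp (u + (t + k)) (W (t + k)) \<omega>) + (\<delta> + D (t + k) \<omega> / e) / ln 2" if k: "k \<in> Lam G n" for k
            proof -
              let ?p = "cp (u + (t + k)) (W (t + k)) \<omega>" and ?q = "cp (u + (t + k)) (V (t + k)) \<omega>" and ?r = "r (t + k) \<omega>"
              have p: "0 < ?p" "0 < ?q" using elim c[OF k] by auto
              then have r: "0 < ?r" by (simp add: r_def)
              have kG: "k \<in> G" using k Lam_subset by blast
              have "cp u A (shift G k (shift G t \<omega>)) = ?q"
                unfolding shift_shift[OF kG] by (rule cpV[OF c[OF k], symmetric])
              moreover have "log 2 ?q = log 2 ?p + ln ?r / ln 2"
                using p by (simp add: r_def ln_div log_def field_simps)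
              moreover have "- ln ?r \<le> \<delta> + D (t + k) \<omega> / e"
              proof -
                have "- ln ?r \<le> \<delta> + (?r - 1 - ln ?r) / e" unfolding e_def by (rule neg_ln_le_gap[OF r \<delta>])
                also have "\<dots> \<le> \<delta> + D (t + k) \<omega> / e"
                  using e c[OF k] by (intro add_left_mono divide_right_mono) (auto simp: D_def)
                finally show ?thesis .
              qed
              then have "- ln ?r / ln 2 \<le> (\<delta> + D (t + k) \<omega> / e) / ln 2" using ln2 by (intro divide_right_mono) auto
              ultimately show ?thesis by simp
            qed
            have "(\<Sum>k\<in>Lam G n. - log 2 (cp u A (shift G k (shift G t \<omega>))))
                \<le> (\<Sum>k\<in>Lam G n. - log 2 (cp (u + (t + k)) (W (t + k)) \<omega>) + (\<delta> + D (t + k) \<omega> / e) / ln 2)"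
              by (rule sum_mono) (rule log_le)
            also have "\<dots> = - (\<Sum>k\<in>Lam G n. log 2 (cp (u + (t + k)) (W (t + k)) \<omega>))
                + (\<delta> * ?c n + (\<Sum>k\<in>Lam G n. D (t + k) \<omega>) / e) / ln 2"
              by (simp only: sum.distrib sum_divide_distrib[symmetric] sum_negf sum_constant) (simp add: mult.commute)
            also have "\<dots> < (entropy_rate - \<epsilon> / 2) * ?c n + (\<delta> * ?c n + (\<kappa> * ?c n) / e) / ln 2"
              using lg notE2 e ln2 by (intro add_less_le_mono divide_right_mono add_left_mono) auto
            also have "\<dots> = (entropy_rate - \<epsilon> / 4) * ?c n"
              using e ln2 by (simp add: \<delta>_def \<kappa>_def field_simps)
            finally have "shift G t \<omega> \<in> X"
              using n \<omega> shift_in[OF tG] unfolding X_def by blast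
            then show ?thesis using \<omega> by blast
          qed (use n in blast)
        qed
      qed
      then have "prob (shift G s -` E0 \<inter> S) \<le> prob ((\<Union>n\<in>{n0..n1}. E1 n) \<union> E2 t \<union> (shift G t -` X \<inter> S))"
      proof (rule finite_measure_mono_AE)
        show "(\<Union>n\<in>{n0..n1}. E1 n) \<union> E2 t \<union> (shift G t -` X \<inter> S) \<in> sets \<mu>"
          using E1_sets shift_sets[OF tG X_sets] E2_sets by auto
      qed
      also have "\<dots> \<le> prob ((\<Union>n\<in>{n0..n1}. E1 n) \<union> E2 t) + prob (shift G t -` X \<inter> S)"
        by (rule measure_Un_le) (use E1_sets shift_sets[OF tG X_sets] in \<open>auto simp: E2_sets\<close>)
      also have "prob ((\<Union>n\<in>{n0..n1}. E1 n) \<union> E2 t) \<le> prob (\<Union>n\<in>{n0..n1}. E1 n) + prob (E2 t)"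
        by (rule measure_Un_le) (use E1_sets in \<open>auto simp: E2_sets\<close>)
      also have "prob (\<Union>n\<in>{n0..n1}. E1 n) \<le> (\<Sum>n\<in>{n0..n1}. prob (E1 n))"
        by (rule measure_UNION_le) (use E1_sets in auto)
      also have "\<dots> \<le> (\<Sum>n\<in>{n0..n1}. 2 * 2 powr (- (\<epsilon> / 2) * ?c n))" by (rule sum_mono) (rule pE1)
      also have "\<dots> \<le> \<rho> / 3" using geo[of n1] by simp
      also have "prob (shift G t -` X \<inter> S) = prob X" by (rule prob_shift[OF tG X_sets])
      also have "prob X \<le> \<rho> / 3" using avg[of n1] by (simp add: X_def)
      finally show ?thesis using prob_shift[OF sG E0_sets] by simp
    qed
    \<comment> \<open>\<open>prob E0\<close> does not depend on \<open>t\<close>, so summing the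
      estimate over the base points exploits that \<open>E2 t\<close> is small on average.\<close>
    have "?c T * prob E0 = (\<Sum>t\<in>Lam G T. prob E0)" by simp
    also have "\<dots> \<le> (\<Sum>t\<in>Lam G T. \<rho> / 3 + prob (E2 t) + \<rho> / 3)" by (rule sum_mono) (rule main)
    also have "\<dots> = ?c T * (\<rho> / 3) + (\<Sum>t\<in>Lam G T. prob (E2 t)) + ?c T * (\<rho> / 3)" by (simp add: sum.distrib)
    also have "\<dots> \<le> ?c T * \<rho>" using sumE2 by (simp add: field_simps)
    finally show ?thesis using cT by (simp add: E0_eq)
  qed
  then show ?thesis unfolding a_def by blast
qed

theorem lower_bound:
  assumes \<epsilon>: "0 < \<epsilon>"
  shows "AE \<omega> in \<mu>. \<forall>\<^sub>F n in sequentially. entropy_rate - \<epsilon> \<le> K n \<omega> / real (card (Lam G n))"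
proof (cases "\<epsilon> \<le> entropy_rate")
  case False
  \<comment> \<open>The threshold is negative, and densities are not. The other case provides the
    condition \<open>0 \<le> a\<close> for counting programs.\<close>
  then have "entropy_rate - \<epsilon> \<le> K n \<omega> / real (card (Lam G n))" for n \<omega>
  proof -
    have "entropy_rate - \<epsilon> \<le> 0" using False by simp
    also have "0 \<le> K n \<omega> / real (card (Lam G n))" by (simp add: K_def)
    finally show ?thesis .
  qed
  then show ?thesis by (intro AE_I2 always_eventually allI)
next
  case True
  have "AE \<omega> in \<mu>. \<forall>\<^sub>F n in sequentially. \<omega> \<notin> {\<omega> \<in> S. low (entropy_rate - \<epsilon>) n \<omega>}"
    by (rule tails_small_imp_AE_eventually[OF low_sets low_prob_small[OF \<epsilon> True]])
  then show ?thesis using AE_K_finite AE_space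
  proof eventually_elim
    case (elim \<omega>)
    from elim(1) eventually_gt_at_top[of 0] show ?case
    proof eventually_elim
      case (elim n)
      have c: "0 < real (card (Lam G n))" using card_Lam_ge1[OF index, of n] elim by simp
      obtain k where k: "kolm \<phi> (string n \<omega>) = enat k"
        using \<open>\<forall>n>0. kolm \<phi> (string n \<omega>) \<noteq> \<infinity>\<close> elim by auto
      have "\<not> low (entropy_rate - \<epsilon>) n \<omega>" using elim \<open>\<omega> \<in> space \<mu>\<close> by simp
      then have "nat \<lceil>(entropy_rate - \<epsilon>) * real (card (Lam G n))\<rceil> \<le> k"
        by (simp only: low_def k enat_ord_simps not_less)
      then have "(entropy_rate - \<epsilon>) * real (card (Lam G n)) \<le> real k"
        by (simp only: nat_le_iff ceiling_le_iff of_int_of_nat_eq)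
      then show ?case using c by (simp add: K_def k field_simps)
    qed
  qed
qed

end

section \<open>The Kolmogorov-Sinai entropy\<close>

context shift_measure begin

section \<open>Approximation of measurable sets by local ones\<close>

lemma Lam_exhaust:
  assumes "finite J" "J \<subseteq> G"
  shows "\<exists>k. J \<subseteq> Lam G k"
  using assms
proof (induction J)
  case (insert g J)
  then obtain k where k: "J \<subseteq> Lam G k" by auto
  define l where "l = nat (\<Sum>i\<in>UNIV. \<bar>g $ i\<bar>) + 1"
  have "\<bar>g $ i\<bar> < int l" for i
  proof -
    have "\<bar>g $ i\<bar> \<le> (\<Sum>i\<in>UNIV. \<bar>g $ i\<bar>)" by (rule member_le_sum) auto
    then show ?thesis unfolding l_def by linarith
  qed
  then have "g \<in> Lam G l" using insert.prems by (auto simp: Lam_def)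
  then have "insert g J \<subseteq> Lam G (max k l)"
    using k Lam_mono[of k "max k l" G] Lam_mono[of l "max k l" G] by auto
  then show ?case by blast
qed simp

lemma open_contains_cyl:
  assumes U: "openin (subtopology (full_shift G) S) U" and \<omega>: "\<omega> \<in> U"
  shows "\<exists>k. cyl (Lam G k) \<omega> \<subseteq> U"
proof -
  obtain T where T: "openin (full_shift G) T" "U = T \<inter> S" using U by (auto simp: openin_subtopology)
  have "\<omega> \<in> T" using \<omega> T by blast
  then obtain X where X: "finite {i \<in> G. X i \<noteq> UNIV}" "\<omega> \<in> PiE G X" "PiE G X \<subseteq> T"
    using T(1) unfolding full_shift_def openin_product_topology_alt by auto
  obtain k where k: "{i \<in> G. X i \<noteq> UNIV} \<subseteq> Lam G k" using Lam_exhaust[OF X(1)] by auto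
  have "cyl (Lam G k) \<omega> \<subseteq> PiE G X"
  proof
    fix \<omega>' assume w: "\<omega>' \<in> cyl (Lam G k) \<omega>"
    have "\<omega>' i \<in> X i" if "i \<in> G" for i
    proof (cases "X i = UNIV")
      case False
      then have "\<omega>' i = \<omega> i" using w k that by (auto simp: cyl_def)
      then show ?thesis using X(2) that by auto
    qed simp
    moreover have "\<omega>' \<in> extensional G" using w S_ext by (auto simp: cyl_def PiE_def)
    ultimately show "\<omega>' \<in> PiE G X" by (auto simp: PiE_def)
  qed
  then have "cyl (Lam G k) \<omega> \<subseteq> U" using X(3) T(2) by (auto simp: cyl_def)
  then show ?thesis by blast
qed

text \<open>The sets that can be approximated in this way contain the open sets and are closed under
  complements and countable unions.\<close>

lemma approx_local:
  assumes "A \<in> sets \<mu>" "0 < \<tau>"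
  shows "\<exists>k Q. local_on (Lam G k) Q \<and> prob (A - {\<omega> \<in> S. Q \<omega>}) + prob ({\<omega> \<in> S. Q \<omega>} - A) < \<tau>"
proof -
  note locs = local_sets[OF finite_Lam[OF index] Lam_subset]
  have "A \<in> sigma_sets S {U. openin (subtopology (full_shift G) S) U}" using assms(1) by (simp add: sets_\<mu>)
  then have "A \<in> sets \<mu> \<and> (\<forall>\<tau>>0. \<exists>k Q. local_on (Lam G k) Q \<and>
      prob (A - {\<omega> \<in> S. Q \<omega>}) + prob ({\<omega> \<in> S. Q \<omega>} - A) < \<tau>)"
  proof (induction rule: sigma_sets.induct)
    case (Basic U)
    then have op: "openin (subtopology (full_shift G) S) U" by simp
    have US: "U \<subseteq> S" using openin_subset[OF op] by auto
    have Usets: "U \<in> sets \<mu>" unfolding sets_\<mu> using Basic by (rule sigma_sets.Basic)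
    \<comment> \<open>Membership in an open set is certified by a finite window: these sets increase
      to \<open>U\<close>, because cylinders form a neighbourhood base.\<close>
    let ?Q = "\<lambda>k \<omega>. cyl (Lam G k) \<omega> \<subseteq> U"
    have loc: "local_on (Lam G k) (?Q k)" for k by (rule local_onI) (auto simp: cyl_def)
    have X: "{\<omega> \<in> S. ?Q k \<omega>} \<in> sets \<mu>" for k by (rule locs[OF loc])
    have sub: "{\<omega> \<in> S. ?Q k \<omega>} \<subseteq> U" for k by (auto simp: cyl_def)
    have "(\<lambda>k. prob {\<omega> \<in> S. ?Q k \<omega>}) \<longlonglongrightarrow> prob (\<Union>k. {\<omega> \<in> S. ?Q k \<omega>})"
    proof (rule finite_Lim_measure_incseq)
      show "incseq (\<lambda>k. {\<omega> \<in> S. ?Q k \<omega>})"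
      proof (rule incseq_SucI)
        fix k
        have "cyl (Lam G (Suc k)) \<omega> \<subseteq> cyl (Lam G k) \<omega>" for \<omega>
          using Lam_mono[of k "Suc k" G] by (auto simp: cyl_def)
        then show "{\<omega> \<in> S. ?Q k \<omega>} \<subseteq> {\<omega> \<in> S. ?Q (Suc k) \<omega>}" by blast
      qed
    qed (use X in auto)
    moreover have "(\<Union>k. {\<omega> \<in> S. ?Q k \<omega>}) = U"
    proof (intro equalityI subsetI)
      fix \<omega> assume \<omega>: "\<omega> \<in> U"
      obtain k where "cyl (Lam G k) \<omega> \<subseteq> U" using open_contains_cyl[OF op \<omega>] by (rule exE)
      then show "\<omega> \<in> (\<Union>k. {\<omega> \<in> S. ?Q k \<omega>})" using US \<omega> by (intro UN_I[of k]) auto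
    qed (use sub in auto)
    ultimately have lim: "(\<lambda>k. prob {\<omega> \<in> S. ?Q k \<omega>}) \<longlonglongrightarrow> prob U" by simp
    show ?case
    proof (intro conjI Usets allI impI)
      fix \<tau> :: real assume "0 < \<tau>"
      then have "\<forall>\<^sub>F k in sequentially. prob U - \<tau> < prob {\<omega> \<in> S. ?Q k \<omega>}"
        using lim by (intro order_tendstoD(1)) auto
      then obtain k where k: "prob U - \<tau> < prob {\<omega> \<in> S. ?Q k \<omega>}"
        using eventually_happens'[OF sequentially_bot] by blast
      have "prob (U - {\<omega> \<in> S. ?Q k \<omega>}) = prob U - prob {\<omega> \<in> S. ?Q k \<omega>}"
        by (rule finite_measure_Diff[OF Usets X sub])
      moreover have "{\<omega> \<in> S. ?Q k \<omega>} - U = {}" using sub by blast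
      then have "prob ({\<omega> \<in> S. ?Q k \<omega>} - U) = 0" by (simp only: measure_empty)
      ultimately have "prob (U - {\<omega> \<in> S. ?Q k \<omega>}) + prob ({\<omega> \<in> S. ?Q k \<omega>} - U) < \<tau>" using k by simp
      then show "\<exists>k Q. local_on (Lam G k) Q \<and> prob (U - {\<omega> \<in> S. Q \<omega>}) + prob ({\<omega> \<in> S. Q \<omega>} - U) < \<tau>"
        by (intro exI[of _ k] exI[of _ "?Q k"] conjI loc)
    qed
  next
    case Empty
    have "local_on (Lam G 0) (\<lambda>_. False)" by (simp add: local_on_def)
    then show ?case by (auto intro!: exI[of _ "0::nat"] exI[of _ "\<lambda>_. False"])
  next
    case (Compl A)
    show ?case
    proof (intro conjI allI impI)
      show "S - A \<in> sets \<mu>" using Compl sets.compl_sets[of A \<mu>] by simp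
      fix \<tau> :: real assume "0 < \<tau>"
      then obtain k Q where Q: "local_on (Lam G k) Q"
        "prob (A - {\<omega> \<in> S. Q \<omega>}) + prob ({\<omega> \<in> S. Q \<omega>} - A) < \<tau>" using Compl by blast
      have "A \<in> sets \<mu>" using Compl.IH by (rule conjunct1)
      then have AS: "A \<subseteq> S" using sets.sets_into_space[of A \<mu>] by simp
      have e1: "S - A - {\<omega> \<in> S. \<not> Q \<omega>} = {\<omega> \<in> S. Q \<omega>} - A" by blast
      have e2: "{\<omega> \<in> S. \<not> Q \<omega>} - (S - A) = A - {\<omega> \<in> S. Q \<omega>}" using AS by blast
      show "\<exists>k Q. local_on (Lam G k) Q \<and> prob (S - A - {\<omega> \<in> S. Q \<omega>}) + prob ({\<omega> \<in> S. Q \<omega>} - (S - A)) < \<tau>"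
      proof (intro exI conjI)
        show "local_on (Lam G k) (\<lambda>\<omega>. \<not> Q \<omega>)" by (rule local_on_comp[OF Q(1)])
        show "prob (S - A - {\<omega> \<in> S. \<not> Q \<omega>}) + prob ({\<omega> \<in> S. \<not> Q \<omega>} - (S - A)) < \<tau>"
          unfolding e1 e2 using Q(2) by linarith
      qed
    qed
  next
    case (Union a)
    let ?A = "\<Union>i. a i"
    have a: "a i \<in> sets \<mu>" for i using Union by blast
    then have A: "?A \<in> sets \<mu>" by auto
    show ?case
    proof (intro conjI A allI impI)
      fix \<tau> :: real assume \<tau>: "0 < \<tau>"
      let ?AN = "\<lambda>N. \<Union>i\<in>{..<N}. a i"
      have AN: "?AN N \<in> sets \<mu>" for N using a by auto
      have "(\<lambda>N. prob (?AN N)) \<longlonglongrightarrow> prob (\<Union>N. ?AN N)"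
      proof (rule finite_Lim_measure_incseq)
        show "incseq ?AN" unfolding incseq_def by (intro allI impI UN_mono) auto
      qed (use AN in auto)
      moreover have "(\<Union>N. ?AN N) = ?A" by blast
      ultimately have "\<forall>\<^sub>F N in sequentially. prob ?A - \<tau> / 2 < prob (?AN N)"
        using \<tau> by (intro order_tendstoD(1)) auto
      then obtain N where N: "prob ?A - \<tau> / 2 < prob (?AN N)"
        using eventually_happens'[OF sequentially_bot] by blast
      define \<theta> where "\<theta> = \<tau> / (2 * (real N + 1))"
      have \<theta>: "0 < \<theta>" using \<tau> by (simp add: \<theta>_def)
      have "\<forall>i. \<exists>k Q. local_on (Lam G k) Q \<and> prob (a i - {\<omega> \<in> S. Q \<omega>}) + prob ({\<omega> \<in> S. Q \<omega>} - a i) < \<theta>"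
        using Union \<theta> by blast
      from choice[OF this] obtain k where k: "\<forall>i. \<exists>Q. local_on (Lam G (k i)) Q \<and>
          prob (a i - {\<omega> \<in> S. Q \<omega>}) + prob ({\<omega> \<in> S. Q \<omega>} - a i) < \<theta>" by (rule exE)
      from choice[OF k] obtain Q where "\<forall>i. local_on (Lam G (k i)) (Q i) \<and>
          prob (a i - {\<omega> \<in> S. Q i \<omega>}) + prob ({\<omega> \<in> S. Q i \<omega>} - a i) < \<theta>" by (rule exE)
      then have Q: "local_on (Lam G (k i)) (Q i)"
        "prob (a i - {\<omega> \<in> S. Q i \<omega>}) + prob ({\<omega> \<in> S. Q i \<omega>} - a i) < \<theta>" for i by simp_all
      let ?X = "\<lambda>i. {\<omega> \<in> S. Q i \<omega>}"
      have X: "?X i \<in> sets \<mu>" for i by (rule locs[OF Q(1)])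
      define kk where "kk = Max (k ` {..N})"
      have kk: "k i \<le> kk" if "i < N" for i unfolding kk_def using that by (intro Max_ge) auto
      have lQ: "local_on (Lam G kk) (Q i)" if "i < N" for i
        by (rule local_on_mono[OF Q(1) Lam_mono[OF kk[OF that]]])
      define R where "R \<omega> \<longleftrightarrow> (\<exists>i<N. Q i \<omega>)" for \<omega>
      have lR: "local_on (Lam G kk) R"
      proof (rule local_onI)
        fix \<omega> \<omega>' :: "int ^ 'd \<Rightarrow> 'a" assume eq: "\<And>g. g \<in> Lam G kk \<Longrightarrow> \<omega> g = \<omega>' g"
        have "Q i \<omega> = Q i \<omega>'" if "i < N" for i by (rule local_onD[OF lQ[OF that]]) (rule eq)
        then show "R \<omega> = R \<omega>'" by (auto simp: R_def)
      qed
      have R: "{\<omega> \<in> S. R \<omega>} = (\<Union>i\<in>{..<N}. ?X i)" by (auto simp: R_def)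
      have "prob (?A - {\<omega> \<in> S. R \<omega>}) \<le> prob ((?A - ?AN N) \<union> (\<Union>i\<in>{..<N}. a i - ?X i))"
        unfolding R using A AN a X by (intro finite_measure_mono) auto
      also have "\<dots> \<le> prob (?A - ?AN N) + prob (\<Union>i\<in>{..<N}. a i - ?X i)"
        using A AN a X by (intro measure_Un_le) auto
      also have "prob (?A - ?AN N) = prob ?A - prob (?AN N)"
        using A AN by (intro finite_measure_Diff) auto
      also have "prob (\<Union>i\<in>{..<N}. a i - ?X i) \<le> (\<Sum>i\<in>{..<N}. prob (a i - ?X i))"
        using a X by (intro measure_UNION_le) auto
      finally have 1: "prob (?A - {\<omega> \<in> S. R \<omega>}) \<le> prob ?A - prob (?AN N) + (\<Sum>i\<in>{..<N}. prob (a i - ?X i))" by simp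
      have "prob ({\<omega> \<in> S. R \<omega>} - ?A) \<le> prob (\<Union>i\<in>{..<N}. ?X i - a i)"
        unfolding R using a X by (intro finite_measure_mono) auto
      also have "\<dots> \<le> (\<Sum>i\<in>{..<N}. prob (?X i - a i))"
        using a X by (intro measure_UNION_le) auto
      finally have 2: "prob ({\<omega> \<in> S. R \<omega>} - ?A) \<le> (\<Sum>i\<in>{..<N}. prob (?X i - a i))" .
      have "(\<Sum>i\<in>{..<N}. prob (a i - ?X i)) + (\<Sum>i\<in>{..<N}. prob (?X i - a i))
          = (\<Sum>i\<in>{..<N}. prob (a i - ?X i) + prob (?X i - a i))" by (simp add: sum.distrib)
      also have "\<dots> \<le> (\<Sum>i\<in>{..<N}. \<theta>)" by (intro sum_mono less_imp_le Q(2))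
      also have "\<dots> \<le> \<tau> / 2" using \<tau> by (simp add: \<theta>_def field_simps)
      finally have "prob (?A - {\<omega> \<in> S. R \<omega>}) + prob ({\<omega> \<in> S. R \<omega>} - ?A) < \<tau>"
        using 1 2 N by linarith
      then show "\<exists>k Q. local_on (Lam G k) Q \<and> prob (?A - {\<omega> \<in> S. Q \<omega>}) + prob ({\<omega> \<in> S. Q \<omega>} - ?A) < \<tau>"
        by (intro exI[of _ kk] exI[of _ R] conjI lR)
    qed
  qed
  then show ?thesis using assms(2) by blast
qed

text \<open>The guess is some cell whose local approximation holds at the point. On \<open>B\<close>
  it can fail only if the approximation of \<open>B\<close> fails, or if that of another cell
  \<open>C\<close> holds, at a point outside \<open>C\<close> or in the null set where
  \<open>B\<close> and \<open>C\<close> overlap. If no approximation holds, the arbitrary value of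
  \<open>SOME\<close> is covered by the first case.\<close>

lemma local_guess:
  assumes \<beta>: "finite \<beta>" "\<beta> \<subseteq> sets \<mu>" and disj: "\<And>A B. A \<in> \<beta> \<Longrightarrow> B \<in> \<beta> \<Longrightarrow> A \<noteq> B \<Longrightarrow> prob (A \<inter> B) = 0"
    and \<tau>: "0 < \<tau>"
  shows "\<exists>k guess. local_on (Lam G k) guess \<and> (\<forall>B\<in>\<beta>. prob {\<omega> \<in> B. guess \<omega> \<noteq> B} \<le> \<tau>)"
proof -
  note locs = local_sets[OF finite_Lam[OF index] Lam_subset]
  define \<theta> where "\<theta> = \<tau> / (real (card \<beta>) + 1)"
  have \<theta>: "0 < \<theta>" using \<tau> by (simp add: \<theta>_def)
  have "\<forall>B\<in>\<beta>. \<exists>k Q. local_on (Lam G k) Q \<and> prob (B - {\<omega> \<in> S. Q \<omega>}) + prob ({\<omega> \<in> S. Q \<omega>} - B) < \<theta>"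
    using approx_local \<beta>(2) \<theta> by blast
  from bchoice[OF this] obtain k where k: "\<forall>B\<in>\<beta>. \<exists>Q. local_on (Lam G (k B)) Q \<and>
      prob (B - {\<omega> \<in> S. Q \<omega>}) + prob ({\<omega> \<in> S. Q \<omega>} - B) < \<theta>" by (rule exE)
  from bchoice[OF k] obtain Q where "\<forall>B\<in>\<beta>. local_on (Lam G (k B)) (Q B) \<and>
      prob (B - {\<omega> \<in> S. Q B \<omega>}) + prob ({\<omega> \<in> S. Q B \<omega>} - B) < \<theta>" by (rule exE)
  then have Q: "B \<in> \<beta> \<Longrightarrow> local_on (Lam G (k B)) (Q B)"
    "B \<in> \<beta> \<Longrightarrow> prob (B - {\<omega> \<in> S. Q B \<omega>}) + prob ({\<omega> \<in> S. Q B \<omega>} - B) < \<theta>" for B by simp_all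
  let ?X = "\<lambda>B. {\<omega> \<in> S. Q B \<omega>}"
  have X: "?X B \<in> sets \<mu>" if "B \<in> \<beta>" for B by (rule locs[OF Q(1)[OF that]])
  define kk where "kk = Max (insert 0 (k ` \<beta>))"
  have kk: "k B \<le> kk" if "B \<in> \<beta>" for B unfolding kk_def using that \<beta>(1) by (intro Max_ge) auto
  define guess where "guess \<omega> = (SOME B. B \<in> \<beta> \<and> Q B \<omega>)" for \<omega>
  have lg: "local_on (Lam G kk) guess"
  proof (rule local_onI)
    fix \<omega> \<omega>' :: "int ^ 'd \<Rightarrow> 'a" assume eq: "\<And>g. g \<in> Lam G kk \<Longrightarrow> \<omega> g = \<omega>' g"
    have "Q B \<omega> = Q B \<omega>'" if "B \<in> \<beta>" for B
      by (rule local_onD[OF local_on_mono[OF Q(1)[OF that] Lam_mono[OF kk[OF that]]]]) (rule eq)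
    then have "(\<lambda>B. B \<in> \<beta> \<and> Q B \<omega>) = (\<lambda>B. B \<in> \<beta> \<and> Q B \<omega>')" by auto
    then show "guess \<omega> = guess \<omega>'" by (simp add: guess_def)
  qed
  have "prob {\<omega> \<in> B. guess \<omega> \<noteq> B} \<le> \<tau>" if B: "B \<in> \<beta>" for B
  proof -
    let ?Y = "\<lambda>C. if C = B then B - ?X B else (?X C - C) \<union> (C \<inter> B)"
    have Bs: "C \<in> sets \<mu>" if "C \<in> \<beta>" for C using \<beta> that by blast
    have Y: "?Y C \<in> sets \<mu>" if "C \<in> \<beta>" for C using Bs[OF that] Bs[OF B] X[OF that] by auto
    have "{\<omega> \<in> B. guess \<omega> \<noteq> B} \<subseteq> (\<Union>C\<in>\<beta>. ?Y C)"
    proof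
      fix \<omega> assume w: "\<omega> \<in> {\<omega> \<in> B. guess \<omega> \<noteq> B}"
      have wS: "\<omega> \<in> S" using w sets.sets_into_space[OF Bs[OF B]] by auto
      show "\<omega> \<in> (\<Union>C\<in>\<beta>. ?Y C)"
      proof (cases "Q B \<omega>")
        case False
        then have "\<omega> \<in> ?Y B" using w by simp
        then show ?thesis using B by blast
      next
        case True
        then have "guess \<omega> \<in> \<beta> \<and> Q (guess \<omega>) \<omega>" unfolding guess_def using B by (intro someI) blast
        moreover have "guess \<omega> \<noteq> B" using w by simp
        ultimately have "\<omega> \<in> ?Y (guess \<omega>)" "guess \<omega> \<in> \<beta>" using w wS by auto
        then show ?thesis by blast
      qed
    qed
    then have "prob {\<omega> \<in> B. guess \<omega> \<noteq> B} \<le> prob (\<Union>C\<in>\<beta>. ?Y C)"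
      using Y \<beta>(1) by (intro finite_measure_mono sets.finite_UN) auto
    also have "\<dots> \<le> (\<Sum>C\<in>\<beta>. prob (?Y C))" using Y \<beta>(1) by (intro measure_UNION_le) auto
    also have "\<dots> \<le> (\<Sum>C\<in>\<beta>. \<theta>)"
    proof (rule sum_mono)
      fix C assume C: "C \<in> \<beta>"
      show "prob (?Y C) \<le> \<theta>"
      proof (cases "C = B")
        case True
        show ?thesis unfolding True if_P[OF refl]
          using Q(2)[OF B] measure_nonneg[of \<mu> "?X B - B"] by linarith
      next
        case False
        have "prob ((?X C - C) \<union> (C \<inter> B)) \<le> prob (?X C - C) + prob (C \<inter> B)"
          using X[OF C] Bs[OF C] Bs[OF B] by (intro measure_Un_le) auto
        then show ?thesis unfolding if_not_P[OF False]
          using Q(2)[OF C] disj[OF C B False] measure_nonneg[of \<mu> "C - ?X C"] by linarith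
      qed
    qed
    also have "\<dots> \<le> \<tau>" using \<tau> by (simp add: \<theta>_def field_simps)
    finally show ?thesis .
  qed
  then show ?thesis by (intro exI[of _ kk] exI[of _ guess] conjI lg ballI)
qed

end

section \<open>Infinite sums and cross entropy\<close>

lemma infsum_ennreal_le:
  fixes F :: "'b \<Rightarrow> ennreal"
  assumes "\<And>X. finite X \<Longrightarrow> X \<subseteq> A \<Longrightarrow> sum F X \<le> c"
  shows "infsum F A \<le> c"
  by (subst nonneg_infsum_complete) (use assms in \<open>auto intro!: SUP_least\<close>)

lemma sum_le_infsum_ennreal:
  fixes F :: "'b \<Rightarrow> ennreal"
  assumes "finite X" "X \<subseteq> A"
  shows "sum F X \<le> infsum F A"
  by (subst nonneg_infsum_complete) (use assms in \<open>auto intro!: SUP_upper\<close>)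

text \<open>\<open>X\<close> is taken with a sum within \<epsilon> of the supremum of all finite
  sums; a disjoint addition cannot exceed that supremum.\<close>

lemma small_tail:
  fixes F :: "'b \<Rightarrow> real"
  assumes bound: "\<And>X. finite X \<Longrightarrow> X \<subseteq> A \<Longrightarrow> sum F X \<le> c" and \<epsilon>: "0 < \<epsilon>"
  obtains X where "finite X" "X \<subseteq> A" "\<And>Y. finite Y \<Longrightarrow> Y \<subseteq> A - X \<Longrightarrow> sum F Y < \<epsilon>"
proof -
  let ?Z = "sum F ` {X. finite X \<and> X \<subseteq> A}"
  have bdd: "bdd_above ?Z" using bound by (intro bdd_aboveI[of _ c]) auto
  have ne: "?Z \<noteq> {}" by auto
  have "\<exists>z\<in>?Z. Sup ?Z - \<epsilon> < z" using \<epsilon> by (intro less_cSupD ne) simp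
  then obtain X where X: "finite X" "X \<subseteq> A" "Sup ?Z - \<epsilon> < sum F X" by auto
  show ?thesis
  proof (rule that[OF X(1,2)])
    fix Y assume Y: "finite Y" "Y \<subseteq> A - X"
    have "sum F X + sum F Y = sum F (X \<union> Y)" using X Y by (intro sum.union_disjoint[symmetric]) auto
    also have "\<dots> \<le> Sup ?Z" using X Y by (intro cSup_upper bdd) auto
    finally show "sum F Y < \<epsilon>" using X(3) by linarith
  qed
qed

lemma ent_fun_nonneg: "0 \<le> t \<Longrightarrow> t \<le> 1 \<Longrightarrow> 0 \<le> ent_fun t"
  by (auto simp: ent_fun_def mult_nonneg_nonpos)

text \<open>The weights \<open>p\<close> need not have total mass 1; the deficit is paid for by the term \<open>1 / ln 2\<close>.\<close>

lemma ent_sum_le_cross: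
  fixes p w :: "'b \<Rightarrow> real"
  assumes p: "\<And>x. x \<in> X \<Longrightarrow> 0 < p x" and w: "\<And>x. x \<in> X \<Longrightarrow> 0 < w x" "sum w X \<le> 1"
  shows "(\<Sum>x\<in>X. ent_fun (p x)) \<le> (\<Sum>x\<in>X. p x * (- log 2 (w x))) + 1 / ln 2"
proof -
  have "(\<Sum>x\<in>X. ent_fun (p x)) - (\<Sum>x\<in>X. p x * (- log 2 (w x))) = (\<Sum>x\<in>X. ent_fun (p x) - p x * (- log 2 (w x)))"
    by (rule sum_subtractf[symmetric])
  also have "\<dots> \<le> (\<Sum>x\<in>X. w x / ln 2)"
  proof (rule sum_mono)
    fix x assume x: "x \<in> X"
    have "ln (w x / p x) \<le> w x / p x - 1" using p[OF x] w(1)[OF x] by (intro ln_le_minus_one) simp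
    then have "p x * ln (w x / p x) \<le> p x * (w x / p x - 1)" using p[OF x] by (intro mult_left_mono) auto
    also have "\<dots> \<le> w x" using p[OF x] by (simp add: field_simps)
    finally have "p x * (ln (w x) - ln (p x)) \<le> w x" using p[OF x] w(1)[OF x] by (simp add: ln_div)
    then have "p x * (ln (w x) - ln (p x)) / ln 2 \<le> w x / ln 2" by (intro divide_right_mono) auto
    then show "ent_fun (p x) - p x * (- log 2 (w x)) \<le> w x / ln 2"
      using p[OF x] by (simp add: ent_fun_def log_def algebra_simps diff_divide_distrib)
  qed
  also have "\<dots> \<le> 1 / ln 2" using w(2) by (simp add: divide_right_mono flip: sum_divide_distrib)
  finally show ?thesis by simp
qed

context shift_measure begin

section \<open>The coordinate partition attains the entropy rate\<close>

lemma H_eq_sum: "finite V \<Longrightarrow> V \<subseteq> G \<Longrightarrow> H V = (\<Sum>s\<in>pat V. ent_fun (m V s))"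
  unfolding H_def
  by (subst integral_local[OF _ _ local_on_comp[OF local_on_m]])
     (auto simp: ent_fun_def less_le intro!: sum.cong)

lemma ent_fun_m_nonneg: "0 \<le> ent_fun (m V s)"
  by (intro ent_fun_nonneg m_nonneg m_le_1)

text \<open>Symbols of probability 0 are left out, since the cells of a partition must have positive
  measure.\<close>

definition coord_partition :: "(int ^ 'd \<Rightarrow> 'a) set set" where
  "coord_partition = (\<lambda>a. cyl {0} (\<lambda>_. a)) ` {a. 0 < m {0} (\<lambda>_. a)}"

lemma coord_partition: "mu_partition \<mu> coord_partition"
  unfolding mu_partition_def
proof (intro conjI ballI impI)
  show "coord_partition \<subseteq> sets \<mu>" by (auto simp: coord_partition_def intro!: cyl_sets)
  fix A B assume "A \<in> coord_partition" "B \<in> coord_partition" "A \<noteq> B"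
  then have "A \<inter> B = {}" by (auto simp: coord_partition_def cyl_def)
  then show "measure \<mu> (A \<inter> B) = 0" by simp
next
  show "measure \<mu> (space \<mu> - \<Union>coord_partition) = 0"
  proof -
    have U: "\<Union>coord_partition \<in> sets \<mu>"
      by (auto simp: coord_partition_def intro!: sets.finite_UN cyl_sets)
    have pos: "AE \<omega> in \<mu>. 0 < m {0} \<omega>" by (rule AE_m_pos) auto
    have "AE \<omega> in \<mu>. \<omega> \<notin> space \<mu> - \<Union>coord_partition"
      using pos AE_space
    proof eventually_elim
      case (elim \<omega>)
      have "m {0} \<omega> = m {0} (\<lambda>_. \<omega> 0)" by (rule local_onD[OF local_on_m]) simp
      then have "cyl {0} (\<lambda>_. \<omega> 0) \<in> coord_partition" using elim by (simp add: coord_partition_def)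
      moreover have "\<omega> \<in> cyl {0} (\<lambda>_. \<omega> 0)" using elim by (simp add: cyl_def)
      ultimately show ?case by blast
    qed
    then show ?thesis using sets.compl_sets[OF U] by (subst prob_eq_0) auto
  qed
next
  show "0 < measure \<mu> A" if "A \<in> coord_partition" for A
    using that by (auto simp: coord_partition_def m_def)
qed

text \<open>The refinement over a box contains all non-null cylinders on it, and their entropy is
  \<open>H\<close> of the box. \<open>H_ge\<close> holds for each single box, so the infimum over
  boxes needs no limit.\<close>

lemma ks_entropy_ge: "ennreal entropy_rate \<le> ks_entropy G \<mu>"
proof -
  let ?\<alpha> = coord_partition
  have fin: "finite ?\<alpha>" by (simp add: coord_partition_def)
  have "part_entropy \<mu> ?\<alpha> < \<infinity>"
    using fin by (simp add: part_entropy_def less_top[symmetric])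
  then have "entropy_wrt G \<mu> ?\<alpha> \<le> ks_entropy G \<mu>"
    unfolding ks_entropy_def using coord_partition by (intro SUP_upper) simp
  moreover have "ennreal entropy_rate \<le> entropy_wrt G \<mu> ?\<alpha>"
    unfolding entropy_wrt_def
  proof (rule INF_greatest)
    fix n :: nat assume "n \<in> {0<..}"
    then have c: "0 < real (card (Lam G n))" using card_Lam_ge1[OF index, of n] by simp
    let ?L = "Lam G n"
    define P where "P = {s \<in> pat ?L. 0 < m ?L s}"
    have finL: "finite ?L" "?L \<subseteq> G" using finite_Lam[OF index] by auto
    have LG: "g \<in> G" if "g \<in> ?L" for g using finL(2) that by (rule subsetD)
    have finP: "finite P" unfolding P_def using finL by simp
    have inj: "inj_on (cyl ?L) P"
    proof (rule inj_onI)
      fix s s' assume s: "s \<in> P" "s' \<in> P" "cyl ?L s = cyl ?L s'"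
      have "cyl ?L s \<noteq> {}" using s(1) by (auto simp: P_def m_def)
      then obtain \<omega> where w: "\<omega> \<in> cyl ?L s" "\<omega> \<in> cyl ?L s'" using s(3) by blast
      have "s g = s' g" if "g \<in> ?L" for g using w that unfolding cyl_def by fastforce
      then show "s = s'"
        using s(1,2) by (intro PiE_ext[of s ?L "\<lambda>_. UNIV" s']) (auto simp: P_def)
    qed
    have sub: "cyl ?L ` P \<subseteq> part_refine G \<mu> ?L ?\<alpha>"
    proof
      fix C assume "C \<in> cyl ?L ` P"
      then obtain s where s: "s \<in> P" "C = cyl ?L s" by blast
      let ?A = "\<lambda>g. cyl {0} (\<lambda>_. s g)"
      have C: "C = space \<mu> \<inter> (\<Inter>g\<in>?L. shift G g -` ?A g)"
        using LG shift_in by (auto simp: s(2) cyl_def shift_apply)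
      have pos: "0 < measure \<mu> C" using s by (simp add: P_def m_def)
      \<comment> \<open>A cell of the coordinate partition must have positive measure. Here it does
        because its preimage under the shift contains \<open>C\<close>.\<close>
      have mem: "?A g \<in> ?\<alpha>" if g: "g \<in> ?L" for g
      proof -
        have gG: "g \<in> G" using g finL by blast
        have As: "?A g \<in> sets \<mu>" by (rule cyl_sets) auto
        have "prob C \<le> prob (shift G g -` ?A g \<inter> S)"
          using C g by (intro finite_measure_mono shift_sets[OF gG As]) auto
        also have "\<dots> = prob (?A g)" by (rule prob_shift[OF gG As])
        finally have "0 < m {0} (\<lambda>_. s g)" using pos by (simp add: m_def)
        then show ?thesis by (simp add: coord_partition_def)
      qed
      show "C \<in> part_refine G \<mu> ?L ?\<alpha>"
        unfolding part_refine_def by (intro CollectI exI[of _ ?A] conjI ballI mem C pos)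
    qed
    have "real (card ?L) * entropy_rate \<le> H ?L" by (rule H_ge[OF finL])
    also have "H ?L = (\<Sum>s\<in>P. ent_fun (m ?L s))"
      unfolding H_eq_sum[OF finL] P_def
      by (rule sum.mono_neutral_right) (use finL in \<open>auto simp: ent_fun_def\<close>)
    finally have 1: "real (card ?L) * entropy_rate \<le> (\<Sum>s\<in>P. ent_fun (m ?L s))" .
    have "ennreal (\<Sum>s\<in>P. ent_fun (m ?L s)) = (\<Sum>s\<in>P. ennreal (ent_fun (m ?L s)))"
      by (rule sum_ennreal[symmetric]) (rule ent_fun_m_nonneg)
    also have "\<dots> = (\<Sum>C\<in>cyl ?L ` P. ennreal (ent_fun (measure \<mu> C)))"
      by (subst sum.reindex[OF inj]) (simp add: m_def)
    also have "\<dots> \<le> part_entropy \<mu> (part_refine G \<mu> ?L ?\<alpha>)"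
      unfolding part_entropy_def using finP sub by (intro sum_le_infsum_ennreal) auto
    finally have 2: "ennreal (\<Sum>s\<in>P. ent_fun (m ?L s)) \<le> part_entropy \<mu> (part_refine G \<mu> ?L ?\<alpha>)" .
    have "ennreal entropy_rate \<le> ennreal ((\<Sum>s\<in>P. ent_fun (m ?L s)) / real (card ?L))"
      using 1 c by (intro ennreal_leI) (simp add: field_simps)
    also have "\<dots> = ennreal (\<Sum>s\<in>P. ent_fun (m ?L s)) / of_nat (card ?L)"
      using c by (subst divide_ennreal[symmetric])
        (auto intro!: sum_nonneg ent_fun_m_nonneg simp: ennreal_of_nat_eq_real_of_nat)
    also have "\<dots> \<le> part_entropy \<mu> (part_refine G \<mu> ?L ?\<alpha>) / of_nat (card ?L)"
      by (rule divide_right_mono_ennreal[OF 2])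
    finally show "ennreal entropy_rate \<le> part_entropy \<mu> (part_refine G \<mu> ?L ?\<alpha>) / of_nat (card ?L)" .
  qed
  ultimately show ?thesis by (rule order_trans[rotated])
qed

section \<open>Guessing the cells of a partition from a window\<close>

lemma AE_disjoint:
  assumes X: "finite X" "X \<subseteq> sets \<mu>" and disj: "\<And>A B. A \<in> X \<Longrightarrow> B \<in> X \<Longrightarrow> A \<noteq> B \<Longrightarrow> prob (A \<inter> B) = 0"
  shows "AE \<omega> in \<mu>. \<forall>A\<in>X. \<forall>B\<in>X. A \<noteq> B \<longrightarrow> \<omega> \<notin> A \<inter> B"
proof (intro AE_finite_allI X)
  fix A B assume "A \<in> X" "B \<in> X"
  then show "AE \<omega> in \<mu>. A \<noteq> B \<longrightarrow> \<omega> \<notin> A \<inter> B"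
    using disj[of A B] X prob_eq_0[of "A \<inter> B"] by (cases "A = B") auto
qed

lemma sum_prob_le_1:
  assumes X: "finite X" "X \<subseteq> sets \<mu>" and disj: "\<And>A B. A \<in> X \<Longrightarrow> B \<in> X \<Longrightarrow> A \<noteq> B \<Longrightarrow> prob (A \<inter> B) = 0"
  shows "(\<Sum>A\<in>X. prob A) \<le> 1"
proof -
  have "AE \<omega> in \<mu>. \<forall>A\<in>X. \<forall>B\<in>X. A \<noteq> B \<longrightarrow> \<omega> \<notin> A \<inter> B"
    by (rule AE_disjoint[OF assms])
  then have "AE \<omega> in \<mu>. (\<Sum>A\<in>X. indicator A \<omega>) \<le> (1 :: real)"
  proof eventually_elim
    case (elim \<omega>)
    show ?case
    proof (cases "\<exists>A\<in>X. \<omega> \<in> A")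
      case True
      then obtain A where A: "A \<in> X" "\<omega> \<in> A" by blast
      have "(\<Sum>B\<in>X. indicator B \<omega>) = (\<Sum>B\<in>X. if B = A then 1 else 0 :: real)"
        by (rule sum.cong) (use A elim in \<open>auto simp: indicator_def\<close>)
      then show ?thesis using A X by simp
    next
      case False
      then have "(\<Sum>B\<in>X. indicator B \<omega>) = (0 :: real)" by (intro sum.neutral) (auto simp: indicator_def)
      then show ?thesis by simp
    qed
  qed
  moreover have int: "integrable \<mu> (\<lambda>\<omega>. indicator A \<omega> :: real)" if "A \<in> X" for A
    using that X by (intro integrable_real_indicator) (auto simp: less_top[symmetric])
  ultimately have "(\<integral>\<omega>. (\<Sum>A\<in>X. indicator A \<omega>) \<partial>\<mu>) \<le> (\<integral>\<omega>. (1::real) \<partial>\<mu>)"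
    by (intro integral_mono_AE) auto
  also have "(\<integral>\<omega>. (\<Sum>A\<in>X. indicator A \<omega>) \<partial>\<mu>) = (\<Sum>A\<in>X. prob (A \<inter> S))"
    using int by (subst Bochner_Integration.integral_sum) auto
  also have "\<dots> = (\<Sum>A\<in>X. prob A)"
  proof (rule sum.cong[OF refl])
    fix A assume "A \<in> X"
    then have "A \<subseteq> S" using X sets.sets_into_space[of A \<mu>] by auto
    then show "prob (A \<inter> S) = prob A" by (simp add: Int_absorb2)
  qed
  finally show ?thesis by simp
qed

text \<open>A conditional law of the cell given the window: mass \<open>1 - \<theta>\<close> sits on
  the guess, and the rest is distributed like \<mu>. Every cell thus has positive probability, and
  even a wrong guess costs at most \<open>- log 2 (\<theta> * prob B)\<close>, whose mean is finite
  for a partition of finite entropy.\<close>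

definition guess_prob :: "((int ^ 'd \<Rightarrow> 'a) \<Rightarrow> (int ^ 'd \<Rightarrow> 'a) set) \<Rightarrow> real \<Rightarrow>
    (int ^ 'd \<Rightarrow> 'a) set \<Rightarrow> (int ^ 'd \<Rightarrow> 'a) \<Rightarrow> real" where
  "guess_prob guess \<theta> B \<omega> = (1 - \<theta>) * of_bool (guess \<omega> = B) + \<theta> * prob B"

lemma local_on_guess_prob: "local_on V guess \<Longrightarrow> local_on V (guess_prob guess \<theta> B)"
  unfolding guess_prob_def[abs_def] by (rule local_on_comp)

lemma guess_prob_bounds:
  assumes "0 < \<theta>" "\<theta> < 1"
  shows "\<theta> * prob B \<le> guess_prob guess \<theta> B \<omega>" "guess_prob guess \<theta> B \<omega> \<le> 1" "0 \<le> guess_prob guess \<theta> B \<omega>"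
    "guess \<omega> = B \<Longrightarrow> 1 - \<theta> \<le> guess_prob guess \<theta> B \<omega>"
proof -
  define x where "x = \<theta> * prob B"
  have "0 \<le> x" "x \<le> \<theta>" using assms by (auto simp: x_def intro: mult_left_le)
  then show "\<theta> * prob B \<le> guess_prob guess \<theta> B \<omega>" "guess_prob guess \<theta> B \<omega> \<le> 1" "0 \<le> guess_prob guess \<theta> B \<omega>"
    "guess \<omega> = B \<Longrightarrow> 1 - \<theta> \<le> guess_prob guess \<theta> B \<omega>"
    using assms unfolding guess_prob_def x_def[symmetric] by (auto simp: of_bool_def)
qed

lemma sum_guess_prob:
  assumes \<theta>: "0 < \<theta>" "\<theta> < 1" and X: "finite X" "X \<subseteq> sets \<mu>"
    and disj: "\<And>A B. A \<in> X \<Longrightarrow> B \<in> X \<Longrightarrow> A \<noteq> B \<Longrightarrow> prob (A \<inter> B) = 0"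
  shows "(\<Sum>B\<in>X. guess_prob guess \<theta> B \<omega>) \<le> 1"
proof -
  have "(\<Sum>B\<in>X. of_bool (guess \<omega> = B)) \<le> (1::real)"
    using X(1) by (simp add: of_bool_def)
  then have "(1 - \<theta>) * (\<Sum>B\<in>X. of_bool (guess \<omega> = B)) \<le> 1 - \<theta>"
    using \<theta> by (intro mult_left_le) auto
  moreover have "\<theta> * (\<Sum>B\<in>X. prob B) \<le> \<theta>"
    using \<theta> sum_prob_le_1[OF X disj] by (intro mult_left_le) auto
  ultimately show ?thesis by (simp add: guess_prob_def sum.distrib sum_distrib_left)
qed

lemma integrable_guess_cost:
  assumes "finite V" "V \<subseteq> G" "local_on V guess" "B \<in> sets \<mu>"
  shows "integrable \<mu> (\<lambda>\<omega>. indicator B \<omega> * (- log 2 (guess_prob guess \<theta> B \<omega>)))"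
  using integrable_real_mult_indicator[OF assms(4)
      integrable_local[OF assms(1,2) local_on_comp[OF local_on_guess_prob[OF assms(3)], of "\<lambda>x. - log 2 x"]]]
  by (simp add: mult.commute)

text \<open>Three contributions of size \<epsilon>: the cost of right guesses, wrong guesses on the
  finitely many cells \<open>\<beta>1\<close>, and wrong guesses on the remaining cells. The cost
  \<theta> is fixed first, then \<open>\<beta>1\<close>, and only then the accuracy of the
  guess.\<close>

lemma guess_cost_small:
  assumes part: "mu_partition \<mu> \<beta>" and ent: "part_entropy \<mu> \<beta> < \<infinity>" and \<epsilon>: "0 < \<epsilon>"
  shows "\<exists>k guess \<theta>. local_on (Lam G k) guess \<and> 0 < \<theta> \<and> \<theta> < 1 \<and>
     (\<forall>X. finite X \<longrightarrow> X \<subseteq> \<beta> \<longrightarrow>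
        (\<Sum>B\<in>X. \<integral>\<omega>. indicator B \<omega> * (- log 2 (guess_prob guess \<theta> B \<omega>)) \<partial>\<mu>) \<le> 3 * \<epsilon>)"
proof -
  have \<beta>: "B \<in> sets \<mu>" "0 < prob B" if "B \<in> \<beta>" for B using part that by (auto simp: mu_partition_def)
  have disj: "prob (A \<inter> B) = 0" if "A \<in> \<beta>" "B \<in> \<beta>" "A \<noteq> B" for A B
    using part that by (auto simp: mu_partition_def)
  \<comment> \<open>With this choice a right guess costs at most \<epsilon>.\<close>
  define \<theta> where "\<theta> = 1 - 2 powr (- \<epsilon>)"
  have \<theta>: "0 < \<theta>" "\<theta> < 1" using \<epsilon> by (auto simp: \<theta>_def powr_less_one)
  have lt: "- log 2 (1 - \<theta>) = \<epsilon>" by (simp add: \<theta>_def)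
  define M0 where "M0 = - log 2 \<theta>"
  have M0: "0 \<le> M0" using \<theta> by (simp add: M0_def)
  obtain M where M: "part_entropy \<mu> \<beta> = ennreal M" "0 \<le> M"
    using ent by (cases "part_entropy \<mu> \<beta>" rule: ennreal_cases) auto
  have entX: "(\<Sum>B\<in>X. ent_fun (prob B)) \<le> M" if X: "finite X" "X \<subseteq> \<beta>" for X
  proof -
    have "ennreal (\<Sum>B\<in>X. ent_fun (prob B)) = (\<Sum>B\<in>X. ennreal (ent_fun (prob B)))"
      by (rule sum_ennreal[symmetric]) (simp add: ent_fun_nonneg)
    also have "\<dots> \<le> ennreal M" unfolding M(1)[symmetric] part_entropy_def by (rule sum_le_infsum_ennreal[OF X])
    finally show ?thesis using M(2) by simp
  qed
  have probX: "(\<Sum>B\<in>X. prob B) \<le> 1" if X: "finite X" "X \<subseteq> \<beta>" for X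
  proof (rule sum_prob_le_1[OF X(1)])
    show "prob (A \<inter> B) = 0" if "A \<in> X" "B \<in> X" "A \<noteq> B" for A B
      by (rule disj) (use that X in auto)
  qed (use X \<beta>(1) in auto)
  \<comment> \<open>\<open>F B\<close> is \<open>prob B\<close> times the largest possible cost on
    \<open>B\<close>, by \<open>KcF\<close> below. Its finite sums are bounded because the entropy
    is finite.\<close>
  define F where "F B = M0 * prob B + ent_fun (prob B)" for B
  obtain \<beta>1 where \<beta>1: "finite \<beta>1" "\<beta>1 \<subseteq> \<beta>" "\<And>Y. finite Y \<Longrightarrow> Y \<subseteq> \<beta> - \<beta>1 \<Longrightarrow> sum F Y < \<epsilon>"
  proof (rule small_tail[of \<beta> F "M0 + M" \<epsilon>])
    show "sum F X \<le> M0 + M" if "finite X" "X \<subseteq> \<beta>" for X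
    proof -
      have "sum F X = M0 * (\<Sum>B\<in>X. prob B) + (\<Sum>B\<in>X. ent_fun (prob B))"
        by (simp add: F_def sum.distrib sum_distrib_left)
      also have "M0 * (\<Sum>B\<in>X. prob B) \<le> M0" using M0 probX[OF that] by (intro mult_left_le)
      finally show ?thesis using entX[OF that] by simp
    qed
  qed (use \<epsilon> in auto)
  define Kc where "Kc B = - log 2 (\<theta> * prob B)" for B
  have Kc: "0 \<le> Kc B" if "B \<in> \<beta>" for B
  proof -
    have "\<theta> * prob B \<le> 1" using \<theta> by (intro mult_le_one) auto
    then show ?thesis using \<theta> \<beta>(2)[OF that] by (simp add: Kc_def)
  qed
  have KcF: "prob B * Kc B = F B" if "B \<in> \<beta>" for B
    using \<theta> \<beta>(2)[OF that] by (simp add: Kc_def F_def M0_def ent_fun_def log_mult_pos algebra_simps)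
  \<comment> \<open>Wrong guesses on all of \<open>\<beta>1\<close> then cost at most \<epsilon> in
    total. The added 1 keeps the denominator positive.\<close>
  define \<tau> where "\<tau> = \<epsilon> / ((\<Sum>B\<in>\<beta>1. Kc B) + 1)"
  have sK: "0 \<le> (\<Sum>B\<in>\<beta>1. Kc B)" using Kc \<beta>1 by (intro sum_nonneg) auto
  have \<tau>: "0 < \<tau>" using \<epsilon> sK by (simp add: \<tau>_def)
  have "\<exists>k guess. local_on (Lam G k) guess \<and> (\<forall>B\<in>\<beta>1. prob {\<omega> \<in> B. guess \<omega> \<noteq> B} \<le> \<tau>)"
  proof (rule local_guess[OF \<beta>1(1) _ _ \<tau>])
    show "prob (A \<inter> B) = 0" if "A \<in> \<beta>1" "B \<in> \<beta>1" "A \<noteq> B" for A B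
      by (rule disj) (use that \<beta>1(2) in auto)
  qed (use \<beta>1(2) \<beta>(1) in auto)
  then obtain k guess where guess: "local_on (Lam G k) guess" "\<forall>B\<in>\<beta>1. prob {\<omega> \<in> B. guess \<omega> \<noteq> B} \<le> \<tau>"
    by (elim exE conjE)
  have "(\<Sum>B\<in>X. \<integral>\<omega>. indicator B \<omega> * (- log 2 (guess_prob guess \<theta> B \<omega>)) \<partial>\<mu>) \<le> 3 * \<epsilon>"
    if X: "finite X" "X \<subseteq> \<beta>" for X
  proof -
    have one: "(\<integral>\<omega>. indicator B \<omega> * (- log 2 (guess_prob guess \<theta> B \<omega>)) \<partial>\<mu>)
        \<le> \<epsilon> * prob B + Kc B * prob {\<omega> \<in> B. guess \<omega> \<noteq> B}" if B: "B \<in> \<beta>" for B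
    proof -
      let ?W = "{\<omega> \<in> B. guess \<omega> \<noteq> B}"
      have BS: "B \<subseteq> S" using sets.sets_into_space[OF \<beta>(1)[OF B]] by simp
      have "{\<omega> \<in> S. guess \<omega> \<noteq> B} \<in> sets \<mu>"
        by (rule local_sets[OF finite_Lam[OF index] Lam_subset local_on_comp[OF guess(1)]])
      moreover have "?W = B \<inter> {\<omega> \<in> S. guess \<omega> \<noteq> B}" using BS by blast
      ultimately have W: "?W \<in> sets \<mu>" using \<beta>(1)[OF B] by simp
      have intB: "integrable \<mu> (\<lambda>\<omega>. indicator B \<omega> :: real)" "integrable \<mu> (\<lambda>\<omega>. indicator ?W \<omega> :: real)"
        using \<beta>(1)[OF B] W by (intro integrable_real_indicator; simp add: less_top[symmetric])+
      have "(\<integral>\<omega>. indicator B \<omega> * (- log 2 (guess_prob guess \<theta> B \<omega>)) \<partial>\<mu>)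
          \<le> (\<integral>\<omega>. \<epsilon> * indicator B \<omega> + Kc B * indicator ?W \<omega> \<partial>\<mu>)"
      proof (rule integral_mono)
        show "integrable \<mu> (\<lambda>\<omega>. indicator B \<omega> * (- log 2 (guess_prob guess \<theta> B \<omega>)))"
          by (rule integrable_guess_cost[OF finite_Lam[OF index] Lam_subset guess(1) \<beta>(1)[OF B]])
        show "integrable \<mu> (\<lambda>\<omega>. \<epsilon> * indicator B \<omega> + Kc B * indicator ?W \<omega>)" using intB by simp
        fix \<omega>
        show "indicator B \<omega> * (- log 2 (guess_prob guess \<theta> B \<omega>)) \<le> \<epsilon> * indicator B \<omega> + Kc B * indicator ?W \<omega>"
        proof (cases "\<omega> \<in> B")
          case True
          show ?thesis
          proof (cases "guess \<omega> = B")
            case g: True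
            have "- log 2 (guess_prob guess \<theta> B \<omega>) \<le> - log 2 (1 - \<theta>)"
              using guess_prob_bounds(4)[OF \<theta>, of guess \<omega> B] g \<theta> by simp
            then show ?thesis using True g lt by simp
          next
            case g: False
            have p: "0 < \<theta> * prob B" using \<theta> \<beta>(2)[OF B] by simp
            have "log 2 (\<theta> * prob B) \<le> log 2 (guess_prob guess \<theta> B \<omega>)"
              using guess_prob_bounds(1)[OF \<theta>, of B guess \<omega>] p by (intro log_mono) auto
            then show ?thesis using True g \<epsilon> by (simp add: Kc_def)
          qed
        qed simp
      qed
      also have "\<dots> = \<epsilon> * prob (B \<inter> S) + Kc B * prob (?W \<inter> S)" using intB by simp
      also have "B \<inter> S = B" using BS by auto
      also have "?W \<inter> S = ?W" using BS by auto
      finally show ?thesis .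
    qed
    have "(\<Sum>B\<in>X. \<integral>\<omega>. indicator B \<omega> * (- log 2 (guess_prob guess \<theta> B \<omega>)) \<partial>\<mu>)
        \<le> (\<Sum>B\<in>X. \<epsilon> * prob B + Kc B * prob {\<omega> \<in> B. guess \<omega> \<noteq> B})"
      using X by (intro sum_mono one) auto
    also have "\<dots> = \<epsilon> * (\<Sum>B\<in>X. prob B) + ((\<Sum>B\<in>X \<inter> \<beta>1. Kc B * prob {\<omega> \<in> B. guess \<omega> \<noteq> B})
        + (\<Sum>B\<in>X - \<beta>1. Kc B * prob {\<omega> \<in> B. guess \<omega> \<noteq> B}))"
      unfolding sum.distrib sum_distrib_left by (simp add: sum.Int_Diff[OF X(1), of _ \<beta>1])
    also have "\<epsilon> * (\<Sum>B\<in>X. prob B) \<le> \<epsilon>" using \<epsilon> probX[OF X] by (intro mult_left_le) auto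
    also have "(\<Sum>B\<in>X \<inter> \<beta>1. Kc B * prob {\<omega> \<in> B. guess \<omega> \<noteq> B}) \<le> (\<Sum>B\<in>X \<inter> \<beta>1. Kc B * \<tau>)"
      using guess(2) Kc X by (intro sum_mono mult_left_mono) auto
    also have "\<dots> \<le> (\<Sum>B\<in>\<beta>1. Kc B * \<tau>)"
      using Kc \<tau> \<beta>1 by (intro sum_mono2) auto
    also have "\<dots> \<le> \<epsilon>"
    proof -
      have "(\<Sum>B\<in>\<beta>1. Kc B * \<tau>) = (\<Sum>B\<in>\<beta>1. Kc B) * \<tau>" by (simp add: sum_distrib_right)
      also have "\<dots> \<le> ((\<Sum>B\<in>\<beta>1. Kc B) + 1) * \<tau>" using \<tau> by simp
      also have "\<dots> = \<epsilon>" using sK by (simp add: \<tau>_def)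
      finally show ?thesis .
    qed
    also have "(\<Sum>B\<in>X - \<beta>1. Kc B * prob {\<omega> \<in> B. guess \<omega> \<noteq> B}) \<le> (\<Sum>B\<in>X - \<beta>1. F B)"
    proof (rule sum_mono)
      fix B assume B: "B \<in> X - \<beta>1"
      then have B': "B \<in> \<beta>" using X by blast
      have "prob {\<omega> \<in> B. guess \<omega> \<noteq> B} \<le> prob B"
        using \<beta>(1)[OF B'] by (intro finite_measure_mono) auto
      then have "Kc B * prob {\<omega> \<in> B. guess \<omega> \<noteq> B} \<le> Kc B * prob B" by (intro mult_left_mono Kc[OF B'])
      then show "Kc B * prob {\<omega> \<in> B. guess \<omega> \<noteq> B} \<le> F B" using KcF[OF B'] by (simp add: mult.commute)
    qed
    also have "\<dots> \<le> \<epsilon>" using \<beta>1(3)[of "X - \<beta>1"] X by (intro less_imp_le) auto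
    finally show ?thesis by simp
  qed
  then show ?thesis using guess(1) \<theta> by (intro exI[of _ k] exI[of _ guess] exI[of _ \<theta>] conjI allI impI)
qed

text \<open>Draw a pattern on the enlarged box according to \<mu>, then at each site of the box a
  cell according to \<open>guess_prob\<close>; \<open>w C\<close> is the weight of the outcome
  \<open>C\<close>. The entropy of the refinement is at most its cross entropy with \<open>w\<close>
  up to a constant. At a point of \<open>C\<close> the cost \<open>- log 2 (w C)\<close> is at most
  the information of its pattern plus the costs of its cells, and the means of these are
  \<open>H\<close> of the enlarged box and at most \<kappa> per site.\<close>

lemma part_refine_cost:
  assumes part: "mu_partition \<mu> \<beta>" and guess: "local_on (Lam G k) guess" and \<theta>: "0 < \<theta>" "\<theta> < 1"
    and cost: "\<And>X. finite X \<Longrightarrow> X \<subseteq> \<beta> \<Longrightarrow>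
      (\<Sum>B\<in>X. \<integral>\<omega>. indicator B \<omega> * (- log 2 (guess_prob guess \<theta> B \<omega>)) \<partial>\<mu>) \<le> \<kappa>"
    and n: "0 < n" and X: "finite X" "X \<subseteq> part_refine G \<mu> (Lam G n) \<beta>"
  shows "(\<Sum>C\<in>X. ent_fun (prob C)) \<le> H (Lam G (n + k)) + real (card (Lam G n)) * \<kappa> + 1 / ln 2"
proof -
  let ?F = "Lam G n" and ?V = "Lam G (n + k)"
  note fin = finite_Lam[OF index]
  have \<beta>: "B \<in> sets \<mu>" "0 < prob B" if "B \<in> \<beta>" for B using part that by (auto simp: mu_partition_def)
  have disj: "prob (A \<inter> B) = 0" if "A \<in> \<beta>" "B \<in> \<beta>" "A \<noteq> B" for A B
    using part that by (auto simp: mu_partition_def)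
  have FG: "g \<in> G" if "g \<in> ?F" for g using that Lam_subset by blast
  \<comment> \<open>The box is nonempty, so an intersection over it stays inside \<open>S\<close>
    and is covered by closure under finite intersections.\<close>
  have zeroF: "0 \<in> ?F" using n index by (auto simp: Lam_def)
  have "\<forall>C\<in>X. \<exists>A. (\<forall>g\<in>?F. A g \<in> \<beta>) \<and> C = S \<inter> (\<Inter>g\<in>?F. shift G g -` A g) \<and> 0 < prob C"
    using X(2) by (auto simp: part_refine_def)
  from bchoice[OF this] obtain A where A: "\<forall>C\<in>X. (\<forall>g\<in>?F. A C g \<in> \<beta>) \<and>
      C = S \<inter> (\<Inter>g\<in>?F. shift G g -` A C g) \<and> 0 < prob C" by (rule exE)
  have A\<beta>: "A C g \<in> \<beta>" if "C \<in> X" "g \<in> ?F" for C g using A that by blast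
  have C_eq: "C = S \<inter> (\<Inter>g\<in>?F. shift G g -` A C g)" if "C \<in> X" for C using A that by blast
  have C_pos: "0 < prob C" if "C \<in> X" for C using A that by blast
  have C_sets: "C \<in> sets \<mu>" if C: "C \<in> X" for C
  proof -
    have "C = (\<Inter>g\<in>?F. shift G g -` A C g \<inter> S)" using C_eq[OF C] zeroF by blast
    moreover have "(\<Inter>g\<in>?F. shift G g -` A C g \<inter> S) \<in> sets \<mu>"
      using fin zeroF by (intro sets.finite_INT shift_sets FG \<beta>(1) A\<beta>[OF C]) auto
    ultimately show ?thesis by simp
  qed
  have C_in: "shift G g \<omega> \<in> A C g" if "C \<in> X" "\<omega> \<in> C" "g \<in> ?F" for C \<omega> g
    using C_eq[OF that(1)] that by blast
  have C_disj: "prob (C \<inter> C') = 0" if C: "C \<in> X" "C' \<in> X" "C \<noteq> C'" for C C'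
  proof -
    have "\<exists>g\<in>?F. A C g \<noteq> A C' g"
    proof (rule ccontr)
      assume "\<not> (\<exists>g\<in>?F. A C g \<noteq> A C' g)"
      then have "(\<Inter>g\<in>?F. shift G g -` A C g) = (\<Inter>g\<in>?F. shift G g -` A C' g)" by (intro INF_cong) auto
      then show False using C_eq[OF C(1)] C_eq[OF C(2)] C(3) by simp
    qed
    then obtain g where g: "g \<in> ?F" "A C g \<noteq> A C' g" by blast
    note gA = A\<beta>[OF C(1) g(1)] A\<beta>[OF C(2) g(1)]
    have sets: "A C g \<inter> A C' g \<in> sets \<mu>" using \<beta>(1)[OF gA(1)] \<beta>(1)[OF gA(2)] by auto
    have "C \<inter> C' \<subseteq> shift G g -` (A C g \<inter> A C' g) \<inter> S"
      using C_in[OF C(1) _ g(1)] C_in[OF C(2) _ g(1)] C_eq[OF C(1)] by blast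
    then have "prob (C \<inter> C') \<le> prob (shift G g -` (A C g \<inter> A C' g) \<inter> S)"
      by (intro finite_measure_mono shift_sets[OF FG[OF g(1)] sets])
    also have "\<dots> = 0" using prob_shift[OF FG[OF g(1)] sets] disj[OF gA g(2)] by simp
    finally show ?thesis by (simp add: order_antisym)
  qed
  have AE_one: "AE \<omega> in \<mu>. \<forall>C\<in>X. \<forall>C'\<in>X. C \<noteq> C' \<longrightarrow> \<omega> \<notin> C \<inter> C'"
    by (rule AE_disjoint[OF X(1) _ C_disj]) (use C_sets in auto)
  \<comment> \<open>Only finitely many cells occur in the members of \<open>X\<close>, so all sums
    over cells below are finite although \<beta> may be infinite.\<close>
  define \<beta>0 where "\<beta>0 = (\<Union>C\<in>X. A C ` ?F)"
  have \<beta>0: "finite \<beta>0" "\<beta>0 \<subseteq> \<beta>" using X(1) fin A\<beta> by (auto simp: \<beta>0_def)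
  have in\<beta>0: "A C g \<in> \<beta>0" if "C \<in> X" "g \<in> ?F" for C g using that by (auto simp: \<beta>0_def)
  let ?q = "guess_prob guess \<theta>"
  have sumq: "(\<Sum>B\<in>\<beta>0. ?q B \<omega>) \<le> 1" for \<omega>
  proof (rule sum_guess_prob[OF \<theta> \<beta>0(1)])
    show "prob (B \<inter> B') = 0" if "B \<in> \<beta>0" "B' \<in> \<beta>0" "B \<noteq> B'" for B B'
      by (rule disj) (use that \<beta>0(2) in auto)
  qed (use \<beta>0(2) \<beta>(1) in auto)
  note qb = guess_prob_bounds[OF \<theta>]
  have qpos: "0 < ?q B \<omega>" if "B \<in> \<beta>" for B \<omega>
  proof -
    have "0 < \<theta> * prob B" using \<theta> \<beta>(2)[OF that] by simp
    then show ?thesis using qb(1)[of B guess \<omega>] by linarith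
  qed
  define Q where "Q C \<omega> = m ?V \<omega> * (\<Prod>g\<in>?F. ?q (A C g) (shift G g \<omega>))" for C \<omega>
  have Q0: "0 \<le> Q C \<omega>" for C \<omega> by (auto simp: Q_def intro!: mult_nonneg_nonneg prod_nonneg qb(3))
  have lg: "local_on ?V (\<lambda>\<omega>. ?q B (shift G g \<omega>))" if g: "g \<in> ?F" for g B
  proof (rule local_onI)
    fix \<omega> \<omega>' :: "int ^ 'd \<Rightarrow> 'a" assume eq: "\<And>h. h \<in> ?V \<Longrightarrow> \<omega> h = \<omega>' h"
    show "?q B (shift G g \<omega>) = ?q B (shift G g \<omega>')"
    proof (rule local_onD[OF local_on_guess_prob[OF guess]])
      fix h assume h: "h \<in> Lam G k"
      then have "h \<in> G" using Lam_subset by blast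
      moreover have "h + g \<in> ?V" using Lam_add[OF index g h] by (simp add: add.commute)
      ultimately show "shift G g \<omega> h = shift G g \<omega>' h" using eq by (simp add: shift_apply)
    qed
  qed
  have lQ: "local_on ?V (Q C)" for C
  proof (rule local_onI)
    fix \<omega> \<omega>' :: "int ^ 'd \<Rightarrow> 'a" assume eq: "\<And>h. h \<in> ?V \<Longrightarrow> \<omega> h = \<omega>' h"
    have "m ?V \<omega> = m ?V \<omega>'" by (rule local_onD[OF local_on_m]) (rule eq)
    moreover have "(\<Prod>g\<in>?F. ?q (A C g) (shift G g \<omega>)) = (\<Prod>g\<in>?F. ?q (A C g) (shift G g \<omega>'))"
    proof (rule prod.cong[OF refl])
      fix g assume "g \<in> ?F"
      from local_onD[OF lg[OF this]] eq
      show "?q (A C g) (shift G g \<omega>) = ?q (A C g) (shift G g \<omega>')" by blast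
    qed
    ultimately show "Q C \<omega> = Q C \<omega>'" by (simp add: Q_def)
  qed
  define w where "w C = (\<Sum>s\<in>pat ?V. Q C s)" for C
  have finV: "finite (pat ?V :: (int ^ 'd \<Rightarrow> 'a) set)" using fin by (rule finite_pat)
  \<comment> \<open>\<open>w C\<close> is a sum of nonnegative terms, and
    \<open>Q C \<omega>\<close> is the term of the pattern of \<omega>.\<close>
  have wQ: "Q C \<omega> \<le> w C" for C \<omega>
  proof -
    have "Q C \<omega> = Q C (restrict \<omega> ?V)" by (rule local_on_restrict[OF lQ, symmetric])
    also have "\<dots> \<le> w C" unfolding w_def by (rule member_le_sum) (use finV Q0 in auto)
    finally show ?thesis .
  qed
  have sum_w: "sum w X \<le> 1"
  proof -
    have prodle: "(\<Sum>C\<in>X. \<Prod>g\<in>?F. ?q (A C g) (shift G g s)) \<le> 1" for s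
    proof -
      let ?r = "\<lambda>C. restrict (A C) ?F"
      have inj: "inj_on ?r X"
      proof (rule inj_onI)
        fix C C' assume C: "C \<in> X" "C' \<in> X" "?r C = ?r C'"
        have "A C g = A C' g" if "g \<in> ?F" for g using fun_cong[OF C(3), of g] that by simp
        then have "(\<Inter>g\<in>?F. shift G g -` A C g) = (\<Inter>g\<in>?F. shift G g -` A C' g)" by (intro INF_cong) auto
        then show "C = C'" using C_eq[OF C(1)] C_eq[OF C(2)] by simp
      qed
      have "(\<Sum>C\<in>X. \<Prod>g\<in>?F. ?q (A C g) (shift G g s)) = (\<Sum>C\<in>X. \<Prod>g\<in>?F. ?q (?r C g) (shift G g s))" by simp
      also have "\<dots> = (\<Sum>b\<in>?r ` X. \<Prod>g\<in>?F. ?q (b g) (shift G g s))" by (simp only: sum.reindex[OF inj] comp_def)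
      \<comment> \<open>Distinct members of \<open>X\<close> have distinct choices of cells. Once
        the sum runs over all choices, it factors into one sum for each site.\<close>
      also have "\<dots> \<le> (\<Sum>b\<in>PiE ?F (\<lambda>_. \<beta>0). \<Prod>g\<in>?F. ?q (b g) (shift G g s))"
        by (rule sum_mono2) (use fin \<beta>0 in\<beta>0 in \<open>auto intro!: finite_PiE prod_nonneg qb(3)\<close>)
      also have "\<dots> = (\<Prod>g\<in>?F. \<Sum>B\<in>\<beta>0. ?q B (shift G g s))"
        using fin \<beta>0(1) by (intro prod_sum_PiE[symmetric]) auto
      also have "\<dots> \<le> 1" by (intro prod_le_1) (auto intro!: sum_nonneg qb(3) sumq)
      finally show ?thesis .
    qed
    have "sum w X = (\<Sum>s\<in>pat ?V. \<Sum>C\<in>X. Q C s)" unfolding w_def by (rule sum.swap)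
    also have "\<dots> = (\<Sum>s\<in>pat ?V. m ?V s * (\<Sum>C\<in>X. \<Prod>g\<in>?F. ?q (A C g) (shift G g s)))"
      by (simp add: Q_def sum_distrib_left)
    also have "\<dots> \<le> (\<Sum>s\<in>pat ?V. m ?V s)" by (intro sum_mono mult_left_le prodle m_nonneg)
    also have "\<dots> = 1" by (rule sum_m) (use fin in auto)
    finally show ?thesis .
  qed
  have Qpos: "0 < Q C \<omega>" if "C \<in> X" "0 < m ?V \<omega>" for C \<omega>
    unfolding Q_def using that A\<beta> by (intro mult_pos_pos prod_pos qpos) auto
  have wpos: "0 < w C" if "C \<in> X" for C
  proof -
    have "(\<Sum>s\<in>pat ?V. m ?V s) \<noteq> 0" using sum_m[OF fin Lam_subset] by simp
    then obtain s where "m ?V s \<noteq> 0" by (rule sum.not_neutral_contains_not_neutral)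
    then have "0 < m ?V s" using m_nonneg[of ?V s] by linarith
    from Qpos[OF that this] wQ[of C s] show ?thesis by linarith
  qed
  have "(\<Sum>C\<in>X. ent_fun (prob C)) \<le> (\<Sum>C\<in>X. prob C * (- log 2 (w C))) + 1 / ln 2"
    by (rule ent_sum_le_cross[OF C_pos wpos sum_w])
  also have "(\<Sum>C\<in>X. prob C * (- log 2 (w C))) \<le> H ?V + real (card ?F) * \<kappa>"
  proof -
    let ?c = "\<lambda>B \<omega>. - log 2 (?q B \<omega>)"
    have c0: "0 \<le> ?c B \<omega>" if "B \<in> \<beta>" for B \<omega> using qpos[OF that, of \<omega>] qb(2)[of guess B \<omega>] by simp
    have int_c: "integrable \<mu> (\<lambda>\<omega>. indicator B \<omega> * ?c B \<omega>)" if "B \<in> \<beta>" for B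
      by (rule integrable_guess_cost[OF fin Lam_subset guess \<beta>(1)[OF that]])
    have int_cs: "integrable \<mu> (\<lambda>\<omega>. indicator B (shift G g \<omega>) * ?c B (shift G g \<omega>))"
      and eq_cs: "(\<integral>\<omega>. indicator B (shift G g \<omega>) * ?c B (shift G g \<omega>) \<partial>\<mu>) = (\<integral>\<omega>. indicator B \<omega> * ?c B \<omega> \<partial>\<mu>)"
      if "B \<in> \<beta>" "g \<in> G" for B g
    proof -
      note ms = measurable_shift[OF that(2)] and ds = distr_shift[OF that(2)]
      show "integrable \<mu> (\<lambda>\<omega>. indicator B (shift G g \<omega>) * ?c B (shift G g \<omega>))"
        by (rule integrable_distr[OF ms]) (use int_c[OF that(1)] in \<open>simp add: ds\<close>)
      have "(\<integral>\<omega>. indicator B \<omega> * ?c B \<omega> \<partial>distr \<mu> \<mu> (shift G g)) = (\<integral>\<omega>. indicator B (shift G g \<omega>) * ?c B (shift G g \<omega>) \<partial>\<mu>)"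
        by (rule integral_distr[OF ms borel_measurable_integrable[OF int_c[OF that(1)]]])
      then show "(\<integral>\<omega>. indicator B (shift G g \<omega>) * ?c B (shift G g \<omega>) \<partial>\<mu>) = (\<integral>\<omega>. indicator B \<omega> * ?c B \<omega> \<partial>\<mu>)"
        by (simp add: ds)
    qed
    have intC: "integrable \<mu> (\<lambda>\<omega>. indicator C \<omega> :: real)" if "C \<in> X" for C
      using C_sets[OF that] by (intro integrable_real_indicator) (auto simp: less_top[symmetric])
    have intm: "integrable \<mu> (\<lambda>\<omega>. - log 2 (m ?V \<omega>))"
      by (rule integrable_local[OF fin Lam_subset local_on_comp[OF local_on_m]])
    \<comment> \<open>The bound must not mention \<open>C\<close>, so at each site the costs of all
      cells of \<open>\<beta>0\<close> containing the shifted point are added up. The right cell is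
      among them, and invariance removes the shift from each integral.\<close>
    let ?R = "\<lambda>\<omega>. - log 2 (m ?V \<omega>) + (\<Sum>g\<in>?F. \<Sum>B\<in>\<beta>0. indicator B (shift G g \<omega>) * ?c B (shift G g \<omega>))"
    have intR: "integrable \<mu> (\<lambda>\<omega>. \<Sum>g\<in>?F. \<Sum>B\<in>\<beta>0. indicator B (shift G g \<omega>) * ?c B (shift G g \<omega>))"
      by (intro Bochner_Integration.integrable_sum int_cs) (use \<beta>0(2) FG in auto)
    have "(\<Sum>C\<in>X. prob C * (- log 2 (w C))) = (\<Sum>C\<in>X. \<integral>\<omega>. indicator C \<omega> * (- log 2 (w C)) \<partial>\<mu>)"
    proof (rule sum.cong[OF refl])
      fix C assume C: "C \<in> X"
      have "C \<inter> S = C" using sets.sets_into_space[OF C_sets[OF C]] by auto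
      then show "prob C * (- log 2 (w C)) = (\<integral>\<omega>. indicator C \<omega> * (- log 2 (w C)) \<partial>\<mu>)"
        using intC[OF C] by simp
    qed
    also have "\<dots> = (\<integral>\<omega>. (\<Sum>C\<in>X. indicator C \<omega> * (- log 2 (w C))) \<partial>\<mu>)"
      using intC by (subst Bochner_Integration.integral_sum) auto
    also have "\<dots> \<le> (\<integral>\<omega>. ?R \<omega> \<partial>\<mu>)"
    proof (rule integral_mono_AE)
      show "integrable \<mu> (\<lambda>\<omega>. \<Sum>C\<in>X. indicator C \<omega> * (- log 2 (w C)))"
        using intC by (intro Bochner_Integration.integrable_sum integrable_mult_left) auto
      show "integrable \<mu> ?R" by (rule Bochner_Integration.integrable_add[OF intm intR])
      have "AE \<omega> in \<mu>. 0 < m ?V \<omega>" by (rule AE_m_pos[OF fin Lam_subset])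
      then show "AE \<omega> in \<mu>. (\<Sum>C\<in>X. indicator C \<omega> * (- log 2 (w C))) \<le> ?R \<omega>" using AE_one
      proof eventually_elim
        case (elim \<omega>)
        have m0: "0 \<le> - log 2 (m ?V \<omega>)" using elim(1) m_le_1[of ?V \<omega>] by simp
        have t0: "0 \<le> indicator B (shift G g \<omega>) * ?c B (shift G g \<omega>)" if "B \<in> \<beta>0" for B g
          using c0[of B "shift G g \<omega>"] that \<beta>0(2) by (intro mult_nonneg_nonneg) auto
        have R0: "0 \<le> (\<Sum>g\<in>?F. \<Sum>B\<in>\<beta>0. indicator B (shift G g \<omega>) * ?c B (shift G g \<omega>))"
          by (intro sum_nonneg t0)
        show ?case
        proof (cases "\<exists>C\<in>X. \<omega> \<in> C")
          case False
          then have "(\<Sum>C\<in>X. indicator C \<omega> * (- log 2 (w C))) = 0" by (intro sum.neutral) auto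
          then show ?thesis using m0 R0 by linarith
        next
          case True
          then obtain C where C: "C \<in> X" "\<omega> \<in> C" by blast
          have "(\<Sum>C'\<in>X. indicator C' \<omega> * (- log 2 (w C'))) = (\<Sum>C'\<in>X. if C' = C then - log 2 (w C) else 0)"
            by (rule sum.cong[OF refl]) (use C elim(2) in \<open>auto simp: indicator_def\<close>)
          also have "\<dots> = - log 2 (w C)" using C X(1) by simp
          also have "\<dots> \<le> - log 2 (Q C \<omega>)" using Qpos[OF C(1) elim(1)] wQ[of C \<omega>] by simp
          also have "\<dots> = - log 2 (m ?V \<omega>) + (\<Sum>g\<in>?F. ?c (A C g) (shift G g \<omega>))"
          proof -
            have p: "0 < ?q (A C g) (shift G g \<omega>)" if "g \<in> ?F" for g by (rule qpos[OF A\<beta>[OF C(1) that]])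
            have "ln (\<Prod>g\<in>?F. ?q (A C g) (shift G g \<omega>)) = (\<Sum>g\<in>?F. ln (?q (A C g) (shift G g \<omega>)))"
              using less_imp_neq[OF p, symmetric] by (intro ln_prod fin)
            then have "log 2 (\<Prod>g\<in>?F. ?q (A C g) (shift G g \<omega>)) = (\<Sum>g\<in>?F. log 2 (?q (A C g) (shift G g \<omega>)))"
              by (simp add: log_def sum_divide_distrib)
            then show ?thesis unfolding Q_def using elim(1) prod_pos[of ?F, OF p]
              by (simp add: log_mult_pos sum_negf)
          qed
          also have "\<dots> \<le> ?R \<omega>"
          proof (intro add_left_mono sum_mono)
            fix g assume g: "g \<in> ?F"
            have "?c (A C g) (shift G g \<omega>) = indicator (A C g) (shift G g \<omega>) * ?c (A C g) (shift G g \<omega>)"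
              using C_in[OF C g] by simp
            also have "\<dots> \<le> (\<Sum>B\<in>\<beta>0. indicator B (shift G g \<omega>) * ?c B (shift G g \<omega>))"
              by (rule member_le_sum[of "A C g" \<beta>0 "\<lambda>B. indicator B (shift G g \<omega>) * ?c B (shift G g \<omega>)"])
                 (use in\<beta>0[OF C(1) g] t0 \<beta>0(1) in auto)
            finally show "?c (A C g) (shift G g \<omega>) \<le> (\<Sum>B\<in>\<beta>0. indicator B (shift G g \<omega>) * ?c B (shift G g \<omega>))" .
          qed
          finally show ?thesis .
        qed
      qed
    qed
    also have "\<dots> = H ?V + (\<integral>\<omega>. (\<Sum>g\<in>?F. \<Sum>B\<in>\<beta>0. indicator B (shift G g \<omega>) * ?c B (shift G g \<omega>)) \<partial>\<mu>)"
      unfolding H_def by (rule Bochner_Integration.integral_add[OF intm intR])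
    also have "(\<integral>\<omega>. (\<Sum>g\<in>?F. \<Sum>B\<in>\<beta>0. indicator B (shift G g \<omega>) * ?c B (shift G g \<omega>)) \<partial>\<mu>)
        = (\<Sum>g\<in>?F. \<integral>\<omega>. (\<Sum>B\<in>\<beta>0. indicator B (shift G g \<omega>) * ?c B (shift G g \<omega>)) \<partial>\<mu>)"
      by (intro Bochner_Integration.integral_sum Bochner_Integration.integrable_sum int_cs) (use \<beta>0(2) FG in auto)
    also have "\<dots> = (\<Sum>g\<in>?F. \<Sum>B\<in>\<beta>0. \<integral>\<omega>. indicator B \<omega> * ?c B \<omega> \<partial>\<mu>)"
    proof (rule sum.cong[OF refl])
      fix g assume g: "g \<in> ?F"
      have "(\<integral>\<omega>. (\<Sum>B\<in>\<beta>0. indicator B (shift G g \<omega>) * ?c B (shift G g \<omega>)) \<partial>\<mu>)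
          = (\<Sum>B\<in>\<beta>0. \<integral>\<omega>. indicator B (shift G g \<omega>) * ?c B (shift G g \<omega>) \<partial>\<mu>)"
        by (intro Bochner_Integration.integral_sum int_cs) (use \<beta>0(2) FG[OF g] in auto)
      also have "\<dots> = (\<Sum>B\<in>\<beta>0. \<integral>\<omega>. indicator B \<omega> * ?c B \<omega> \<partial>\<mu>)"
        by (intro sum.cong[OF refl] eq_cs) (use \<beta>0(2) FG[OF g] in auto)
      finally show "(\<integral>\<omega>. (\<Sum>B\<in>\<beta>0. indicator B (shift G g \<omega>) * ?c B (shift G g \<omega>)) \<partial>\<mu>)
          = (\<Sum>B\<in>\<beta>0. \<integral>\<omega>. indicator B \<omega> * ?c B \<omega> \<partial>\<mu>)" .
    qed
    also have "\<dots> \<le> real (card ?F) * \<kappa>" by (rule sum_bounded_above) (rule cost[OF \<beta>0])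
    finally show ?thesis by simp
  qed
  finally show ?thesis by simp
qed

text \<open>The entropy with respect to a partition is an infimum over boxes, so a single large box
  suffices for each error \<open>e\<close>.\<close>

lemma ks_entropy_le: "ks_entropy G \<mu> \<le> ennreal entropy_rate"
  unfolding ks_entropy_def
proof (rule SUP_least)
  fix \<beta> assume "\<beta> \<in> {\<alpha>. mu_partition \<mu> \<alpha> \<and> part_entropy \<mu> \<alpha> < \<infinity>}"
  then have part: "mu_partition \<mu> \<beta>" and ent: "part_entropy \<mu> \<beta> < \<infinity>" by auto
  show "entropy_wrt G \<mu> \<beta> \<le> ennreal entropy_rate"
  proof (rule ennreal_le_epsilon)
    fix e :: real assume e: "0 < e"
    \<comment> \<open>The three contributions in \<open>guess_cost_small\<close> add up to
      \<open>e / 2\<close> per site; the other half of \<open>e\<close> covers the limit in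
      \<open>n\<close>.\<close>
    then have "0 < e / 6" by simp
    from guess_cost_small[OF part ent this] obtain k guess \<theta> where g: "local_on (Lam G k) guess" "0 < \<theta>" "\<theta> < 1"
      and cost: "\<And>X. finite X \<Longrightarrow> X \<subseteq> \<beta> \<Longrightarrow>
        (\<Sum>B\<in>X. \<integral>\<omega>. indicator B \<omega> * (- log 2 (guess_prob guess \<theta> B \<omega>)) \<partial>\<mu>) \<le> 3 * (e / 6)" by blast
    let ?c = "\<lambda>n. real (card (Lam G n))"
    let ?B = "\<lambda>n. H (Lam G (n + k)) / ?c n + e / 2 + (1 / ln 2) / ?c n"
    have "(\<lambda>n. (1 / ln 2) / ?c n) \<longlonglongrightarrow> 0"
    proof (rule tendsto_divide_0[OF tendsto_const])
      have "filterlim ?c at_top sequentially"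
        by (rule filterlim_at_top_mono[OF filterlim_real_sequentially]) (simp add: card_Lam_ge1[OF index])
      then show "filterlim ?c at_infinity sequentially" by (rule filterlim_at_top_imp_at_infinity)
    qed
    then have "?B \<longlonglongrightarrow> entropy_rate + e / 2 + 0" by (intro tendsto_intros H_Lam_limit)
    then have "\<forall>\<^sub>F n in sequentially. ?B n < entropy_rate + e" using e by (intro order_tendstoD(2)[of ?B]) auto
    then have "\<forall>\<^sub>F n in sequentially. 0 < n \<and> ?B n < entropy_rate + e"
      using eventually_gt_at_top[of 0] by eventually_elim blast
    then obtain n where n: "0 < n" "?B n < entropy_rate + e"
      using eventually_happens'[OF sequentially_bot] by blast
    have c: "0 < ?c n" using card_Lam_ge1[OF index, of n] n(1) by simp
    let ?r = "H (Lam G (n + k)) + ?c n * (3 * (e / 6)) + 1 / ln 2"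
    have "part_entropy \<mu> (part_refine G \<mu> (Lam G n) \<beta>) \<le> ennreal ?r"
      unfolding part_entropy_def
    proof (rule infsum_ennreal_le)
      fix X assume X: "finite X" "X \<subseteq> part_refine G \<mu> (Lam G n) \<beta>"
      have "(\<Sum>C\<in>X. ennreal (ent_fun (prob C))) = ennreal (\<Sum>C\<in>X. ent_fun (prob C))"
        by (rule sum_ennreal) (simp add: ent_fun_nonneg)
      also have "\<dots> \<le> ennreal ?r"
        by (rule ennreal_leI[OF part_refine_cost[OF part g cost n(1) X]])
      finally show "(\<Sum>C\<in>X. ennreal (ent_fun (prob C))) \<le> ennreal ?r" .
    qed
    then have "part_entropy \<mu> (part_refine G \<mu> (Lam G n) \<beta>) / of_nat (card (Lam G n)) \<le> ennreal ?r / of_nat (card (Lam G n))"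
      by (rule divide_right_mono_ennreal)
    also have "\<dots> = ennreal (?r / ?c n)"
    proof -
      have "0 \<le> H (Lam G (n + k))"
        using H_ge[OF finite_Lam[OF index] Lam_subset, of "n + k"] entropy_rate_nonneg
        by (meson mult_nonneg_nonneg of_nat_0_le_iff order_trans)
      then have "0 \<le> ?r" using e by simp
      then show ?thesis using c divide_ennreal[of ?r "?c n"] by (simp add: ennreal_of_nat_eq_real_of_nat)
    qed
    also have "?r / ?c n = ?B n" using c by (simp add: field_simps)
    also have "ennreal (?B n) \<le> ennreal (entropy_rate + e)" using n(2) by (intro ennreal_leI) simp
    also have "\<dots> = ennreal entropy_rate + ennreal e" using e entropy_rate_nonneg by (simp add: ennreal_plus)
    finally have "part_entropy \<mu> (part_refine G \<mu> (Lam G n) \<beta>) / of_nat (card (Lam G n)) \<le> ennreal entropy_rate + ennreal e" .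
    moreover have "entropy_wrt G \<mu> \<beta> \<le> part_entropy \<mu> (part_refine G \<mu> (Lam G n) \<beta>) / of_nat (card (Lam G n))"
      unfolding entropy_wrt_def using n(1) by (intro INF_lower) simp
    ultimately show "entropy_wrt G \<mu> \<beta> \<le> ennreal entropy_rate + ennreal e" by simp
  qed
qed

lemma ks_entropy_eq: "ks_entropy G \<mu> = ennreal entropy_rate"
  using ks_entropy_le ks_entropy_ge by (rule antisym)

end

section \<open>From almost sure inequalities to the densities\<close>

context complexity_setting begin

lemma complexity_density:
  "AE \<omega> in \<mu>. upper_complexity_density \<phi> G f \<omega> = ks_entropy G \<mu> \<and> lower_complexity_density \<phi> G f \<omega> = ks_entropy G \<mu>"
proof -
  let ?r = "\<lambda>n \<omega>. K n \<omega> / real (card (Lam G n))"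
  \<comment> \<open>Errors \<open>1 / Suc j\<close> keep the number of almost sure events
    countable.\<close>
  have "AE \<omega> in \<mu>. \<forall>j. \<forall>\<^sub>F n in sequentially. ?r n \<omega> < entropy_rate + 1 / real (Suc j)"
    unfolding AE_all_countable by (intro allI upper_bound) simp
  moreover have "AE \<omega> in \<mu>. \<forall>j. \<forall>\<^sub>F n in sequentially. entropy_rate - 1 / real (Suc j) \<le> ?r n \<omega>"
    unfolding AE_all_countable by (intro allI lower_bound) simp
  ultimately show ?thesis using AE_K_finite
  proof eventually_elim
    case (elim \<omega>)
    have lim: "(\<lambda>n. ?r n \<omega>) \<longlonglongrightarrow> entropy_rate"
    proof (rule order_tendstoI)
      fix a assume "entropy_rate < a"
      then obtain j where j: "inverse (real (Suc j)) < a - entropy_rate" using reals_Archimedean[of "a - entropy_rate"] by auto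
      from elim(1) have "\<forall>\<^sub>F n in sequentially. ?r n \<omega> < entropy_rate + 1 / real (Suc j)" by blast
      then show "\<forall>\<^sub>F n in sequentially. ?r n \<omega> < a"
        by eventually_elim (use j in \<open>simp add: inverse_eq_divide\<close>)
    next
      fix a assume "a < entropy_rate"
      then obtain j where j: "inverse (real (Suc j)) < entropy_rate - a" using reals_Archimedean[of "entropy_rate - a"] by auto
      from elim(2) have "\<forall>\<^sub>F n in sequentially. entropy_rate - 1 / real (Suc j) \<le> ?r n \<omega>" by blast
      then show "\<forall>\<^sub>F n in sequentially. a < ?r n \<omega>"
        by eventually_elim (use j in \<open>simp add: inverse_eq_divide\<close>)
    qed
    let ?d = "\<lambda>n. ennreal_of_enat (pattern_complexity \<phi> G f n (restrict \<omega> (Lam G n))) / of_nat (card (Lam G n))"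
    have "\<forall>\<^sub>F n in sequentially. ennreal (?r n \<omega>) = ?d n"
      \<comment> \<open>\<open>n = 0\<close> is excluded because the box is empty there, and
        finiteness of the complexity is known for positive \<open>n\<close>.\<close>
      using eventually_gt_at_top[of 0]
    proof eventually_elim
      case (elim n)
      have c: "0 < real (card (Lam G n))" using card_Lam_ge1[OF index, of n] elim by simp
      obtain k where k: "kolm \<phi> (string n \<omega>) = enat k"
        using \<open>\<forall>n>0. kolm \<phi> (string n \<omega>) \<noteq> \<infinity>\<close> elim by auto
      then have "ennreal_of_enat (pattern_complexity \<phi> G f n (restrict \<omega> (Lam G n))) = ennreal (K n \<omega>)"
        by (simp add: pattern_complexity_def string_def K_def ennreal_of_nat_eq_real_of_nat)
      then show ?case using c divide_ennreal[of "K n \<omega>" "real (card (Lam G n))"]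
        by (simp add: K_def ennreal_of_nat_eq_real_of_nat)
    qed
    moreover have "(\<lambda>n. ennreal (?r n \<omega>)) \<longlonglongrightarrow> ennreal entropy_rate" using lim by (rule tendsto_ennrealI)
    ultimately have d: "?d \<longlonglongrightarrow> ks_entropy G \<mu>"
      unfolding ks_entropy_eq by (rule Lim_transform_eventually[rotated])
    show ?case unfolding upper_complexity_density_def lower_complexity_density_def
      using lim_imp_Limsup[OF sequentially_bot d] lim_imp_Liminf[OF sequentially_bot d] by simp
  qed
qed

end

theorem theorem3p1:
  fixes G :: "(int ^ 'd) set"
    and num :: "'a::finite \<Rightarrow> nat"
    and N :: nat
    and \<phi> :: "bool list \<Rightarrow> 'a list option"
    and f :: "int ^ 'd \<Rightarrow> nat"
    and S :: "(int ^ 'd \<Rightarrow> 'a) set"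
    and \<mu> :: "(int ^ 'd \<Rightarrow> 'a) measure"
  assumes "G = UNIV \<or> G = {g. \<forall>i. 0 \<le> g $ i}"
    and "bij_betw num UNIV {0..N}"
    and "additively_optimal num \<phi>"
    and "admissible_enum G f"
    and "subshift G S"
    and "\<mu> \<in> ergodic_measures G S"
  shows "AE \<omega> in \<mu>. upper_complexity_density \<phi> G f \<omega> = ks_entropy G \<mu> \<and>
                    lower_complexity_density \<phi> G f \<omega> = ks_entropy G \<mu>"
proof -
  have "\<mu> \<in> invariant_measures G S" using assms(6) by (simp add: ergodic_measures_def)
  then interpret complexity_setting G S \<mu> num N \<phi> f
    using assms by unfold_locales
  show ?thesis by (rule complexity_density)
qed

end
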